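(* Let $N \in \{8, 9, 16, 25\}$ and let $p$ be the prime dividing $N$. For integers $m \geq 1$ and $n \geq 1$ write $m = p^\alpha m'$ and $n = p^\beta n'$ with $\alpha, \beta \geq 0$ and $(m', N) = (n', N) = 1$. Let $a_0^{(N)}(m,n)$ denote the coefficient of $q^n$ in the canonical basis element $f_{0,m}^{(N)}$. Then for $\alpha \neq \beta$ the following congruences hold: \begin{align*} a_0^{(8)}(2^\alpha m', 2^\beta n') \equiv a_0^{(16)}(2^\alpha m', 2^\beta n') \equiv & 0 \pmod{2^{4(\alpha-\beta)+8}} & \text{if } \alpha > \beta, \\ a_0^{(8)}(2^\alpha m',2^\beta n') \equiv a_0^{(16)}(2^\alpha m', 2^\beta n') \equiv & 0 \pmod{2^{3(\beta-\alpha)+8}} & \text{if } \beta > \alpha, \\ a_0^{(9)}(3^\alpha m', 3^\beta n') \equiv & 0 \pmod{3^{3(\alpha - \beta) + 3}} & \text{if } \alpha > \beta, \\ a_0^{(9)}(3^\alpha m', 3^\beta n') \equiv & 0 \pmod{3^{2(\beta - \alpha) + 3}} & \text{if } \beta > \alpha, \\ a_0^{(25)}(5^\alpha m', 5^\beta n') \equiv & 0 \pmod{5^{2(\alpha - \beta) + 1}} & \text{if } \alpha > \beta, \\ a_0^{(25)}(5^\alpha m', 5^\beta n') \equiv & 0 \pmod{5^{(\beta - \alpha)+1}} & \text{if } \beta > \alpha. \end{align*}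
   Context: Let $q = e^{2\pi i z}$. For a positive integer $N$, $M_0^\sharp(N)$ denotes the space of weakly holomorphic modular functions of weight $0$ for $\Gamma_0(N)$ (holomorphic on the upper half-plane) whose only poles are at the cusp $\infty$ (i.e. holomorphic at all other cusps of $\Gamma_0(N)$). For $N \in \{8,9,16,25\}$ (where $\Gamma_0(N)$ has genus zero), for each integer $m \geq 0$ there is a unique $f_{0,m}^{(N)} \in M_0^\sharp(N)$ with Fourier expansion $f_{0,m}^{(N)}(z) = q^{-m} + \sum_{n\geq 1} a_0^{(N)}(m,n) q^n$; these form the canonical basis of $M_0^\sharp(N)$, and all coefficients $a_0^{(N)}(m,n)$ are integers. *)

theory Defs
  imports
    "HOL-Complex_Analysis.Complex_Analysis"
    "HOL-Number_Theory.Number_Theory"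
begin

definition upper_half_plane :: "complex set" where
  "upper_half_plane = {z. Im z > 0}"

definition SL2Z :: "(int ^ 2 ^ 2) set" where
  "SL2Z = {A. det A = 1}"

definition Gamma0 :: "nat \<Rightarrow> (int ^ 2 ^ 2) set" where
  "Gamma0 N = {A \<in> SL2Z. int N dvd A $ 2 $ 1}"

definition moebius :: "int ^ 2 ^ 2 \<Rightarrow> complex \<Rightarrow> complex" where
  "moebius A z =
     (of_int (A $ 1 $ 1) * z + of_int (A $ 1 $ 2)) /
     (of_int (A $ 2 $ 1) * z + of_int (A $ 2 $ 2))"

text \<open>
  The function \<open>f\<close> on the upper half-plane is a function of
  \<open>q\<^sub>h = exp (2 \<pi> i z / h)\<close> which is meromorphic at \<open>q\<^sub>h = 0\<close>, with Laurent expansion \<open>F\<close>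
  there. Since \<open>F\<close> is a formal Laurent series, only finitely many negative powers occur.
\<close>
definition has_q_expansion :: "(complex \<Rightarrow> complex) \<Rightarrow> nat \<Rightarrow> complex fls \<Rightarrow> bool" where
  "has_q_expansion f h F \<longleftrightarrow>
     (\<exists>g. g has_laurent_expansion F \<and>
        (\<forall>z\<in>upper_half_plane. f z = g (exp (2 * of_real pi * \<i> * z / of_nat h))))"

text \<open>
  Weakly holomorphic modular functions of weight 0 for \<open>\<Gamma>\<^sub>0(N)\<close> whose only poles are at the
  cusp \<open>\<infinity>\<close>. Every cusp has the form \<open>\<gamma> \<infinity>\<close> with \<open>\<gamma>\<close> in \<open>SL\<^sub>2(\<int>)\<close>. The stabiliser of \<open>\<infinity>\<close> in
  \<open>SL\<^sub>2(\<int>)\<close> is contained in \<open>\<Gamma>\<^sub>0(N)\<close>, so the cusp \<open>\<gamma> \<infinity>\<close> is equivalent to \<open>\<infinity>\<close> under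
  \<open>\<Gamma>\<^sub>0(N)\<close> if and only if \<open>\<gamma>\<close> lies in \<open>\<Gamma>\<^sub>0(N)\<close>. Holomorphy at a cusp does not depend on which
  period \<open>h > 0\<close> of \<open>f \<circ> \<gamma>\<close> is used for the expansion.
\<close>
definition M0_sharp :: "nat \<Rightarrow> (complex \<Rightarrow> complex) set" where
  "M0_sharp N = {f.
     f holomorphic_on upper_half_plane \<and>
     (\<forall>A\<in>Gamma0 N. \<forall>z\<in>upper_half_plane. f (moebius A z) = f z) \<and>
     (\<exists>F. has_q_expansion f 1 F) \<and>
     (\<forall>A\<in>SL2Z - Gamma0 N. \<exists>h>0. \<exists>F.
        has_q_expansion (\<lambda>z. f (moebius A z)) h F \<and> fls_subdegree F \<ge> 0)}"

text \<open>
  \<open>f\<close> is the element \<open>f\<^sub>0\<^sub>,\<^sub>m = q\<^sup>-\<^sup>m + O(q)\<close> of the canonical basis, and \<open>F\<close> is its Fourier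
  expansion: the coefficient of \<open>q\<^sup>n\<close> in \<open>f\<^sub>0\<^sub>,\<^sub>m\<close> is \<open>fls_nth F n\<close>.
\<close>
definition canonical_basis_element ::
    "nat \<Rightarrow> nat \<Rightarrow> (complex \<Rightarrow> complex) \<Rightarrow> complex fls \<Rightarrow> bool" where
  "canonical_basis_element N m f F \<longleftrightarrow>
     f \<in> M0_sharp N \<and> has_q_expansion f 1 F \<and>
     (\<forall>n\<le>0. fls_nth F n = (if n = - int m then 1 else 0))"

text \<open>
  Divisibility by \<open>M\<close> in \<open>\<int>\<close> for a complex number; in particular the number is an integer.
\<close>
definition cong_0_mod :: "complex \<Rightarrow> int \<Rightarrow> bool" where
  "cong_0_mod x M \<longleftrightarrow> (\<exists>a::int. x = of_int a \<and> [a = 0] (mod M))"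

end

theory Submission
  imports Defs
begin

text \<open>
  Write \<open>U f (z) = (1/p) \<Sum> f ((z + j) / p)\<close> and \<open>V f (z) = f (p z)\<close>. If \<open>p\<close> divides \<open>N\<close>, then \<open>U\<close> and \<open>V\<close>
  exchange the spaces of levels \<open>p N\<close> and \<open>N\<close>. So by uniqueness the canonical basis element of level
  \<open>p N\<close> and order \<open>p m\<close> is \<open>V\<close> of the one of level \<open>N\<close> and order \<open>m\<close>, and \<open>U\<close> kills those of order prime
  to \<open>p\<close>. This reduces everything to the prime levels \<open>2, 3, 5\<close>.

  At level \<open>p\<close> let \<open>\<psi> = (\<eta>(z) / \<eta>(p z))^(24/(p-1))\<close>, let \<open>v = \<kappa> / \<psi>\<close> be its image under the Fricke involution
  and let \<open>f\<^sub>m = P\<^sub>m(\<psi>)\<close> be the canonical basis. Since \<open>p U f + f|W\<close> is invariant under the full modular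
  group for every \<open>f\<close> of level \<open>p\<close>, comparing poles at both cusps gives
  \<open>p U f\<^sub>m = p f\<^sub>m\<^sub>/\<^sub>p + ([p dvd m] p - 1) (P\<^sub>m(v) - P\<^sub>m(0))\<close>, where \<open>f\<^sub>m\<^sub>/\<^sub>p\<close> is absent unless \<open>p\<close> divides \<open>m\<close>.
  The case \<open>m = p\<close> yields the modular equation between \<open>\<psi>(z)\<close> and \<open>\<psi>(p z)\<close>, whose coefficients are so
  divisible by \<open>p\<close> that \<open>U\<close> maps \<open>t \<int>[t]\<close> into \<open>p^c t \<int>[t]\<close> for \<open>t = p^a / \<psi>\<close>. Iterating \<open>U\<close> on \<open>f\<^sub>m\<close> proves
  the congruences for \<open>\<beta> > \<alpha>\<close>. The case \<open>\<alpha> > \<beta>\<close> follows from \<open>n a(m, n) = m a(n, m)\<close>, which holds because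
  \<open>P\<^sub>m(\<psi>) d P\<^sub>n(\<psi>)\<close> is exact and has no residue.
\<close>

subsection \<open>The q-Pochhammer symbol\<close>

text \<open>The analytic input is the behaviour of eta under z -> -1/z. Only sixth powers of eta
  occur, because 24/(p-1) = 6 e, and the sixth power is exactly what comparing theta functions
  yields without choosing a root. Identities between modular functions are read off from principal
  parts, since a function of level N that is bounded at all cusps is constant. The exponents arise
  as follows. As v = p^(3e-a) t, and U itself costs a division by p, the difference of U f_m and
  f_(m/p) lies in p^(3e-a-1) t Z[t]. Each of the remaining \<beta>-\<alpha>-1 applications of U
  gains p^c, and t contributes p^a to every coefficient of q^n. The total is c (\<beta>-\<alpha>) +
  3e-1-c, where 3e-1-c is 8, 3, 1; duality replaces c by c+1. The delicate case is U on t itself. On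
  t^l with l \<ge> 2 the relation \<psi> t = p^a supplies the divisibility, but p U t has to be
  computed exactly. It is t A(v)/v, where A is the polynomial with coefficients
  \<open>Acoeff\<close>, and c+1 is the p-adic valuation of the linear coefficient of A: 48, 270 or
  1575. This is why explicit coefficients of powers of \<psi> are needed.\<close>

definition qpoch :: "complex \<Rightarrow> complex \<Rightarrow> complex" where
  "qpoch x q = (\<Prod>n. 1 - x * q ^ n)"

lemma qpoch_convergent:
  fixes q x :: complex
  assumes "norm q < 1"
  shows "convergent_prod (\<lambda>n. 1 - x * q ^ n)"
proof -
  have "summable (\<lambda>n. norm x * norm q ^ n)"
    using assms by (intro summable_mult summable_geometric) auto
  moreover have "(\<lambda>n. norm (1 - x * q ^ n - 1)) = (\<lambda>n. norm x * norm q ^ n)"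
    by (simp add: norm_mult norm_power)
  ultimately have "summable (\<lambda>n. norm (1 - x * q ^ n - 1))"
    by (simp only:)
  thus ?thesis
    by (intro abs_convergent_prod_imp_convergent_prod summable_imp_abs_convergent_prod)
qed

lemma qpoch_LIMSEQ:
  assumes "norm q < 1"
  shows "(\<lambda>N. \<Prod>n<N. 1 - x * q ^ n) \<longlonglongrightarrow> qpoch x q"
  using convergent_prod_LIMSEQ[OF qpoch_convergent[OF assms]]
  unfolding qpoch_def LIMSEQ_lessThan_iff_atMost .

lemma qpoch_nonzero:
  assumes "norm q < 1" "\<And>n. x * q ^ n \<noteq> 1"
  shows "qpoch x q \<noteq> 0"
  unfolding qpoch_def
  by (rule prodinf_nonzero[OF qpoch_convergent]) (use assms in auto)

lemma qpoch_rec: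
  assumes q: "norm q < 1"
  shows "qpoch x q = (1 - x) * qpoch (x * q) q"
proof -
  have "(\<lambda>N. (1 - x) * (\<Prod>n<N. 1 - (x * q) * q ^ n)) \<longlonglongrightarrow> (1 - x) * qpoch (x * q) q"
    by (intro tendsto_intros qpoch_LIMSEQ q)
  also have "(\<lambda>N. (1 - x) * (\<Prod>n<N. 1 - (x * q) * q ^ n)) = (\<lambda>N. \<Prod>n<Suc N. 1 - x * q ^ n)"
    by (simp add: prod.lessThan_Suc_shift mult_ac del: prod.lessThan_Suc)
  finally have "(\<lambda>N. \<Prod>n<Suc N. 1 - x * q ^ n) \<longlonglongrightarrow> (1 - x) * qpoch (x * q) q" .
  moreover have "(\<lambda>N. \<Prod>n<Suc N. 1 - x * q ^ n) \<longlonglongrightarrow> qpoch x q"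
    using qpoch_LIMSEQ[OF q, of x] by (rule filterlim_sequentially_Suc[THEN iffD2])
  ultimately show ?thesis
    using LIMSEQ_unique by blast
qed

lemma qpoch_mult_minus:
  assumes q: "norm q < 1"
  shows "qpoch x q * qpoch (- x) q = qpoch (x\<^sup>2) (q\<^sup>2)"
proof -
  have q2: "norm (q\<^sup>2) < 1"
    using q by (simp add: norm_power power_less_one_iff abs_square_less_1)
  have "(\<lambda>N. (\<Prod>n<N. 1 - x * q ^ n) * (\<Prod>n<N. 1 - (- x) * q ^ n)) \<longlonglongrightarrow> qpoch x q * qpoch (- x) q"
    by (intro tendsto_intros qpoch_LIMSEQ q)
  also have "(\<lambda>N. (\<Prod>n<N. 1 - x * q ^ n) * (\<Prod>n<N. 1 - (- x) * q ^ n)) =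
             (\<lambda>N. \<Prod>n<N. 1 - x\<^sup>2 * (q\<^sup>2) ^ n)"
    unfolding prod.distrib[symmetric]
    by (intro ext prod.cong refl) (simp add: algebra_simps power2_eq_square power_mult_distrib)
  finally show ?thesis
    using qpoch_LIMSEQ[OF q2] LIMSEQ_unique by blast
qed

lemma qpoch_split_parity:
  assumes q: "norm q < 1"
  shows "qpoch x q = qpoch x (q\<^sup>2) * qpoch (x * q) (q\<^sup>2)"
proof -
  have q2: "norm (q\<^sup>2) < 1"
    using q by (simp add: norm_power power_less_one_iff abs_square_less_1)
  have "(\<lambda>N. (\<Prod>n<N. 1 - x * (q\<^sup>2) ^ n) * (\<Prod>n<N. 1 - (x * q) * (q\<^sup>2) ^ n))
          \<longlonglongrightarrow> qpoch x (q\<^sup>2) * qpoch (x * q) (q\<^sup>2)"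
    by (intro tendsto_intros qpoch_LIMSEQ q2)
  also have "(\<lambda>N. (\<Prod>n<N. 1 - x * (q\<^sup>2) ^ n) * (\<Prod>n<N. 1 - (x * q) * (q\<^sup>2) ^ n)) =
             (\<lambda>N. \<Prod>n<2 * N. 1 - x * q ^ n)"
  proof
    fix N
    show "(\<Prod>n<N. 1 - x * (q\<^sup>2) ^ n) * (\<Prod>n<N. 1 - (x * q) * (q\<^sup>2) ^ n) = (\<Prod>n<2 * N. 1 - x * q ^ n)"
    proof (induction N)
      case (Suc N)
      have "(q\<^sup>2) ^ N = q ^ (2 * N)" "(q ^ N)\<^sup>2 = q ^ (2 * N)"
        by (simp_all add: power_mult [symmetric] mult.commute)
      with Suc show ?case by (simp add: mult_ac)
    qed simp
  qed
  finally have "(\<lambda>N. \<Prod>n<2 * N. 1 - x * q ^ n) \<longlonglongrightarrow> qpoch x (q\<^sup>2) * qpoch (x * q) (q\<^sup>2)" .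
  moreover have "(\<lambda>N. \<Prod>n<2 * N. 1 - x * q ^ n) \<longlonglongrightarrow> qpoch x q"
    by (rule filterlim_compose[OF qpoch_LIMSEQ[OF q]]) (simp add: mult_nat_left_at_top)
  ultimately show ?thesis
    using LIMSEQ_unique by blast
qed

lemma qpoch_self_nonzero:
  assumes "norm q < 1"
  shows "qpoch q q \<noteq> 0"
proof (rule qpoch_nonzero[OF assms])
  fix n
  have "norm (q ^ Suc n) < 1"
    unfolding norm_power using assms by (cases "q = 0") (auto intro!: power_Suc_less_one simp del: power_Suc)
  hence "norm (q * q ^ n) < 1" by simp
  thus "q * q ^ n \<noteq> 1" by force
qed

text \<open>Euler's identity between partitions into distinct parts and into odd parts. Split
  \<open>qpoch q q\<close> by parity and rewrite its even half
  \<open>qpoch (q\<^sup>2) (q\<^sup>2)\<close> as \<open>qpoch q q * qpoch (- q) q\<close>; the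
  nonzero factor \<open>qpoch q q\<close> cancels.\<close>

lemma qpoch_euler:
  assumes q: "norm q < 1"
  shows "qpoch (- q) q * qpoch q (q\<^sup>2) = 1"
proof -
  have q2: "norm (q\<^sup>2) < 1"
    using q by (simp add: norm_power power_less_one_iff abs_square_less_1)
  have "qpoch q q = qpoch q (q\<^sup>2) * qpoch (q\<^sup>2) (q\<^sup>2)"
    using qpoch_split_parity[OF q, of q] by (simp add: power2_eq_square)
  also have "qpoch (q\<^sup>2) (q\<^sup>2) = qpoch q q * qpoch (- q) q"
    using qpoch_mult_minus[OF q, of q] by simp
  finally show ?thesis
    using qpoch_self_nonzero[OF q] by (simp add: field_simps)
qed

text \<open>Weierstrass' test with majorant M r^n, where r < 1 is the maximum of |h| on K. Both
  arguments vary because holomorphy is needed in u for the theta function, with fixed base, and in q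
  for the Euler product, where both arguments are q.\<close>

lemma qpoch_uniform_limit:
  assumes K: "compact K" and g: "continuous_on K g" and h: "continuous_on K h"
    and h1: "\<And>w. w \<in> K \<Longrightarrow> norm (h w) < 1"
  shows "uniform_limit K (\<lambda>N w. \<Prod>n<N. 1 - g w * h w ^ n) (\<lambda>w. qpoch (g w) (h w)) sequentially"
proof (cases "K = {}")
  case False
  obtain M where M: "\<And>w. w \<in> K \<Longrightarrow> norm (g w) \<le> M"
    using compact_imp_bounded[OF compact_continuous_image[OF g K]] unfolding bounded_iff by auto
  obtain w0 where w0: "w0 \<in> K" "\<And>w. w \<in> K \<Longrightarrow> norm (h w) \<le> norm (h w0)"
    using continuous_attains_sup[OF K False, of "\<lambda>w. norm (h w)"] h
    by (auto intro: continuous_intros)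
  define r where "r = norm (h w0)"
  have r: "r < 1" "r \<ge> 0" using h1[OF w0(1)] by (auto simp: r_def)
  have M0: "M \<ge> 0" using M[OF w0(1)] norm_ge_zero order_trans by blast
  have "uniformly_convergent_on K (\<lambda>N w. \<Sum>n<N. norm (1 - g w * h w ^ n - 1))"
  proof (rule Weierstrass_m_test'_ev)
    show "\<forall>\<^sub>F n in sequentially. \<forall>w\<in>K. norm (norm (1 - g w * h w ^ n - 1)) \<le> M * r ^ n"
      using M w0(2) M0
      by (intro always_eventually allI ballI)
         (simp add: norm_mult norm_power r_def mult_mono power_mono)
    show "summable (\<lambda>n. M * r ^ n)"
      using r by (intro summable_mult summable_geometric) auto
  qed
  hence "uniformly_convergent_on K (\<lambda>N w. \<Prod>n<N. 1 - g w * h w ^ n)"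
    by (intro uniformly_convergent_on_prod' K continuous_intros g h)
  then obtain l where l: "uniform_limit K (\<lambda>N w. \<Prod>n<N. 1 - g w * h w ^ n) l sequentially"
    by (auto simp: uniformly_convergent_on_def)
  have "l w = qpoch (g w) (h w)" if "w \<in> K" for w
    using tendsto_uniform_limitI[OF l that] qpoch_LIMSEQ[OF h1[OF that]] LIMSEQ_unique by blast
  thus ?thesis
    using l uniform_limit_cong'[of K "\<lambda>N w. \<Prod>n<N. 1 - g w * h w ^ n" "\<lambda>N w. \<Prod>n<N. 1 - g w * h w ^ n" l]
    by auto
qed auto

lemma holomorphic_qpoch:
  assumes S: "open S" and g: "g holomorphic_on S" and h: "h holomorphic_on S"
    and h1: "\<And>w. w \<in> S \<Longrightarrow> norm (h w) < 1"
  shows "(\<lambda>w. qpoch (g w) (h w)) holomorphic_on S"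
proof (rule holomorphic_uniform_sequence[OF S])
  show "(\<lambda>w. \<Prod>n<N. 1 - g w * h w ^ n) holomorphic_on S" for N
    by (intro holomorphic_intros g h)
  fix w assume "w \<in> S"
  then obtain d where d: "d > 0" "cball w d \<subseteq> S"
    using S open_contains_cball by blast
  have "uniform_limit (cball w d) (\<lambda>N w. \<Prod>n<N. 1 - g w * h w ^ n) (\<lambda>w. qpoch (g w) (h w)) sequentially"
  proof (rule qpoch_uniform_limit)
    show "continuous_on (cball w d) g" "continuous_on (cball w d) h"
      using g h d holomorphic_on_imp_continuous_on holomorphic_on_subset by metis+
  qed (use d h1 in auto)
  thus "\<exists>d>0. cball w d \<subseteq> S \<and>
     uniform_limit (cball w d) (\<lambda>N w. \<Prod>n<N. 1 - g w * h w ^ n) (\<lambda>w. qpoch (g w) (h w)) sequentially"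
    using d by blast
qed

subsection \<open>An odd theta function and the inversion formula for the sixth power of eta\<close>

definition qe :: "complex \<Rightarrow> complex" where
  "qe z = exp (2 * of_real pi * \<i> * z)"

lemma norm_qe: "norm (qe z) = exp (- (2 * pi * Im z))"
  by (simp add: qe_def)

lemma qe_nonzero [simp]: "qe z \<noteq> 0"
  by (simp add: qe_def)

lemma norm_qe_less_1: "Im z > 0 \<Longrightarrow> norm (qe z) < 1"
  by (simp add: norm_qe)

lemma qe_add: "qe (x + y) = qe x * qe y"
  and qe_diff: "qe (x - y) = qe x / qe y"
  and qe_minus: "qe (- x) = 1 / qe x"
  by (simp_all add: qe_def ring_distribs exp_add exp_diff exp_minus field_simps)

lemma qe_0 [simp]: "qe 0 = 1"
  by (simp add: qe_def)

lemma qe_power: "qe z ^ n = qe (of_nat n * z)"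
  by (simp add: qe_def exp_of_nat_mult [symmetric] mult_ac)

lemma qe_eq_1_iff: "qe z = 1 \<longleftrightarrow> z \<in> \<int>"
proof
  assume "qe z = 1"
  then obtain n :: int where "Re (2 * of_real pi * \<i> * z) = 0" "Im (2 * of_real pi * \<i> * z) = of_int (2 * n) * pi"
    unfolding exp_eq_1 qe_def by auto
  hence "z = of_int n" by (auto simp: complex_eq_iff)
  thus "z \<in> \<int>" by simp
next
  assume "z \<in> \<int>"
  then obtain n where "z = of_int n" by (auto elim: Ints_cases)
  thus "qe z = 1"
    by (auto simp: qe_def exp_eq_1 intro!: exI[of _ n])
qed

lemma qe_of_int [simp]: "qe (of_int n) = 1" and qe_of_nat [simp]: "qe (of_nat m) = 1" and qe_1 [simp]: "qe 1 = 1"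
  by (simp_all add: qe_eq_1_iff)

lemma qe_half [simp]: "qe (1 / 2) = -1"
  by (simp add: qe_def mult.commute)

lemma holomorphic_qe [holomorphic_intros]:
  "f holomorphic_on S \<Longrightarrow> (\<lambda>z. qe (f z)) holomorphic_on S"
  unfolding qe_def by (intro holomorphic_intros)

lemma DERIV_qe [derivative_intros]:
  "(f has_field_derivative f') (at z within S) \<Longrightarrow>
     ((\<lambda>z. qe (f z)) has_field_derivative (2 * of_real pi * \<i> * f' * qe (f z))) (at z within S)"
  unfolding qe_def by (auto intro!: derivative_eq_intros)

text \<open>Up to a factor independent of u this is Jacobi's theta_1 in product form. The factor
  \<open>qe (- u / 2)\<close> makes it odd and turns the period 1 into a change of sign.\<close>

definition theta_odd :: "complex \<Rightarrow> complex \<Rightarrow> complex" where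
  "theta_odd \<tau> u = qe (- u / 2) * qpoch (qe u) (qe \<tau>) * qpoch (qe (\<tau> - u)) (qe \<tau>)"

lemma holomorphic_theta_odd:
  assumes "Im \<tau> > 0"
  shows "theta_odd \<tau> holomorphic_on S"
proof -
  have "(\<lambda>u. qpoch (qe u) (qe \<tau>)) holomorphic_on UNIV" "(\<lambda>u. qpoch (qe (\<tau> - u)) (qe \<tau>)) holomorphic_on UNIV"
    using norm_qe_less_1[OF assms] by (auto intro!: holomorphic_qpoch holomorphic_intros)
  hence "theta_odd \<tau> holomorphic_on UNIV"
    unfolding theta_odd_def by (intro holomorphic_intros) auto
  thus ?thesis by (rule holomorphic_on_subset) auto
qed

lemma theta_odd_add_1: "theta_odd \<tau> (u + 1) = - theta_odd \<tau> u"
proof -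
  have 1: "qe (u + 1) = qe u" "qe (\<tau> - (u + 1)) = qe (\<tau> - u)"
    by (simp_all add: qe_add qe_diff)
  have "- (u + 1) / 2 = - u / 2 - 1 / 2" by (simp add: field_simps)
  hence 2: "qe (- (u + 1) / 2) = - qe (- u / 2)"
    by (simp only: qe_diff qe_half) simp
  show ?thesis unfolding theta_odd_def 1 2 by simp
qed

lemma theta_odd_add_tau:
  assumes "Im \<tau> > 0"
  shows "theta_odd \<tau> (u + \<tau>) = - qe (- \<tau> / 2 - u) * theta_odd \<tau> u"
proof -
  define q x where "q = qe \<tau>" and "x = qe u"
  have q: "norm q < 1" using norm_qe_less_1[OF assms] by (simp add: q_def)
  have x0: "x \<noteq> 0" "q \<noteq> 0" by (simp_all add: x_def q_def)
  have e: "qe (u + \<tau>) = x * q" "qe (\<tau> - (u + \<tau>)) = 1 / x" "qe (\<tau> - u) = q / x"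
    by (simp_all add: qe_add qe_diff qe_minus x_def q_def field_simps)
  have "- (u + \<tau>) / 2 = (- u / 2) + (- \<tau> / 2)" by (simp add: field_simps)
  hence e2: "qe (- (u + \<tau>) / 2) = qe (- u / 2) * qe (- \<tau> / 2)"
    by (simp only: qe_add)
  have e3: "qe (- \<tau> / 2 - u) = qe (- \<tau> / 2) / x"
    by (simp add: qe_diff x_def)
  have r: "qpoch x q = (1 - x) * qpoch (x * q) q" "qpoch (1 / x) q = (1 - 1 / x) * qpoch (q / x) q"
    using qpoch_rec[OF q, of x] qpoch_rec[OF q, of "1 / x"] by simp_all
  show ?thesis
    unfolding theta_odd_def e e2 e3 q_def[symmetric] x_def[symmetric] r using x0
    by (simp add: field_simps)
qed

lemma theta_odd_minus:
  assumes "Im \<tau> > 0"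
  shows "theta_odd \<tau> (- u) = - theta_odd \<tau> u"
proof -
  define q x y where "q = qe \<tau>" and "x = qe u" and "y = qe (u / 2)"
  have q: "norm q < 1" using norm_qe_less_1[OF assms] by (simp add: q_def)
  have xy: "x = y * y"
    unfolding x_def y_def by (simp add: qe_add [symmetric])
  have y0: "y \<noteq> 0" by (simp add: y_def)
  have e: "qe (- u) = 1 / x" "qe (\<tau> - - u) = q * x" "qe (\<tau> - u) = q / x"
    by (simp_all add: qe_add qe_diff qe_minus x_def q_def)
  have e2: "qe (- u / 2) = 1 / y" "qe (- (- u) / 2) = y"
    using qe_minus[of "u / 2"] by (simp_all add: y_def)
  have r: "qpoch x q = (1 - x) * qpoch (q * x) q" "qpoch (1 / x) q = (1 - 1 / x) * qpoch (q / x) q"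
    using qpoch_rec[OF q, of x] qpoch_rec[OF q, of "1 / x"] by (simp_all add: mult.commute)
  show ?thesis
    unfolding theta_odd_def e e2 q_def[symmetric] x_def[symmetric] r
    unfolding xy using y0
    by (simp add: field_simps)
qed

lemma theta_odd_nonzero:
  assumes "Im \<tau> > 0" "\<And>n. u + of_int n * \<tau> \<notin> \<int>"
  shows "theta_odd \<tau> u \<noteq> 0"
proof -
  have *: "qe v * qe \<tau> ^ n = qe (v + of_nat n * \<tau>)" for v n
    by (simp add: qe_add qe_power)
  show ?thesis
    unfolding theta_odd_def mult_eq_0_iff de_Morgan_disj
  proof (intro conjI qpoch_nonzero norm_qe_less_1 assms)
    fix n :: nat
    show "qe u * qe \<tau> ^ n \<noteq> 1"
      unfolding * qe_eq_1_iff using assms(2)[of "int n"] by simp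
    have "\<tau> - u + of_nat n * \<tau> = - (u + of_int (- int n - 1) * \<tau>)"
      by (simp add: algebra_simps)
    thus "qe (\<tau> - u) * qe \<tau> ^ n \<noteq> 1"
      unfolding * qe_eq_1_iff using assms(2)[of "- int n - 1"] minus_in_Ints_iff by metis
  qed auto
qed

lemma theta_odd_0 [simp]: "Im \<tau> > 0 \<Longrightarrow> theta_odd \<tau> 0 = 0"
  using theta_odd_minus[of \<tau> 0] by simp

definition euler_phi :: "complex \<Rightarrow> complex" where
  "euler_phi q = qpoch q q"

text \<open>Splitting off \<open>1 - qe u\<close> from the first product isolates the simple zero;
  each of the two remaining products is \<open>euler_phi (qe \<tau>)\<close> at u = 0.\<close>

lemma theta_odd_deriv_0:
  assumes "Im \<tau> > 0"
  shows "(theta_odd \<tau> has_field_derivative (- 2 * of_real pi * \<i> * euler_phi (qe \<tau>) ^ 2)) (at 0)"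
proof -
  define q where "q = qe \<tau>"
  have q: "norm q < 1" using norm_qe_less_1[OF assms] by (simp add: q_def)
  define P where "P = (\<lambda>u. qe (- u / 2) * qpoch (qe u * q) q * qpoch (qe (\<tau> - u)) q)"
  have "P holomorphic_on UNIV"
    unfolding P_def by (intro holomorphic_intros holomorphic_qpoch) (use q in auto)
  then obtain P' where P': "(P has_field_derivative P') (at 0)"
    by (metis UNIV_I open_UNIV holomorphic_derivI)
  have eq: "theta_odd \<tau> = (\<lambda>u. (1 - qe u) * P u)"
    unfolding theta_odd_def P_def q_def[symmetric]
    by (rule ext, subst qpoch_rec[OF q]) (simp add: mult_ac)
  have P0: "P 0 = euler_phi q ^ 2"
    by (simp add: P_def q_def euler_phi_def power2_eq_square)
  show ?thesis
    unfolding eq q_def[symmetric]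
    by (rule derivative_eq_intros P' refl)+ (simp add: P0)
qed

lemma theta_odd_half_periods:
  assumes "Im \<tau> > 0"
  shows "theta_odd \<tau> (1/2) * theta_odd \<tau> (\<tau>/2) * theta_odd \<tau> ((1 + \<tau>)/2) = - 2 / qe (\<tau> / 2)"
proof -
  \<comment> \<open>The square root of q. At the half periods all products have base s^2, with
    arguments -1 and -s^2, twice s, and twice -s. The pairs s, -s combine, and the square of Euler's
    identity appears; the 2 is the factor 1 - x at x = -1.\<close>
  define s where "s = qe (\<tau> / 2)"
  have q2: "qe \<tau> = s\<^sup>2"
    unfolding s_def by (simp add: qe_power)
  have q: "norm (s\<^sup>2) < 1" using norm_qe_less_1[OF assms] by (simp add: q2)
  hence s: "norm s < 1" by (simp add: norm_power abs_square_less_1)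
  have s0: "s \<noteq> 0" by (simp add: s_def)
  have a: "qe (\<tau> - 1/2) = - (s\<^sup>2)"
    using q2 by (simp add: qe_diff)
  have b: "qe (\<tau> / 2) = s" "qe (\<tau> - \<tau> / 2) = s"
    by (simp_all add: s_def)
  have h1: "(1 + \<tau>) / 2 = 1 / 2 + \<tau> / 2" and h2: "\<tau> - (1 / 2 + \<tau> / 2) = \<tau> / 2 - 1 / 2"
    by (simp_all add: field_simps)
  have c: "qe ((1 + \<tau>)/2) = - s" "qe (\<tau> - (1 + \<tau>) / 2) = - s"
    unfolding h1 h2 unfolding qe_add qe_diff qe_half s_def by simp_all
  have h: "- (1 / 2) / 2 + (- (\<tau> / 2) / 2) + (- ((1 + \<tau>) / 2) / 2) = - (\<tau> / 2) - 1 / 2"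
    by (simp add: field_simps)
  have "qe (- (\<tau> / 2) - 1 / 2) = - 1 / s"
    unfolding qe_diff qe_minus by (simp add: s_def)
  hence e: "qe (- (1 / 2) / 2) * qe (- (\<tau> / 2) / 2) * qe (- ((1 + \<tau>)/2) / 2) = - 1 / s"
    unfolding h [symmetric] qe_add .
  have "theta_odd \<tau> (1/2) * theta_odd \<tau> (\<tau>/2) * theta_odd \<tau> ((1 + \<tau>)/2) =
     (qe (- (1 / 2) / 2) * qe (- (\<tau> / 2) / 2) * qe (- ((1 + \<tau>)/2) / 2)) *
     (qpoch (-1) (s\<^sup>2) * qpoch (- (s\<^sup>2)) (s\<^sup>2) * (qpoch s (s\<^sup>2) * qpoch (- s) (s\<^sup>2))\<^sup>2)"
    unfolding theta_odd_def a b c q2 qe_half power2_eq_square[of "qpoch s (s\<^sup>2) * qpoch (- s) (s\<^sup>2)"]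
    by (simp only: mult_ac)
  also have "qpoch (-1) (s\<^sup>2) = 2 * qpoch (- (s\<^sup>2)) (s\<^sup>2)"
    using qpoch_rec[OF q, of "-1"] by simp
  also have "qpoch s (s\<^sup>2) * qpoch (- s) (s\<^sup>2) = qpoch (s\<^sup>2) ((s\<^sup>2)\<^sup>2)"
    by (rule qpoch_mult_minus[OF q])
  also have "2 * qpoch (- (s\<^sup>2)) (s\<^sup>2) * qpoch (- (s\<^sup>2)) (s\<^sup>2) * (qpoch (s\<^sup>2) ((s\<^sup>2)\<^sup>2))\<^sup>2 =
     2 * (qpoch (- (s\<^sup>2)) (s\<^sup>2) * qpoch (s\<^sup>2) ((s\<^sup>2)\<^sup>2))\<^sup>2"
    by (simp only: power_mult_distrib) (simp add: power2_eq_square mult_ac)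
  also have "\<dots> = 2" unfolding qpoch_euler[OF q] by simp
  finally show ?thesis
    unfolding e by (simp add: s_def)
qed

section \<open>Liouville's theorem on the torus and uniqueness of the theta function\<close>

lemma periodic_of_int:
  fixes f :: "complex \<Rightarrow> 'a"
  assumes "\<And>u. f (u + p) = f u"
  shows "f (u + of_int n * p) = f u"
proof (induction n rule: int_induct[where k = 0])
  case (step1 i)
  thus ?case using assms[of "u + of_int i * p"] by (simp add: ring_distribs add_ac)
next
  case (step2 i)
  thus ?case using assms[of "u + of_int (i - 1) * p"] by (simp add: ring_distribs add_ac)
qed simp

lemma doubly_periodic_entire_imp_constant:
  assumes hol: "g holomorphic_on UNIV" and \<tau>: "Im \<tau> > 0"
    and per: "\<And>u. g (u + 1) = g u" "\<And>u. g (u + \<tau>) = g u"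
  shows "g u = g v"
proof -
  define K where "K = (\<lambda>(x, y). of_real x + of_real y * \<tau>) ` ({0..1} \<times> {0..1::real})"
  have "compact K"
    unfolding K_def case_prod_unfold
    by (intro compact_continuous_image compact_Times continuous_intros) auto
  hence "bounded (g ` K)"
    by (intro compact_imp_bounded compact_continuous_image holomorphic_on_imp_continuous_on
          holomorphic_on_subset[OF hol]) auto
  moreover have "range g \<subseteq> g ` K"
  proof safe
    fix u
    define y where "y = Im u / Im \<tau>"
    define x where "x = Re u - y * Re \<tau>"
    have u: "u = of_real x + of_real y * \<tau>"
      using \<tau> by (simp add: complex_eq_iff x_def y_def)
    have "g u = g (of_real (frac x) + of_real (frac y) * \<tau> + of_int \<lfloor>x\<rfloor> * 1 + of_int \<lfloor>y\<rfloor> * \<tau>)"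
      by (simp add: u frac_def algebra_simps)
    also have "\<dots> = g (of_real (frac x) + of_real (frac y) * \<tau>)"
      using periodic_of_int[of g \<tau>] periodic_of_int[of g 1] per by metis
    also have "\<dots> \<in> g ` K"
      unfolding K_def using frac_lt_1[of x] frac_lt_1[of y]
      by (intro imageI image_eqI[where x = "(frac x, frac y)"]) (auto intro: less_imp_le)
    finally show "g u \<in> g ` K" .
  qed
  ultimately have "bounded (range g)"
    using bounded_subset by blast
  thus ?thesis
    using Liouville_theorem[OF hol] unfolding constant_on_def by auto
qed

text \<open>The quotient of \<Phi> by theta has both periods, as the multipliers agree, so it is
  constant once it is entire. By \<open>theta_odd_nonzero\<close> the zeros of theta are lattice
  points, and there a translate of the removable singularity at 0 gives differentiability.\<close>

lemma theta_odd_unique: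
  assumes \<tau>: "Im \<tau> > 0" and hol: "\<Phi> holomorphic_on UNIV"
    and per: "\<And>u. \<Phi> (u + 1) = - \<Phi> u" "\<And>u. \<Phi> (u + \<tau>) = - qe (- \<tau> / 2 - u) * \<Phi> u"
    and \<Phi>0: "\<Phi> 0 = 0" "(\<Phi> has_field_derivative \<Phi>') (at 0)"
    and \<theta>': "(theta_odd \<tau> has_field_derivative \<theta>') (at 0)" "\<theta>' \<noteq> 0"
    and u: "theta_odd \<tau> u \<noteq> 0"
  shows "\<Phi> u = \<Phi>' / \<theta>' * theta_odd \<tau> u"
proof -
  define \<theta> where "\<theta> = theta_odd \<tau>"
  have hol\<theta>: "\<theta> holomorphic_on S" for S
    unfolding \<theta>_def by (rule holomorphic_theta_odd[OF \<tau>])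
  have \<theta>per: "\<theta> (u + 1) = - \<theta> u" "\<theta> (u + \<tau>) = - qe (- \<tau> / 2 - u) * \<theta> u" for u
    unfolding \<theta>_def using theta_odd_add_1 theta_odd_add_tau[OF \<tau>] by auto
  have [simp]: "\<theta> 0 = 0" using \<tau> by (simp add: \<theta>_def)
  \<comment> \<open>One value for all zeros of theta makes g periodic by mere case distinction,
    before the zeros are located.\<close>
  define g where "g = (\<lambda>u. if \<theta> u = 0 then \<Phi>' / \<theta>' else \<Phi> u / \<theta> u)"
  have gper: "g (u + 1) = g u" "g (u + \<tau>) = g u" for u
    unfolding g_def per(1)[of u] per(2)[of u] \<theta>per(1)[of u] \<theta>per(2)[of u] by auto
  have open_nz: "open {u. \<theta> u \<noteq> 0}"
  proof -
    have "continuous_on UNIV \<theta>" using hol\<theta> holomorphic_on_imp_continuous_on by blast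
    hence "open (\<theta> -` (- {0}))" by (intro open_vimage) auto
    thus ?thesis by (simp add: vimage_def)
  qed
  have diff_nz: "g field_differentiable (at u)" if "\<theta> u \<noteq> 0" for u
  proof -
    have "(\<lambda>u. \<Phi> u / \<theta> u) holomorphic_on {u. \<theta> u \<noteq> 0}"
      by (intro holomorphic_intros hol\<theta> holomorphic_on_subset[OF hol]) auto
    hence "g holomorphic_on {u. \<theta> u \<noteq> 0}"
      by (rule holomorphic_transform) (simp add: g_def)
    thus ?thesis
      using that open_nz holomorphic_on_imp_differentiable_at by blast
  qed
  have lim: "((\<lambda>u. \<theta> u / u) \<longlongrightarrow> \<theta>') (at 0)" "((\<lambda>u. \<Phi> u / u) \<longlongrightarrow> \<Phi>') (at 0)"
    using \<theta>'(1) \<Phi>0 \<tau> by (simp_all add: has_field_derivative_iff \<theta>_def)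
  have ev: "eventually (\<lambda>u. \<theta> u \<noteq> 0) (at 0)"
    using tendsto_imp_eventually_ne[OF lim(1) \<theta>'(2)] by eventually_elim auto
  then obtain r where r: "r > 0" "\<And>u. u \<noteq> 0 \<Longrightarrow> norm u < r \<Longrightarrow> \<theta> u \<noteq> 0"
    unfolding eventually_at by (auto simp: dist_norm)
  have "((\<lambda>u. (\<Phi> u / u) / (\<theta> u / u)) \<longlongrightarrow> \<Phi>' / \<theta>') (at 0)"
    by (intro tendsto_divide lim \<theta>')
  moreover have "eventually (\<lambda>u. (\<Phi> u / u) / (\<theta> u / u) = g u) (at 0)"
    using ev eventually_neq_at_within by eventually_elim (auto simp: g_def)
  ultimately have "(g \<longlongrightarrow> \<Phi>' / \<theta>') (at 0)"
    by (rule Lim_transform_eventually)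
  hence lim_g: "(g \<longlongrightarrow> g 0) (at 0)"
    by (simp add: g_def)
  have "g holomorphic_on ball 0 r"
  proof (rule no_isolated_singularity'[where K = "{0}"])
    show "(g \<longlongrightarrow> g z) (at z within ball 0 r)" if "z \<in> {0}" for z
      using that lim_g by (simp add: Lim_at_imp_Lim_at_within)
    show "g holomorphic_on ball 0 r - {0}"
      unfolding holomorphic_on_def using r(2) by (auto intro!: field_differentiable_at_within diff_nz)
  qed simp_all
  hence diff_0: "g field_differentiable (at 0)"
    using r holomorphic_on_imp_differentiable_at[of g "ball 0 r" 0] by auto
  have "g field_differentiable (at v)" for v
  proof (cases "\<theta> v = 0")
    case True
    then obtain n where "v + of_int n * \<tau> \<in> \<int>"
      using theta_odd_nonzero[OF \<tau>, of v] by (auto simp: \<theta>_def)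
    then obtain m where m: "v + of_int n * \<tau> = of_int m"
      by (auto elim: Ints_cases)
    have g: "g x = g (x + (- v))" for x
    proof -
      have "g (x + of_int n * \<tau> + of_int (- m) * 1) = g x"
        using periodic_of_int[of g \<tau>] periodic_of_int[of g 1] gper by metis
      moreover have "x + of_int n * \<tau> + of_int (- m) * 1 = x + (- v)"
        using m by (simp add: algebra_simps)
      ultimately show ?thesis by (simp only:)
    qed
    obtain D where "(g has_field_derivative D) (at (v + (- v)))"
      using diff_0 by (auto simp: field_differentiable_def)
    hence "((\<lambda>x. g (x + (- v))) has_field_derivative D) (at v)"
      unfolding DERIV_shift .
    thus ?thesis
      using g by (auto simp: field_differentiable_def)
  qed (rule diff_nz)
  hence "g holomorphic_on UNIV"
    by (simp add: holomorphic_on_def)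
  hence "g u = g 0"
    using doubly_periodic_entire_imp_constant[OF _ \<tau>, of g] gper by blast
  moreover have "g u = \<Phi> u / theta_odd \<tau> u" "g 0 = \<Phi>' / \<theta>'"
    using u by (simp_all add: g_def \<theta>_def [symmetric])
  ultimately show ?thesis
    using u by (simp add: field_simps)
qed

definition eta6 :: "complex \<Rightarrow> complex" where
  "eta6 z = qe (z / 4) * euler_phi (qe z) ^ 6"

lemma qe_quarter: "qe (1 / 4) = \<i>"
proof -
  have "qe (1 / 4) = cis (pi / 2)"
    by (simp add: qe_def cis_conv_exp mult_ac)
  thus ?thesis by simp
qed

text \<open>
  By uniqueness the quotient of the two theta functions below is constant in \<open>u\<close>. Comparing the cube of its
  value at \<open>0\<close> with the product of its values at the three half periods determines the sixth power of
  eta, because by Euler's identity the product of \<open>theta_odd\<close> over the half periods is elementary.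
\<close>
theorem eta6_inversion:
  assumes \<tau>: "Im \<tau> > 0"
  shows "eta6 (- 1 / \<tau>) = \<i> * \<tau> ^ 3 * eta6 \<tau>"
proof -
  define \<sigma> where "\<sigma> = - 1 / \<tau>"
  have \<tau>0: "\<tau> \<noteq> 0" using \<tau> by auto
  have \<sigma>: "Im \<sigma> > 0"
    using \<tau> \<tau>0 by (simp add: \<sigma>_def Im_divide cmod_power2 sum_power2_gt_zero_iff complex_eq_iff)
  have inv: "1 / \<tau> = - \<sigma>" by (simp add: \<sigma>_def)
  \<comment> \<open>The map u -> u / \<tau> exchanges the roles of the two periods; the Gaussian
    factor corrects the multipliers to those of \<open>theta_odd \<tau>\<close>.\<close>
  define \<Phi> where "\<Phi> = (\<lambda>u. qe (- (u\<^sup>2) / (2 * \<tau>)) * theta_odd \<sigma> (u / \<tau>))"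
  have hol: "\<Phi> holomorphic_on UNIV"
  proof -
    have "(theta_odd \<sigma> \<circ> (\<lambda>u. u / \<tau>)) holomorphic_on UNIV"
      by (intro holomorphic_on_compose holomorphic_intros holomorphic_theta_odd \<sigma> \<tau>0)
    thus ?thesis
      unfolding \<Phi>_def o_def using \<tau>0 by (intro holomorphic_intros) auto
  qed
  have per1: "\<Phi> (u + 1) = - \<Phi> u" for u
  proof -
    define w where "w = u / \<tau>"
    have "theta_odd \<sigma> w = theta_odd \<sigma> ((w - \<sigma>) + \<sigma>)" by simp
    also have "\<dots> = - qe (- \<sigma> / 2 - (w - \<sigma>)) * theta_odd \<sigma> (w - \<sigma>)"
      by (rule theta_odd_add_tau[OF \<sigma>])
    finally have "theta_odd \<sigma> (w - \<sigma>) = - theta_odd \<sigma> w / qe (- \<sigma> / 2 - (w - \<sigma>))"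
      by simp
    moreover have "(u + 1) / \<tau> = w - \<sigma>"
      using \<tau>0 by (simp add: w_def \<sigma>_def field_simps)
    ultimately have "\<Phi> (u + 1) = - (qe (- ((u + 1)\<^sup>2) / (2 * \<tau>)) / qe (- \<sigma> / 2 - (w - \<sigma>))) * theta_odd \<sigma> w"
      by (simp add: \<Phi>_def)
    also have "qe (- ((u + 1)\<^sup>2) / (2 * \<tau>)) / qe (- \<sigma> / 2 - (w - \<sigma>)) = qe (- ((u + 1)\<^sup>2) / (2 * \<tau>) - (- \<sigma> / 2 - (w - \<sigma>)))"
      by (simp only: qe_diff)
    also have "- ((u + 1)\<^sup>2) / (2 * \<tau>) - (- \<sigma> / 2 - (w - \<sigma>)) = - (u\<^sup>2) / (2 * \<tau>)"
      using \<tau>0 by (simp add: w_def \<sigma>_def field_simps power2_eq_square)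
    finally show ?thesis by (simp add: \<Phi>_def w_def)
  qed
  have per2: "\<Phi> (u + \<tau>) = - qe (- \<tau> / 2 - u) * \<Phi> u" for u
  proof -
    have "(u + \<tau>) / \<tau> = u / \<tau> + 1" "- ((u + \<tau>)\<^sup>2) / (2 * \<tau>) = (- \<tau> / 2 - u) + - (u\<^sup>2) / (2 * \<tau>)"
      using \<tau>0 by (simp_all add: field_simps power2_eq_square)
    thus ?thesis
      unfolding \<Phi>_def by (simp only: theta_odd_add_1 qe_add) simp
  qed
  define D where "D = (\<lambda>\<tau>. - 2 * of_real pi * \<i> * euler_phi (qe \<tau>) ^ 2)"
  have Dnz: "D \<tau> \<noteq> 0"
    using qpoch_self_nonzero[OF norm_qe_less_1[OF \<tau>]] by (simp add: D_def euler_phi_def)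
  have d\<theta>: "(theta_odd \<tau> has_field_derivative D \<tau>) (at 0)" "(theta_odd \<sigma> has_field_derivative D \<sigma>) (at (0 / \<tau>))"
    using theta_odd_deriv_0 \<tau> \<sigma> by (simp_all add: D_def)
  have "((\<lambda>u. theta_odd \<sigma> (u / \<tau>)) has_field_derivative D \<sigma> * (1 / \<tau>)) (at 0)"
    by (rule DERIV_chain2[where f = "theta_odd \<sigma>" and g = "\<lambda>u. u / \<tau>", OF d\<theta>(2)]) (use \<tau>0 in \<open>auto intro!: derivative_eq_intros\<close>)
  hence d\<Phi>: "(\<Phi> has_field_derivative D \<sigma> / \<tau>) (at 0)"
    unfolding \<Phi>_def using \<tau>0 \<sigma> by (auto intro!: derivative_eq_intros)
  define C where "C = D \<sigma> / \<tau> / D \<tau>"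
  have hp: "theta_odd \<tau> (1/2) * theta_odd \<tau> (\<tau>/2) * theta_odd \<tau> ((1 + \<tau>)/2) = - 2 / qe (\<tau> / 2)"
    by (rule theta_odd_half_periods[OF \<tau>])
  hence nz: "theta_odd \<tau> (1/2) \<noteq> 0" "theta_odd \<tau> (\<tau>/2) \<noteq> 0" "theta_odd \<tau> ((1 + \<tau>)/2) \<noteq> 0"
    by auto
  have C: "\<Phi> u = C * theta_odd \<tau> u" if "theta_odd \<tau> u \<noteq> 0" for u
    unfolding C_def using \<sigma> that
    by (intro theta_odd_unique[OF \<tau> hol per1 per2 _ d\<Phi> d\<theta>(1) Dnz]) (auto simp: \<Phi>_def)
  have "\<Phi> (1/2) * \<Phi> (\<tau>/2) * \<Phi> ((1 + \<tau>)/2) = C ^ 3 * (- 2 / qe (\<tau> / 2))"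
    unfolding C[OF nz(1)] C[OF nz(2)] C[OF nz(3)] hp[symmetric] by (simp add: power3_eq_cube)
  moreover have "\<Phi> (1/2) * \<Phi> (\<tau>/2) * \<Phi> ((1 + \<tau>)/2) =
     (qe (- ((1/2)\<^sup>2) / (2 * \<tau>)) * qe (- ((\<tau>/2)\<^sup>2) / (2 * \<tau>)) * qe (- (((1 + \<tau>)/2)\<^sup>2) / (2 * \<tau>))) *
     - (theta_odd \<sigma> (1/2) * theta_odd \<sigma> (\<sigma>/2) * theta_odd \<sigma> ((1 + \<sigma>)/2))"
  proof -
    \<comment> \<open>Half periods go to half periods up to sign and a shift by 1; altogether one
      minus sign remains.\<close>
    have "1 / 2 / \<tau> = - (\<sigma> / 2)" "\<tau> / 2 / \<tau> = 1 / 2" "(1 + \<tau>) / 2 / \<tau> = - ((1 + \<sigma>) / 2) + 1"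
      using \<tau>0 by (simp_all add: \<sigma>_def field_simps)
    thus ?thesis
      unfolding \<Phi>_def by (simp only: theta_odd_add_1 theta_odd_minus[OF \<sigma>]) (simp only: mult_ac minus_minus mult_minus_left mult_minus_right)
  qed
  moreover have "qe (- ((1/2)\<^sup>2) / (2 * \<tau>)) * qe (- ((\<tau>/2)\<^sup>2) / (2 * \<tau>)) * qe (- (((1 + \<tau>)/2)\<^sup>2) / (2 * \<tau>)) =
      qe (\<sigma> / 4 - \<tau> / 4 - 1 / 4)"
  proof -
    have "- ((1/2)\<^sup>2) / (2 * \<tau>) + - ((\<tau>/2)\<^sup>2) / (2 * \<tau>) + - (((1 + \<tau>)/2)\<^sup>2) / (2 * \<tau>) = \<sigma> / 4 - \<tau> / 4 - 1 / 4"
      using \<tau>0 by (simp add: \<sigma>_def field_simps power2_eq_square)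
    thus ?thesis by (metis qe_add)
  qed
  ultimately have "C ^ 3 * (- 2 / qe (\<tau> / 2)) = qe (\<sigma> / 4 - \<tau> / 4 - 1 / 4) * (2 / qe (\<sigma> / 2))"
    unfolding theta_odd_half_periods[OF \<sigma>] by simp
  moreover have "C ^ 3 = - (C ^ 3 * (- 2 / qe (\<tau> / 2))) / 2 * qe (\<tau> / 2)"
    by simp
  ultimately have "C ^ 3 = - (qe (\<sigma> / 4 - \<tau> / 4 - 1 / 4) * (2 / qe (\<sigma> / 2))) / 2 * qe (\<tau> / 2)"
    by (simp only:)
  hence "C ^ 3 = - (qe (\<sigma> / 4 - \<tau> / 4 - 1 / 4) / qe (\<sigma> / 2) * qe (\<tau> / 2))"
    by simp
  also have "qe (\<sigma> / 4 - \<tau> / 4 - 1 / 4) / qe (\<sigma> / 2) * qe (\<tau> / 2) = qe ((\<sigma> / 4 - \<tau> / 4 - 1 / 4) - \<sigma> / 2 + \<tau> / 2)"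
    by (simp only: qe_add qe_diff)
  also have "(\<sigma> / 4 - \<tau> / 4 - 1 / 4) - \<sigma> / 2 + \<tau> / 2 = \<tau> / 4 - \<sigma> / 4 - 1 / 4"
    by (simp add: field_simps)
  finally have C3: "C ^ 3 = \<i> * qe (\<tau> / 4) / qe (\<sigma> / 4)"
    by (simp add: qe_diff qe_quarter)
  \<comment> \<open>As C is a ratio of squares of Euler products, its cube involves exactly the
    sixth powers, and no cube root has to be chosen.\<close>
  have "C = euler_phi (qe \<sigma>) ^ 2 / (\<tau> * euler_phi (qe \<tau>) ^ 2)"
    by (simp add: C_def D_def)
  hence "C ^ 3 = euler_phi (qe \<sigma>) ^ 6 / (\<tau> ^ 3 * euler_phi (qe \<tau>) ^ 6)"
    by (simp add: power_divide power_mult_distrib power_mult [symmetric])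
  hence "euler_phi (qe \<sigma>) ^ 6 = \<i> * qe (\<tau> / 4) / qe (\<sigma> / 4) * (\<tau> ^ 3 * euler_phi (qe \<tau>) ^ 6)"
    using C3 \<tau>0 Dnz by (simp add: D_def divide_simps)
  thus ?thesis
    unfolding \<sigma>_def [symmetric] eta6_def by simp
qed

lemma eta6_nonzero: "Im z > 0 \<Longrightarrow> eta6 z \<noteq> 0"
  using qpoch_self_nonzero[OF norm_qe_less_1] by (simp add: eta6_def euler_phi_def)

lemma eta6_add_1: "eta6 (z + 1) = \<i> * eta6 z"
  by (simp add: eta6_def qe_add add_divide_distrib qe_quarter)

subsection \<open>The modular group and Liouville's theorem for congruence subgroups\<close>

abbreviation "\<H> \<equiv> upper_half_plane"

lemma in_H_iff: "z \<in> \<H> \<longleftrightarrow> Im z > 0"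
  by (simp add: upper_half_plane_def)

lemma open_H: "open \<H>"
  unfolding upper_half_plane_def by (rule open_halfspace_Im_gt)

text \<open>Four integer entries instead of a matrix, so that products and inverses are polynomial
  identities and the divisibility of an entry is directly accessible.\<close>

definition mob :: "int \<Rightarrow> int \<Rightarrow> int \<Rightarrow> int \<Rightarrow> complex \<Rightarrow> complex" where
  "mob a b c d z = (of_int a * z + of_int b) / (of_int c * z + of_int d)"

lemma mob_denom_nonzero:
  assumes "z \<in> \<H>" "a * d - b * c = 1"
  shows "of_int c * z + of_int d \<noteq> 0"
proof
  assume *: "of_int c * z + of_int d = 0"
  hence "of_int c * Im z = 0" by (simp add: complex_eq_iff)
  hence "c = 0" using assms(1) by (auto simp: in_H_iff)
  with * assms(2) show False by simp
qed

lemma Im_mob: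
  assumes "a * d - b * c = 1"
  shows "Im (mob a b c d z) = Im z / norm (of_int c * z + of_int d) ^ 2"
proof -
  have "real_of_int a * of_int d - of_int b * of_int c = 1"
    using assms by (metis of_int_1 of_int_diff of_int_mult)
  hence e: "real_of_int a * of_int d = 1 + of_int b * of_int c" by simp
  have "Im (mob a b c d z) = 
    (real_of_int a * Im z * (of_int c * Re z + of_int d) - (of_int a * Re z + of_int b) * (of_int c * Im z)) / norm (of_int c * z + of_int d) ^ 2"
    by (simp add: mob_def Im_divide cmod_power2)
  also have "real_of_int a * Im z * (of_int c * Re z + of_int d) - (of_int a * Re z + of_int b) * (of_int c * Im z)
     = Im z * (real_of_int a * of_int d - of_int b * of_int c)"
    by (simp add: algebra_simps)
  finally show ?thesis using e by simp
qed

lemma mob_in_H [intro]: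
  assumes "z \<in> \<H>" "a * d - b * c = 1"
  shows "mob a b c d z \<in> \<H>"
  using mob_denom_nonzero[OF assms] assms by (simp add: in_H_iff Im_mob)

lemma mob_mob:
  assumes "z \<in> \<H>" "a' * d' - b' * c' = 1"
  shows "mob a b c d (mob a' b' c' d' z) = mob (a * a' + b * c') (a * b' + b * d') (c * a' + d * c') (c * b' + d * d') z"
  using mob_denom_nonzero[OF assms] by (simp add: mob_def divide_simps) (simp add: algebra_simps)

lemma mob_id [simp]: "mob 1 0 0 1 z = z"
  by (simp add: mob_def)

lemma det_mult:
  fixes a b c d :: int
  assumes "a * d - b * c = 1" "a' * d' - b' * c' = 1"
  shows "(a * a' + b * c') * (c * b' + d * d') - (a * b' + b * d') * (c * a' + d * c') = 1"
proof -
  have "(a * a' + b * c') * (c * b' + d * d') - (a * b' + b * d') * (c * a' + d * c') = (a * d - b * c) * (a' * d' - b' * c')"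
    by (simp add: algebra_simps)
  thus ?thesis using assms by simp
qed

lemma mob_inverse:
  assumes "z \<in> \<H>" "a * d - b * c = 1"
  shows "mob d (- b) (- c) a (mob a b c d z) = z"
proof -
  have "mob d (- b) (- c) a (mob a b c d z) =
      mob (d * a + - b * c) (d * b + - b * d) (- c * a + a * c) (- c * b + a * d) z"
    by (rule mob_mob[OF assms])
  also have "d * a + - b * c = 1" using assms(2) by (simp add: algebra_simps)
  also have "- c * b + a * d = 1" using assms(2) by (simp add: algebra_simps)
  finally show ?thesis by (simp add: mult.commute)
qed

text \<open>If Im z < 1/2 and |Re z| <= 1/2, then |z|^2 <= 1/2, so z -> -1/z at least doubles the
  imaginary part. The induction counts the doublings still needed. The bound 1/2 is weaker than that
  of the fundamental domain, but any positive bound keeps the values of q in a smaller disc.\<close>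

lemma reduce_Im_ge_half:
  assumes "z \<in> \<H>"
  shows "\<exists>a b c d. a * d - b * c = 1 \<and> Im (mob a b c d z) \<ge> 1 / 2"
proof -
  have "z \<in> \<H> \<Longrightarrow> Im z * 2 ^ n \<ge> 1 / 2 \<Longrightarrow> \<exists>a b c d. a * d - b * c = 1 \<and> Im (mob a b c d z) \<ge> 1 / 2" for n z
  proof (induction n arbitrary: z)
    case 0
    thus ?case by (intro exI[of _ 1] exI[of _ 0]) auto
  next
    case (Suc n)
    define k where "k = \<lfloor>Re z + 1 / 2\<rfloor>"
    define w where "w = z - of_int k"
    have w: "w \<in> \<H>" "Im w = Im z" using Suc.prems by (simp_all add: in_H_iff w_def)
    have mobw: "mob 1 (- k) 0 1 z = w" by (simp add: mob_def w_def)
    show ?case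
    proof (cases "Im z \<ge> 1 / 2")
      case True
      thus ?thesis by (intro exI[of _ 1] exI[of _ 0]) auto
    next
      case False
      have "Re w = Re z - of_int \<lfloor>Re z + 1 / 2\<rfloor>" by (simp add: w_def k_def)
      hence "\<bar>Re w\<bar> \<le> 1 / 2"
        using floor_correct[of "Re z + 1 / 2"] unfolding abs_le_iff by linarith
      hence "(Re w)\<^sup>2 \<le> (1/2)\<^sup>2" by (metis abs_ge_zero power2_abs power_mono)
      moreover have "(Im w)\<^sup>2 \<le> (1/2)\<^sup>2"
        using False w by (intro power_mono) (auto simp: in_H_iff)
      ultimately have "norm w ^ 2 \<le> (1/2)\<^sup>2 + (1/2)\<^sup>2"
        unfolding cmod_power2 by (rule add_mono)
      hence n2: "norm w ^ 2 \<le> 1 / 2"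
        by (simp add: power2_eq_square)
      have w0: "norm w > 0" using w by (auto simp: in_H_iff)
      have "Im (mob 0 (- 1) 1 0 w) = Im w / norm w ^ 2"
        by (subst Im_mob) auto
      also have "Im w / norm w ^ 2 \<ge> Im w / (1 / 2)"
        using n2 w w0 by (intro divide_left_mono) (auto simp: in_H_iff)
      finally have "Im (mob 0 (- 1) 1 0 w) \<ge> 2 * Im z" using w by simp
      hence "Im (mob 0 (- 1) 1 0 w) * 2 ^ n \<ge> 2 * Im z * 2 ^ n" by (intro mult_right_mono) auto
      hence "Im (mob 0 (- 1) 1 0 w) * 2 ^ n \<ge> 1 / 2"
        using Suc.prems(2) by (simp only: power_Suc mult_ac)
      then obtain a b c d where abcd: "a * d - b * c = 1" "Im (mob a b c d (mob 0 (- 1) 1 0 w)) \<ge> 1 / 2"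
        using Suc.IH[of "mob 0 (- 1) 1 0 w"] mob_in_H[OF w(1), of 0 0 "-1" 1] by auto
      have 1: "mob a b c d (mob 0 (- 1) 1 0 w) = mob (a * 0 + b * 1) (a * (- 1) + b * 0) (c * 0 + d * 1) (c * (- 1) + d * 0) w"
        by (rule mob_mob[OF w(1)]) simp
      have 2: "mob b (- a) d (- c) w = mob (b * 1 + - a * 0) (b * - k + - a * 1) (d * 1 + - c * 0) (d * - k + - c * 1) z"
        unfolding mobw [symmetric] by (rule mob_mob[OF Suc.prems(1)]) simp
      have "Im (mob b (- a - b * k) d (- c - d * k) z) \<ge> 1 / 2"
        using abcd(2) unfolding 1 using 2 by (simp add: algebra_simps)
      moreover have "b * (- c - d * k) - (- a - b * k) * d = 1"
        using abcd(1) by (simp add: algebra_simps)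
      ultimately show ?thesis by blast
    qed
  qed
  moreover obtain n where "1 / 2 / Im z < 2 ^ n"
    using real_arch_pow[of 2 "1 / 2 / Im z"] by auto
  hence "Im z * 2 ^ n \<ge> 1 / 2" using assms by (simp add: in_H_iff field_simps)
  ultimately show ?thesis using assms by blast
qed

section \<open>Boundedness at cusps and descent to the punctured disc\<close>

definition cusp_bdd :: "(complex \<Rightarrow> complex) \<Rightarrow> bool" where
  "cusp_bdd f \<longleftrightarrow> (\<exists>B Y. \<forall>z. Im z > Y \<longrightarrow> norm (f z) \<le> B)"

lemma cusp_bddI: "(\<And>z. Im z > Y \<Longrightarrow> norm (f z) \<le> B) \<Longrightarrow> cusp_bdd f"
  unfolding cusp_bdd_def by blast

lemma cusp_bdd_cong:
  assumes "\<And>z. z \<in> \<H> \<Longrightarrow> f z = g z" "cusp_bdd f"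
  shows "cusp_bdd g"
proof -
  obtain B Y where "\<And>z. Im z > Y \<Longrightarrow> norm (f z) \<le> B" using assms(2) by (auto simp: cusp_bdd_def)
  hence "norm (g z) \<le> B" if "Im z > max Y 0" for z
    using assms(1)[of z, symmetric] that by (simp add: in_H_iff)
  thus ?thesis by (rule cusp_bddI)
qed

lemma cusp_bdd_const: "cusp_bdd (\<lambda>_. c)"
  by (rule cusp_bddI[of 0 _ "norm c"]) auto

lemma cusp_bdd_add:
  assumes "cusp_bdd f" "cusp_bdd g"
  shows "cusp_bdd (\<lambda>z. f z + g z)"
proof -
  obtain B Y B' Y' where *: "\<And>z. Im z > Y \<Longrightarrow> norm (f z) \<le> B" "\<And>z. Im z > Y' \<Longrightarrow> norm (g z) \<le> B'"
    using assms by (auto simp: cusp_bdd_def)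
  have "norm (f z + g z) \<le> B + B'" if "Im z > max Y Y'" for z
    using that by (intro norm_triangle_mono *) auto
  thus ?thesis by (rule cusp_bddI)
qed

lemma cusp_bdd_mult:
  assumes "cusp_bdd f" "cusp_bdd g"
  shows "cusp_bdd (\<lambda>z. f z * g z)"
proof -
  obtain B Y B' Y' where *: "\<And>z. Im z > Y \<Longrightarrow> norm (f z) \<le> B" "\<And>z. Im z > Y' \<Longrightarrow> norm (g z) \<le> B'"
    using assms by (auto simp: cusp_bdd_def)
  have "norm (f z * g z) \<le> B * B'" if "Im z > max Y Y'" for z
  proof -
    have "norm (f z) \<le> B" "norm (g z) \<le> B'" using that by (auto intro: *)
    thus ?thesis unfolding norm_mult by (intro mult_mono) (auto intro: order_trans[OF norm_ge_zero])
  qed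
  thus ?thesis by (rule cusp_bddI)
qed

lemma cusp_bdd_affine:
  assumes "cusp_bdd f" "a > 0"
  shows "cusp_bdd (\<lambda>z. f (of_real a * z + of_real b))"
proof -
  obtain B Y where *: "\<And>z. Im z > Y \<Longrightarrow> norm (f z) \<le> B"
    using assms by (auto simp: cusp_bdd_def)
  have "norm (f (of_real a * z + of_real b)) \<le> B" if "Im z > Y / a" for z
    using that assms(2) by (intro *) (simp add: field_simps)
  thus ?thesis by (rule cusp_bddI)
qed

text \<open>\<open>M0_sharp\<close> without its condition at infinity, and with boundedness in place
  of expansions at the other cusps. Boundedness passes through sums, products and affine
  substitutions whatever the width of the cusp; the behaviour at infinity is carried by
  \<open>qexp\<close>.\<close>

definition mod_fun :: "nat \<Rightarrow> (complex \<Rightarrow> complex) \<Rightarrow> bool" where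
  "mod_fun N f \<longleftrightarrow> f holomorphic_on \<H> \<and>
     (\<forall>a b c d. a * d - b * c = 1 \<and> int N dvd c \<longrightarrow> (\<forall>z\<in>\<H>. f (mob a b c d z) = f z)) \<and>
     (\<forall>a b c d. a * d - b * c = 1 \<and> \<not> int N dvd c \<longrightarrow> cusp_bdd (\<lambda>z. f (mob a b c d z)))"

lemma qe_cover:
  assumes "w \<noteq> 0" "norm w < 1" "h > 0"
  shows "\<exists>z\<in>\<H>. w = qe (z / of_real h)"
proof -
  define z where "z = of_real h * Ln w / (2 * of_real pi * \<i>)"
  have "z / of_real h = Ln w / (2 * of_real pi * \<i>)"
    using assms by (simp add: z_def)
  hence "qe (z / of_real h) = w"
    using assms by (simp add: qe_def exp_Ln)
  moreover have "Im z = h * (- ln (norm w)) / (2 * pi)"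
    using assms by (simp add: z_def Im_divide power2_eq_square)
  hence "Im z > 0" using assms by (simp add: zero_less_mult_iff divide_less_0_iff mult_less_0_iff)
  ultimately show ?thesis by (auto simp: in_H_iff)
qed

lemma holomorphic_descend:
  assumes f: "f holomorphic_on \<H>" and h: "h > 0" and g: "\<And>z. z \<in> \<H> \<Longrightarrow> f z = g (qe (z / of_real h))"
  shows "g holomorphic_on ball 0 1 - {0}"
proof -
  have "g field_differentiable (at w0)" if w0: "w0 \<in> ball 0 1 - {0}" for w0
  proof -
    define U where "U = ball w0 (norm w0) \<inter> ball 0 1"
    \<comment> \<open>A branch of the logarithm near w0: wherever w0 lies, w / w0 has positive real
      part on U and avoids the cut.\<close>
    define L where "L = (\<lambda>w. of_real h * (Ln (w / w0) + Ln w0) / (2 * of_real pi * \<i>))"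
    have U: "w \<noteq> 0" "norm w < 1" "w / w0 \<notin> \<real>\<^sub>\<le>\<^sub>0" if "w \<in> U" for w
    proof -
      show "w \<noteq> 0" "norm w < 1" using that by (auto simp: U_def dist_norm)
      have "norm (1 - w / w0) = norm (w0 - w) / norm w0"
        using w0 by (simp add: norm_divide [symmetric] diff_divide_distrib)
      also have "\<dots> < 1" using that w0 by (simp add: U_def dist_norm)
      finally have "Re (1 - w / w0) < 1" using complex_Re_le_cmod le_less_trans by blast
      hence "Re (w / w0) > 0" by simp
      thus "w / w0 \<notin> \<real>\<^sub>\<le>\<^sub>0" by (auto simp: complex_nonpos_Reals_iff)
    qed
    have expL: "qe (L w / of_real h) = w" if "w \<in> U" for w
    proof -
      have "L w / of_real h = (Ln (w / w0) + Ln w0) / (2 * of_real pi * \<i>)"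
        using h by (simp add: L_def)
      thus ?thesis using U(1)[OF that] w0 by (simp add: qe_def exp_add exp_Ln)
    qed
    have LH: "L w \<in> \<H>" if "w \<in> U" for w
    proof -
      have "exp (- (2 * pi * Im (L w) / h)) = norm (qe (L w / of_real h))"
        unfolding norm_qe by (simp add: Im_divide_of_real)
      also have "\<dots> < 1" using expL[OF that] U[OF that] by simp
      finally show ?thesis using h by (simp add: in_H_iff zero_less_divide_iff zero_less_mult_iff)
    qed
    have "L holomorphic_on U"
      unfolding L_def using U w0 by (intro holomorphic_intros) auto
    hence "(f \<circ> L) holomorphic_on U"
      by (rule holomorphic_on_compose_gen[OF _ f]) (use LH in auto)
    hence "g holomorphic_on U"
      by (rule holomorphic_transform) (use g[OF LH] expL in auto)
    moreover have "open U" "w0 \<in> U" using w0 by (auto simp: U_def)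
    ultimately show ?thesis using holomorphic_on_imp_differentiable_at by blast
  qed
  thus ?thesis
    unfolding holomorphic_on_def by (blast intro: field_differentiable_at_within)
qed

lemma periodic_on_H:
  assumes "\<And>z. z \<in> \<H> \<Longrightarrow> f (z + of_real h) = f z" "z \<in> \<H>"
  shows "f (z + of_int n * of_real h) = f z"
proof (induction n rule: int_induct[where k = 0])
  case (step1 i)
  thus ?case using assms(1)[of "z + of_int i * of_real h"] assms(2)
    by (simp add: ring_distribs add_ac in_H_iff)
next
  case (step2 i)
  thus ?case using assms(1)[of "z + of_int (i - 1) * of_real h"] assms(2)
    by (simp add: ring_distribs add_ac in_H_iff)
qed simp

text \<open>The principal logarithm in g jumps across the negative axis, but after scaling the jump
  is a multiple of h, which the periodicity of f does not see.\<close>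

lemma periodic_descend:
  assumes f: "f holomorphic_on \<H>" and h: "h > 0" and per: "\<And>z. z \<in> \<H> \<Longrightarrow> f (z + of_real h) = f z"
  shows "\<exists>g. g holomorphic_on ball 0 1 - {0} \<and> (\<forall>z\<in>\<H>. f z = g (qe (z / of_real h)))"
proof -
  define g where "g = (\<lambda>w. f (of_real h * Ln w / (2 * of_real pi * \<i>)))"
  have g: "f z = g (qe (z / of_real h))" if "z \<in> \<H>" for z
  proof -
    have "exp (Ln (qe (z / of_real h))) = exp (2 * of_real pi * \<i> * (z / of_real h))"
      by (simp add: exp_Ln) (simp add: qe_def)
    then obtain n :: int where "Ln (qe (z / of_real h)) = 2 * of_real pi * \<i> * (z / of_real h) + of_int (2 * n) * of_real pi * \<i>"
      unfolding exp_eq by auto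
    hence "of_real h * Ln (qe (z / of_real h)) / (2 * of_real pi * \<i>) = z + of_int n * of_real h"
      using h by (simp add: field_simps)
    thus ?thesis unfolding g_def using periodic_on_H[of f h z n] per that by simp
  qed
  with holomorphic_descend[OF f h g] show ?thesis by blast
qed

lemma periodic_bdd_descend:
  assumes f: "f holomorphic_on \<H>" and h: "h > 0" and per: "\<And>z. z \<in> \<H> \<Longrightarrow> f (z + of_real h) = f z"
    and bdd: "cusp_bdd f"
  shows "\<exists>g. g holomorphic_on ball 0 1 \<and> (\<forall>z\<in>\<H>. f z = g (qe (z / of_real h)))"
proof -
  obtain g where g: "g holomorphic_on ball 0 1 - {0}" "\<And>z. z \<in> \<H> \<Longrightarrow> f z = g (qe (z / of_real h))"
    using periodic_descend[OF f h per] by auto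
  obtain B Y where B: "\<And>z. Im z > Y \<Longrightarrow> norm (f z) \<le> B" using bdd by (auto simp: cusp_bdd_def)
  define r where "r = min 1 (exp (- (2 * pi * Y / h)))"
  have "norm (g w) \<le> B" if "w \<noteq> 0" "norm w < r" for w
  proof -
    have "norm w < 1" using that by (simp add: r_def)
    then obtain z where z: "z \<in> \<H>" "w = qe (z / of_real h)"
      using qe_cover[of w h] \<open>w \<noteq> 0\<close> h by blast
    have "exp (- (2 * pi * Im z / h)) < exp (- (2 * pi * Y / h))"
      using that z by (simp add: r_def norm_qe Im_divide_of_real)
    hence "Im z > Y" using h by (simp add: divide_less_cancel)
    thus ?thesis using B g(2) z by metis
  qed
  hence "eventually (\<lambda>w. norm (g w) \<le> B) (at 0)"
    unfolding eventually_at by (intro exI[of _ r]) (auto simp: r_def dist_norm)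
  then obtain k where k: "k holomorphic_on ball 0 1" "\<And>z. z \<in> ball 0 1 - {0} \<Longrightarrow> k z = g z"
    using holomorphic_on_extend_bounded[OF g(1)] by auto
  have "f z = k (qe (z / of_real h))" if "z \<in> \<H>" for z
    using g(2)[OF that] k(2)[of "qe (z / of_real h)"] norm_qe_less_1[of "z / of_real h"] that h
    by (simp add: in_H_iff Im_divide_of_real)
  with k(1) show ?thesis by blast
qed

text \<open>The first matrix times the inverse of the second has lower left entry c d' - d c', which
  N divides. So f after a matrix depends only on the bottom row modulo N, and finitely many
  functions arise.\<close>

lemma mod_fun_coset:
  assumes inv: "\<And>a b c d z. a * d - b * c = 1 \<Longrightarrow> int N dvd c \<Longrightarrow> z \<in> \<H> \<Longrightarrow> f (mob a b c d z) = f z"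
    and det: "a * d - b * c = 1" "a' * d' - b' * c' = 1"
    and cong: "[c = c'] (mod int N)" "[d = d'] (mod int N)" and z: "z \<in> \<H>"
  shows "f (mob a b c d z) = f (mob a' b' c' d' z)"
proof -
  define w where "w = mob a' b' c' d' z"
  have w: "w \<in> \<H>" using z det by (auto simp: w_def)
  have e: "d' * a' - - b' * - c' = 1" using det by (simp add: algebra_simps)
  have z': "z = mob d' (- b') (- c') a' w"
    unfolding w_def using mob_inverse[OF z det(2)] by simp
  have "mob a b c d z = mob (a * d' + b * - c') (a * - b' + b * a') (c * d' + d * - c') (c * - b' + d * a') w"
    unfolding z' by (rule mob_mob[OF w]) (use e in simp)
  moreover have "(a * d' + b * - c') * (c * - b' + d * a') - (a * - b' + b * a') * (c * d' + d * - c') = 1"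
    by (rule det_mult[OF det(1)]) (use e in simp)
  moreover have "[c * d' + d * - c' = c' * d' + d' * - c'] (mod int N)"
    by (intro cong_add cong_mult cong cong_refl)
  hence "int N dvd c * d' + d * - c'" by (simp add: cong_0_iff mult.commute)
  ultimately show ?thesis using inv w unfolding w_def by metis
qed

text \<open>The finitely many translates of f extend to holomorphic functions of exp(2 pi i z / N)
  on the unit disc. Moving z to Im z \<ge> 1/2 only exchanges one translate for another, so every
  value of each is taken by some translate in a closed disc of radius r < 1. The largest modulus is
  thus attained at an interior point, and the maximum principle makes that translate constant, hence
  also f.\<close>

theorem mod_fun_bounded_imp_constant:
  assumes f: "mod_fun N f" "cusp_bdd f" and N: "N > 0"
  shows "\<exists>C. \<forall>z\<in>\<H>. f z = C"
proof -
  have hol: "f holomorphic_on \<H>"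
    and inv: "\<And>a b c d z. a * d - b * c = 1 \<Longrightarrow> int N dvd c \<Longrightarrow> z \<in> \<H> \<Longrightarrow> f (mob a b c d z) = f z"
    and bdd: "\<And>a b c d. a * d - b * c = 1 \<Longrightarrow> \<not> int N dvd c \<Longrightarrow> cusp_bdd (\<lambda>z. f (mob a b c d z))"
    using f unfolding mod_fun_def by blast+
  define S where "S = {(a, b, c, d). a * d - b * c = (1 :: int)}"
  define act where "act = (\<lambda>(a, b, c, d) z. f (mob a b c d z))"
  define \<rho> where "\<rho> = (\<lambda>(a :: int, b :: int, c, d). (c mod int N, d mod int N))"
  define R where "R = inv_into S \<rho> ` (\<rho> ` S)"
  have "\<rho> ` S \<subseteq> {0..<int N} \<times> {0..<int N}" using N by (auto simp: \<rho>_def)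
  hence "finite (\<rho> ` S)" by (rule finite_subset) auto
  hence finR: "finite R" by (simp add: R_def)
  have RS: "R \<subseteq> S"
  proof
    fix A assume "A \<in> R"
    then obtain r where "r \<in> \<rho> ` S" "A = inv_into S \<rho> r" by (auto simp only: R_def image_iff)
    thus "A \<in> S" by (metis inv_into_into)
  qed
  have coset: "act A z = act A' z" if "A \<in> S" "A' \<in> S" "\<rho> A = \<rho> A'" "z \<in> \<H>" for A A' z
  proof -
    obtain a b c d a' b' c' d' where A: "A = (a, b, c, d)" "A' = (a', b', c', d')"
      by (metis prod.exhaust)
    show ?thesis
      using that unfolding A act_def S_def \<rho>_def prod.case mem_Collect_eq prod.inject
      by (intro mod_fun_coset[OF inv]) (auto simp only: cong_def)
  qed
  have rep: "\<exists>A'\<in>R. \<rho> A' = \<rho> A" if "A \<in> S" for A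
    using that by (auto simp: R_def f_inv_into_f)
  have "(1, 0, 0, 1) \<in> S" by (simp add: S_def)
  with rep have Rne: "R \<noteq> {}" by blast
  have "\<exists>g. g holomorphic_on ball 0 1 \<and> (\<forall>z\<in>\<H>. act A z = g (qe (z / of_real (real N))))" if "A \<in> S" for A
  proof -
    obtain a b c d where A: "A = (a, b, c, d)" "a * d - b * c = 1" using \<open>A \<in> S\<close> by (auto simp: S_def)
    have "mob a b c d holomorphic_on \<H>"
      unfolding mob_def using mob_denom_nonzero[OF _ A(2)] by (intro holomorphic_intros) auto
    hence "(f \<circ> mob a b c d) holomorphic_on \<H>"
      by (rule holomorphic_on_compose_gen[OF _ hol]) (use A(2) in auto)
    hence 1: "act A holomorphic_on \<H>" by (simp add: act_def A(1) o_def)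
    have "act A (z + of_real (real N)) = act A z" if z: "z \<in> \<H>" for z
    proof -
      have "mob 1 (int N) 0 1 z = z + of_real (real N)" by (simp add: mob_def)
      hence "act A (z + of_real (real N)) = f (mob a b c d (mob 1 (int N) 0 1 z))"
        by (simp add: act_def A(1))
      also have "mob a b c d (mob 1 (int N) 0 1 z) = mob a (a * int N + b) c (c * int N + d) z"
        using mob_mob[OF z, of 1 1 "int N" 0 a b c d] by simp
      also have "f \<dots> = f (mob a b c d z)"
        by (rule mod_fun_coset[OF inv]) (use A(2) z in \<open>auto simp: algebra_simps cong_def\<close>)
      finally show ?thesis by (simp add: act_def A(1))
    qed
    moreover have "cusp_bdd (act A)"
    proof (cases "int N dvd c")
      case True
      have "cusp_bdd (\<lambda>z. f (mob a b c d z))"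
        by (rule cusp_bdd_cong[OF _ f(2)]) (simp add: inv[OF A(2) True])
      thus ?thesis by (simp add: act_def A(1))
    qed (use bdd[OF A(2)] in \<open>simp add: act_def A(1)\<close>)
    ultimately show ?thesis using periodic_bdd_descend[OF 1, of "real N"] N by simp
  qed
  then obtain G where G: "\<And>A. A \<in> S \<Longrightarrow> G A holomorphic_on ball 0 1"
    "\<And>A z. A \<in> S \<Longrightarrow> z \<in> \<H> \<Longrightarrow> act A z = G A (qe (z / of_real (real N)))"
    by metis
  \<comment> \<open>The modulus of exp(2 pi i z / N) at Im z = 1/2.\<close>
  define r where "r = exp (- (pi / real N))"
  have r: "0 < r" "r < 1" using N by (auto simp: r_def)
  have "\<exists>w\<in>cball 0 r. \<forall>w'\<in>cball 0 r. norm (G A w') \<le> norm (G A w)" if "A \<in> S" for A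
    using r by (intro continuous_attains_sup continuous_intros holomorphic_on_imp_continuous_on
           holomorphic_on_subset[OF G(1)[OF that]]) auto
  then obtain W where W: "\<And>A. A \<in> S \<Longrightarrow> W A \<in> cball 0 r"
     "\<And>A w'. A \<in> S \<Longrightarrow> w' \<in> cball 0 r \<Longrightarrow> norm (G A w') \<le> norm (G A (W A))"
    by metis
  obtain A0 where A0: "A0 \<in> R" "\<And>A. A \<in> R \<Longrightarrow> norm (G A (W A)) \<le> norm (G A0 (W A0))"
    using Max_in[of "(\<lambda>A. norm (G A (W A))) ` R"] Max_ge[of "(\<lambda>A. norm (G A (W A))) ` R"] finR Rne by fastforce
  define M where "M = norm (G A0 (W A0))"
  have bound: "norm (act A z) \<le> M" if A: "A \<in> S" and z: "z \<in> \<H>" for A z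
  proof -
    obtain a b c d where A': "A = (a, b, c, d)" "a * d - b * c = 1" using \<open>A \<in> S\<close> by (auto simp: S_def)
    obtain a' b' c' d' where red: "a' * d' - b' * c' = 1" "Im (mob a' b' c' d' z) \<ge> 1 / 2"
      using reduce_Im_ge_half[OF z] by blast
    define w where "w = mob a' b' c' d' z"
    have w: "w \<in> \<H>" "Im w \<ge> 1 / 2" using z red by (auto simp: w_def)
    have e: "d' * a' - - b' * - c' = 1" using red by (simp add: algebra_simps)
    have z': "z = mob d' (- b') (- c') a' w"
      unfolding w_def using mob_inverse[OF z red(1)] by simp
    define B where "B = (a * d' + b * - c', a * - b' + b * a', c * d' + d * - c', c * - b' + d * a')"
    have "B \<in> S" unfolding B_def S_def using det_mult[OF A'(2) e] by simp
    then obtain B' where B': "B' \<in> R" "\<rho> B' = \<rho> B" using rep by blast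
    have "act A z = f (mob a b c d (mob d' (- b') (- c') a' w))"
      unfolding act_def A'(1) prod.case z' [symmetric] ..
    also have "\<dots> = act B w"
      unfolding act_def B_def prod.case mob_mob[OF w(1) e] ..
    finally have "act A z = act B w" .
    also have "\<dots> = act B' w"
      using B' RS by (intro coset[OF \<open>B \<in> S\<close> _ _ w(1)]) auto
    also have "\<dots> = G B' (qe (w / of_real (real N)))"
      using B' RS by (intro G(2)[OF _ w(1)]) auto
    also have "norm \<dots> \<le> norm (G B' (W B'))"
    proof (rule W(2))
      have "1 / 2 * 2 * pi \<le> Im w * 2 * pi" using w by (intro mult_right_mono) auto
      hence "pi / real N \<le> 2 * pi * Im w / real N" using N by (intro divide_right_mono) auto
      thus "qe (w / of_real (real N)) \<in> cball 0 r"
        unfolding mem_cball_0 norm_qe r_def by (simp add: Im_divide_of_nat)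
    qed (use B' RS in auto)
    also have "\<dots> \<le> M" unfolding M_def by (rule A0(2)[OF B'(1)])
    finally show ?thesis .
  qed
  have A0S: "A0 \<in> S" using A0 RS by blast
  have "G A0 constant_on ball 0 1"
  proof (rule maximum_modulus_principle[OF G(1)[OF A0S]])
    show "W A0 \<in> ball 0 1" using W(1)[OF A0S] r by simp
    show "norm (G A0 w) \<le> norm (G A0 (W A0))" if "w \<in> ball 0 1" for w
    proof (cases "w = 0")
      case True
      thus ?thesis using W(2)[OF A0S, of 0] r by simp
    next
      case False
      then obtain z where "z \<in> \<H>" "w = qe (z / of_real (real N))"
        using qe_cover[of w "real N"] \<open>w \<in> ball 0 1\<close> N by auto
      thus ?thesis using bound[OF A0S, of z] G(2)[OF A0S, of z] by (simp add: M_def)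
    qed
  qed auto
  then obtain C where C: "\<And>w. w \<in> ball 0 1 \<Longrightarrow> G A0 w = C" by (auto simp: constant_on_def)
  have actC: "act A0 z = C" if "z \<in> \<H>" for z
    unfolding G(2)[OF A0S that] using that N norm_qe_less_1[of "z / of_nat N"]
    by (intro C) (simp add: in_H_iff Im_divide_of_nat)
  obtain a b c d where abcd: "A0 = (a, b, c, d)" "a * d - b * c = 1" using A0S by (auto simp: S_def)
  have "f z = C" if z: "z \<in> \<H>" for z
  proof -
    have e: "d * a - - b * - c = 1" using abcd by (simp add: algebra_simps)
    have "f (mob a b c d (mob d (- b) (- c) a z)) = C"
      using actC[of "mob d (- b) (- c) a z"] mob_in_H[OF z e] by (simp add: abcd act_def)
    also have "mob a b c d (mob d (- b) (- c) a z) = z"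
      using mob_inverse[OF z e] by simp
    finally show ?thesis .
  qed
  thus ?thesis by blast
qed

subsection \<open>Fourier expansions\<close>

lemma of_nat_in_H: "z \<in> \<H> \<Longrightarrow> p > 0 \<Longrightarrow> of_nat p * z \<in> \<H>"
  "z \<in> \<H> \<Longrightarrow> p > 0 \<Longrightarrow> (z + of_nat j) / of_nat p \<in> \<H>"
  "z \<in> \<H> \<Longrightarrow> p > 0 \<Longrightarrow> (z + of_int k) / of_nat p \<in> \<H>"
  by (simp_all add: in_H_iff Im_divide_of_nat)

text \<open>In contrast to \<open>has_q_expansion\<close>, the series itself has to converge and
  represent f on all of \<H>, so that sums, products, U and V can be computed pointwise.\<close>

definition qexp :: "(complex \<Rightarrow> complex) \<Rightarrow> complex fls \<Rightarrow> bool" where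
  "qexp f F \<longleftrightarrow> f holomorphic_on \<H> \<and> fls_conv_radius F \<ge> 1 \<and> (\<forall>z\<in>\<H>. f z = eval_fls F (qe z))"

lemma qexp_holomorphic: "qexp f F \<Longrightarrow> f holomorphic_on \<H>"
  by (simp add: qexp_def)

lemma qe_in_radius:
  assumes "fls_conv_radius F \<ge> 1" "z \<in> \<H>"
  shows "ereal (norm (qe z)) < fls_conv_radius F"
proof -
  have "ereal (norm (qe z)) < 1" using norm_qe_less_1[of z] assms(2) by (simp add: in_H_iff one_ereal_def)
  thus ?thesis using assms(1) by (rule less_le_trans)
qed

text \<open>The expansion is given only near q = 0; holomorphy of f on \<H> continues it to the
  punctured unit disc.\<close>

lemma has_q_expansion_imp_qexp:
  assumes "f holomorphic_on \<H>" "has_q_expansion f 1 F"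
  shows "qexp f F"
proof -
  obtain g where g: "g has_laurent_expansion F" "\<And>z. z \<in> \<H> \<Longrightarrow> f z = g (qe z)"
    using assms(2) by (auto simp: has_q_expansion_def qe_def)
  have "g holomorphic_on ball 0 1 - {0}"
    by (rule holomorphic_descend[OF assms(1), of 1]) (use g in auto)
  hence hol: "g holomorphic_on eball 0 1 - {0}" by (simp add: one_ereal_def)
  have "f z = eval_fls F (qe z)" if "z \<in> \<H>" for z
    using eval_fls_eqI[OF g(1) hol, of "qe z"] g(2)[OF that] norm_qe_less_1[of z] that
    by (simp add: in_H_iff one_ereal_def)
  thus ?thesis using assms(1) fls_conv_radius_ge[OF g(1) hol] by (simp add: qexp_def)
qed

lemma qexp_cong:
  assumes "qexp f F" "\<And>z. z \<in> \<H> \<Longrightarrow> g z = f z"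
  shows "qexp g F"
  using assms holomorphic_transform[of f \<H> g] by (auto simp: qexp_def)

lemma qexp_const: "qexp (\<lambda>_. c) (fls_const c)"
  by (auto simp: qexp_def intro!: holomorphic_intros)

lemma qexp_add:
  assumes "qexp f F" "qexp g G"
  shows "qexp (\<lambda>z. f z + g z) (F + G)"
  using assms qe_in_radius[of F] qe_in_radius[of G] fls_conv_radius_add[of F G]
  by (auto simp: qexp_def eval_fls_add intro!: holomorphic_intros intro: order_trans[rotated])

lemma qexp_mult:
  assumes "qexp f F" "qexp g G"
  shows "qexp (\<lambda>z. f z * g z) (F * G)"
  using assms qe_in_radius[of F] qe_in_radius[of G] fls_conv_radius_mult[of F G]
  by (auto simp: qexp_def eval_fls_mult intro!: holomorphic_intros intro: order_trans[rotated])

lemma qexp_cmult: "qexp f F \<Longrightarrow> qexp (\<lambda>z. c * f z) (fls_const c * F)"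
  by (rule qexp_mult[OF qexp_const])

lemma qexp_minus: "qexp f F \<Longrightarrow> qexp (\<lambda>z. - f z) (- F)"
  using qexp_cmult[of f F "-1"] by simp

lemma qexp_diff: "qexp f F \<Longrightarrow> qexp g G \<Longrightarrow> qexp (\<lambda>z. f z - g z) (F - G)"
  using qexp_add[OF _ qexp_minus, of f F g G] by simp

lemma qexp_power: "qexp f F \<Longrightarrow> qexp (\<lambda>z. f z ^ n) (F ^ n)"
proof (induction n)
  case 0
  show ?case using qexp_const[of 1] by simp
qed (auto intro: qexp_mult)

lemma qexp_sum:
  assumes "\<And>i. i \<in> A \<Longrightarrow> qexp (f i) (F i)"
  shows "qexp (\<lambda>z. \<Sum>i\<in>A. f i z) (\<Sum>i\<in>A. F i)"
  using assms
proof (induction A rule: infinite_finite_induct)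
  case (insert x A)
  thus ?case by (auto intro: qexp_add)
qed (use qexp_const[of 0] in simp_all)

lemma qexp_unique:
  assumes "qexp f F" "qexp g G" "\<And>z. z \<in> \<H> \<Longrightarrow> f z = g z"
  shows "F = G"
proof -
  have "eventually (\<lambda>w. w \<in> ball 0 1 - {0}) (at (0 :: complex))"
    by (rule eventually_at_in_open) auto
  hence "eventually (\<lambda>w. eval_fls F w = eval_fls G w) (at 0)"
  proof eventually_elim
    case (elim w)
    then obtain z where "z \<in> \<H>" "w = qe (z / of_real 1)" using qe_cover[of w 1] by auto
    thus ?case using assms by (auto simp: qexp_def)
  qed
  moreover have "fls_conv_radius F > 0" "fls_conv_radius G > 0"
    using assms less_le_trans[of 0 "1 :: ereal"] by (auto simp: qexp_def)
  ultimately have "eval_fls G has_laurent_expansion F" "eval_fls G has_laurent_expansion G"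
    by (auto simp: has_laurent_expansion_def)
  thus ?thesis by (rule has_laurent_expansion_unique)
qed

lemma qexp_0_imp: "qexp f 0 \<Longrightarrow> z \<in> \<H> \<Longrightarrow> f z = 0"
  by (simp add: qexp_def)

lemma qexp_imp_cusp_bdd:
  assumes "qexp f F" "\<And>n. n < 0 \<Longrightarrow> fls_nth F n = 0"
  shows "cusp_bdd f"
proof -
  have sub: "fls_subdegree F \<ge> 0" using assms(2) by (cases "F = 0") (auto intro: fls_subdegree_geI)
  have rad: "fls_conv_radius F \<ge> 1" using assms by (simp add: qexp_def)
  define r where "r = exp (- 2 * pi)"
  have "r < 1" by (simp add: r_def)
  hence "ereal r < 1" by (simp add: one_ereal_def)
  hence "ereal r < fls_conv_radius F" using rad by (rule less_le_trans)
  hence "cball 0 r \<subseteq> eball 0 (fls_conv_radius F)"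
    by (metis ereal_less_eq(3) in_eball_iff le_less_trans mem_cball subsetI)
  hence "continuous_on (cball 0 r) (eval_fls F)"
    using sub by (intro continuous_on_eval_fls) auto
  hence "bounded (eval_fls F ` cball 0 r)"
    by (intro compact_imp_bounded compact_continuous_image) auto
  then obtain B where B: "\<And>w. w \<in> cball 0 r \<Longrightarrow> norm (eval_fls F w) \<le> B"
    unfolding bounded_iff ball_simps by blast
  have "norm (f z) \<le> B" if "Im z > 1" for z
  proof -
    have "qe z \<in> cball 0 r" using that by (simp add: norm_qe r_def)
    moreover have "f z = eval_fls F (qe z)" using assms(1) that by (simp add: qexp_def in_H_iff)
    ultimately show ?thesis using B by simp
  qed
  thus ?thesis by (rule cusp_bddI)
qed

lemma has_q_expansion_imp_cusp_bdd:
  assumes "has_q_expansion f h F" "fls_subdegree F \<ge> 0" "h > 0"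
  shows "cusp_bdd f"
proof -
  obtain g where g: "g has_laurent_expansion F" "\<And>z. z \<in> \<H> \<Longrightarrow> f z = g (qe (z / of_nat h))"
    using assms(1) by (auto simp: has_q_expansion_def qe_def)
  have "(g \<longlongrightarrow> fls_nth F 0) (at 0)"
    using has_laurent_expansion_imp_tendsto_0[OF g(1) assms(2)] .
  hence "eventually (\<lambda>w. dist (g w) (fls_nth F 0) < 1) (at 0)"
    by (rule tendstoD) auto
  then obtain r where r: "r > 0" "\<And>w. w \<noteq> 0 \<Longrightarrow> norm w < r \<Longrightarrow> dist (g w) (fls_nth F 0) < 1"
    unfolding eventually_at by (auto simp: dist_norm)
  have "norm (f z) \<le> norm (fls_nth F 0) + 1" if "Im z > max 0 (- ln r * h / (2 * pi))" for z
  proof -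
    have "- (2 * pi * Im z / h) < ln r" using that assms(3) by (simp add: field_simps)
    hence "norm (qe (z / of_nat h)) < r"
      using r(1) by (simp add: norm_qe Im_divide_of_nat) (metis exp_less_mono exp_ln)
    hence "dist (g (qe (z / of_nat h))) (fls_nth F 0) < 1" by (intro r) auto
    moreover have "f z = g (qe (z / of_nat h))" using that by (intro g) (simp add: in_H_iff)
    ultimately show ?thesis using norm_triangle_ineq2[of "f z" "fls_nth F 0"] by (simp add: dist_norm)
  qed
  thus ?thesis by (rule cusp_bddI)
qed

text \<open>U and V reindex the series, which is easiest for convergent sums once the pole is
  multiplied away. In the converse direction, convergence at the positive reals below 1 already
  forces radius at least 1.\<close>

lemma qexp_shift_iff:
  "qexp f (fls_shift (int M) (fps_to_fls G)) \<longleftrightarrow>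
     f holomorphic_on \<H> \<and> (\<forall>z\<in>\<H>. (\<lambda>n. fps_nth G n * qe z ^ n) sums (f z * qe z ^ M))"
  (is "?lhs \<longleftrightarrow> ?rhs")
proof
  assume ?lhs
  hence *: "f holomorphic_on \<H>" "fps_conv_radius G \<ge> 1" 
    "\<And>z. z \<in> \<H> \<Longrightarrow> f z = eval_fls (fls_shift (int M) (fps_to_fls G)) (qe z)"
    by (auto simp: qexp_def)
  have "(\<lambda>n. fps_nth G n * qe z ^ n) sums (f z * qe z ^ M)" if z: "z \<in> \<H>" for z
  proof -
    have n: "ereal (norm (qe z)) < fps_conv_radius G"
      using qe_in_radius[of "fps_to_fls G" z] * z by simp
    have "f z * qe z ^ M = eval_fps G (qe z)"
      using n *(3)[OF z] by (simp add: eval_fls_shift eval_fps_to_fls power_int_minus)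
    thus ?thesis using sums_eval_fps[OF n] by simp
  qed
  thus ?rhs using * by blast
next
  assume r: ?rhs
  have "fps_conv_radius G \<ge> 1"
    unfolding fps_conv_radius_def
  proof (rule conv_radius_geI_ex)
    fix r :: real assume r': "0 < r" "ereal r < 1"
    then obtain z where z: "z \<in> \<H>" "of_real r = qe z"
      using qe_cover[of "of_real r" 1] by (auto simp: one_ereal_def)
    have "norm (qe z) = r" unfolding z(2) [symmetric] using r' by simp
    moreover have "summable (\<lambda>n. fps_nth G n * qe z ^ n)" using r z(1) by (auto simp: sums_iff)
    ultimately show "\<exists>w. norm w = r \<and> summable (\<lambda>n. fps_nth G n * w ^ n)" by blast
  qed
  moreover have "f z = eval_fls (fls_shift (int M) (fps_to_fls G)) (qe z)" if z: "z \<in> \<H>" for z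
  proof -
    have n: "ereal (norm (qe z)) < fps_conv_radius G"
      using qe_in_radius[of "fps_to_fls G" z] calculation z by simp
    have "eval_fps G (qe z) = f z * qe z ^ M" using r z by (simp add: eval_fps_def sums_iff)
    thus ?thesis using n by (simp add: eval_fls_shift eval_fps_to_fls power_int_minus)
  qed
  ultimately show ?lhs using r by (simp add: qexp_def)
qed

text \<open>The pole is cleared by q^(p M) because this factor, taken at (z + j) / p, is q^M at z
  for every j.\<close>

lemma fls_as_shift_fps:
  assumes "p > 0"
  obtains M G where "F = fls_shift (int (p * M)) (fps_to_fls G)"
proof -
  define M where "M = nat (- fls_subdegree F)"
  have "M \<le> p * M" using assms by simp
  hence "int (p * M) \<ge> - fls_subdegree F" unfolding M_def by linarith
  thus ?thesis using that fls_as_fps by metis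
qed

section \<open>The operators U and V on Fourier expansions\<close>

definition hecke_U :: "nat \<Rightarrow> (complex \<Rightarrow> complex) \<Rightarrow> complex \<Rightarrow> complex" where
  "hecke_U p f z = (\<Sum>j<p. f ((z + of_nat j) / of_nat p)) / of_nat p"

definition fls_U :: "nat \<Rightarrow> complex fls \<Rightarrow> complex fls" where
  "fls_U p F = Abs_fls (\<lambda>n. fls_nth F (int p * n))"

lemma fls_nth_U:
  assumes "p > 0"
  shows "fls_nth (fls_U p F) n = fls_nth F (int p * n)"
  unfolding fls_U_def
proof (rule nth_Abs_fls_lower_bound)
  show "\<forall>k < min 0 (fls_subdegree F). fls_nth F (int p * k) = 0"
  proof safe
    fix k assume k: "k < min 0 (fls_subdegree F)"
    have "int p * k \<le> 1 * k" using k assms by (intro mult_right_mono_neg) auto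
    hence "int p * k < fls_subdegree F" using k by linarith
    thus "fls_nth F (int p * k) = 0" by simp
  qed
qed

lemma sum_roots_of_unity:
  assumes "p > 0"
  shows "(\<Sum>j<p. qe (of_nat j * of_nat n / of_nat p)) = (if p dvd n then of_nat p else 0)"
proof -
  define w where "w = qe (of_nat n / of_nat p)"
  have "(\<Sum>j<p. qe (of_nat j * of_nat n / of_nat p)) = (\<Sum>j<p. w ^ j)"
    by (simp add: w_def qe_power)
  also have "\<dots> = (if p dvd n then of_nat p else 0)"
  proof (cases "p dvd n")
    case True
    then obtain k where "n = p * k" by blast
    hence "w = 1" using assms by (simp add: w_def)
    thus ?thesis using True by simp
  next
    case False
    have "w \<noteq> 1"
    proof
      assume "w = 1"
      then obtain k where "of_nat n / of_nat p = (of_int k :: complex)"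
        unfolding w_def qe_eq_1_iff by (auto elim: Ints_cases)
      hence "(of_int (int n) :: complex) = of_int (k * int p)" using assms by (simp add: field_simps)
      hence "int n = k * int p" using of_int_eq_iff by blast
      thus False using False by (metis dvd_triv_right int_dvd_int_iff)
    qed
    moreover have "w ^ p = 1" using assms by (simp add: w_def qe_power)
    ultimately show ?thesis using False by (simp add: geometric_sum)
  qed
  finally show ?thesis .
qed

lemma holomorphic_U:
  assumes "f holomorphic_on \<H>" "p > 0"
  shows "hecke_U p f holomorphic_on \<H>"
proof -
  have "(f \<circ> (\<lambda>z. (z + of_nat j) / of_nat p)) holomorphic_on \<H>" for j
    by (rule holomorphic_on_compose_gen[OF _ assms(1)])
       (use assms(2) in \<open>auto intro!: holomorphic_intros of_nat_in_H\<close>)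
  thus ?thesis unfolding hecke_U_def using assms(2)
    by (intro holomorphic_intros) (simp_all add: o_def)
qed

lemma qexp_U:
  assumes f: "qexp f F" and p: "p > 0"
  shows "qexp (hecke_U p f) (fls_U p F)"
proof -
  obtain M G where F: "F = fls_shift (int (p * M)) (fps_to_fls G)" using fls_as_shift_fps[OF p] by metis
  have hol: "f holomorphic_on \<H>"
    and s: "\<And>z. z \<in> \<H> \<Longrightarrow> (\<lambda>n. fps_nth G n * qe z ^ n) sums (f z * qe z ^ (p * M))"
    using f unfolding F qexp_shift_iff by auto
  define G' where "G' = Abs_fps (\<lambda>k. fps_nth G (p * k))"
  have FU: "fls_U p F = fls_shift (int M) (fps_to_fls G')"
  proof (rule fls_eqI)
    fix n
    have "int p * n + int (p * M) = int p * (n + int M)" by (simp add: algebra_simps)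
    moreover have "int p * k < 0 \<longleftrightarrow> k < 0" "nat (int p * k) = p * nat k" for k
      using p by (auto simp: mult_less_0_iff nat_mult_distrib)
    ultimately show "fls_nth (fls_U p F) n = fls_nth (fls_shift (int M) (fps_to_fls G')) n"
      using p by (simp add: fls_nth_U F G'_def)
  qed
  have "(\<lambda>n. fps_nth G' n * qe z ^ n) sums (hecke_U p f z * qe z ^ M)" if z: "z \<in> \<H>" for z
  proof -
    have "(\<lambda>n. (\<Sum>j<p. fps_nth G n * qe ((z + of_nat j) / of_nat p) ^ n) / of_nat p) sums
          ((\<Sum>j<p. f ((z + of_nat j) / of_nat p) * qe ((z + of_nat j) / of_nat p) ^ (p * M)) / of_nat p)"
      by (intro sums_divide sums_sum s of_nat_in_H z p)
    moreover have "qe ((z + of_nat j) / of_nat p) ^ (p * M) = qe z ^ M" for j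
    proof -
      have "qe ((z + of_nat j) / of_nat p) ^ p = qe z" using p by (simp add: qe_power qe_add)
      thus ?thesis by (simp add: power_mult)
    qed
    moreover have "(\<Sum>j<p. fps_nth G n * qe ((z + of_nat j) / of_nat p) ^ n) / of_nat p =
       (if p dvd n then fps_nth G n * qe z ^ (n div p) else 0)" for n
    proof -
      have "qe ((z + of_nat j) / of_nat p) ^ n = qe (of_nat n * z / of_nat p) * qe (of_nat j * of_nat n / of_nat p)" for j
        by (simp add: qe_power qe_add [symmetric] add_divide_distrib ring_distribs mult_ac)
      hence "(\<Sum>j<p. fps_nth G n * qe ((z + of_nat j) / of_nat p) ^ n) =
         fps_nth G n * qe (of_nat n * z / of_nat p) * (\<Sum>j<p. qe (of_nat j * of_nat n / of_nat p))"
        by (simp add: sum_distrib_left mult_ac)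
      thus ?thesis using p by (auto simp: sum_roots_of_unity qe_power elim!: dvdE)
    qed
    ultimately have "(\<lambda>n. if p dvd n then fps_nth G n * qe z ^ (n div p) else 0) sums (hecke_U p f z * qe z ^ M)"
      by (simp add: hecke_U_def sum_distrib_right)
    hence "(\<lambda>k. (\<lambda>n. if p dvd n then fps_nth G n * qe z ^ (n div p) else 0) (p * k)) sums (hecke_U p f z * qe z ^ M)"
      by (subst sums_mono_reindex) (use p in \<open>auto simp: strict_mono_def\<close>)
    thus ?thesis using p by (simp add: G'_def)
  qed
  thus ?thesis unfolding FU qexp_shift_iff using holomorphic_U[OF hol p] by blast
qed

lemma qexp_V:
  assumes f: "qexp f F" and p: "p > 0"
  shows "qexp (\<lambda>z. f (of_nat p * z)) (fls_compose_power F p)"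
proof -
  obtain M G where F: "F = fls_shift (int M) (fps_to_fls G)"
    using fls_as_shift_fps[of 1 F] by (metis mult_1 zero_less_one)
  have hol: "f holomorphic_on \<H>"
    and s: "\<And>z. z \<in> \<H> \<Longrightarrow> (\<lambda>n. fps_nth G n * qe z ^ n) sums (f z * qe z ^ M)"
    using f unfolding F qexp_shift_iff by auto
  have FV: "fls_compose_power F p = fls_shift (int (p * M)) (fps_to_fls (G oo fps_X ^ p))"
    using p by (simp add: F fls_compose_power_fps_to_fls)
  have "(f \<circ> (\<lambda>z. of_nat p * z)) holomorphic_on \<H>"
    by (rule holomorphic_on_compose_gen[OF _ hol]) (use p in \<open>auto intro!: holomorphic_intros of_nat_in_H\<close>)
  moreover have "(\<lambda>n. fps_nth (G oo fps_X ^ p) n * qe z ^ n) sums (f (of_nat p * z) * qe z ^ (p * M))" if z: "z \<in> \<H>" for z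
  proof -
    have "(\<lambda>n. fps_nth G n * qe (of_nat p * z) ^ n) sums (f (of_nat p * z) * qe (of_nat p * z) ^ M)"
      by (intro s of_nat_in_H z p)
    hence "(\<lambda>k. (\<lambda>n. fps_nth (G oo fps_X ^ p) n * qe z ^ n) (p * k)) sums (f (of_nat p * z) * qe z ^ (p * M))"
      using p by (simp add: fps_nth_compose_X_power qe_power mult_ac)
    thus ?thesis
      by (subst (asm) sums_mono_reindex) (use p in \<open>auto simp: strict_mono_def fps_nth_compose_X_power\<close>)
  qed
  ultimately show ?thesis unfolding FV qexp_shift_iff by (simp add: o_def)
qed

subsection \<open>Descent of the level\<close>

definition Gamma0_inv :: "nat \<Rightarrow> (complex \<Rightarrow> complex) \<Rightarrow> bool" where
  "Gamma0_inv N f \<longleftrightarrow> (\<forall>a b c d. a * d - b * c = 1 \<and> int N dvd c \<longrightarrow> (\<forall>z\<in>\<H>. f (mob a b c d z) = f z))"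

lemma Gamma0_invD:
  "Gamma0_inv N f \<Longrightarrow> a * d - b * c = 1 \<Longrightarrow> int N dvd c \<Longrightarrow> z \<in> \<H> \<Longrightarrow> f (mob a b c d z) = f z"
  by (auto simp: Gamma0_inv_def)

lemma mod_fun_iff:
  "mod_fun N f \<longleftrightarrow> f holomorphic_on \<H> \<and> Gamma0_inv N f \<and>
     (\<forall>a b c d. a * d - b * c = 1 \<and> \<not> int N dvd c \<longrightarrow> cusp_bdd (\<lambda>z. f (mob a b c d z)))"
  by (simp add: mod_fun_def Gamma0_inv_def)

lemma mod_fun_const: "mod_fun N (\<lambda>_. c)"
  by (auto simp: mod_fun_def intro!: holomorphic_intros cusp_bdd_const)

lemma mod_fun_add: "mod_fun N f \<Longrightarrow> mod_fun N g \<Longrightarrow> mod_fun N (\<lambda>z. f z + g z)"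
  unfolding mod_fun_def by (auto intro!: holomorphic_intros cusp_bdd_add)

lemma mod_fun_mult: "mod_fun N f \<Longrightarrow> mod_fun N g \<Longrightarrow> mod_fun N (\<lambda>z. f z * g z)"
  unfolding mod_fun_def by (auto intro!: holomorphic_intros cusp_bdd_mult)

lemma mod_fun_minus: "mod_fun N f \<Longrightarrow> mod_fun N (\<lambda>z. - f z)"
  using mod_fun_mult[OF mod_fun_const[of N "-1"], of f] by simp

lemma mod_fun_diff: "mod_fun N f \<Longrightarrow> mod_fun N g \<Longrightarrow> mod_fun N (\<lambda>z. f z - g z)"
  using mod_fun_add[OF _ mod_fun_minus, of N f g] by simp

lemma mod_fun_power: "mod_fun N f \<Longrightarrow> mod_fun N (\<lambda>z. f z ^ n)"
proof (induction n)
  case 0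
  show ?case using mod_fun_const[of N 1] by simp
qed (auto intro: mod_fun_mult)

lemma mod_fun_sum: "(\<And>i. i \<in> A \<Longrightarrow> mod_fun N (f i)) \<Longrightarrow> mod_fun N (\<lambda>z. \<Sum>i\<in>A. f i z)"
proof (induction A rule: infinite_finite_induct)
  case (insert x A)
  thus ?case by (auto intro: mod_fun_add)
qed (use mod_fun_const[of N 0] in simp_all)

text \<open>The comparison principle behind the identities below: without a pole at infinity the
  function is bounded at every cusp, hence constant, and the constant is the coefficient of index
  0.\<close>

lemma mod_fun_qexp_eq_0:
  assumes "mod_fun N f" "N > 0" "qexp f F" "\<And>n. n \<le> 0 \<Longrightarrow> fls_nth F n = 0"
  shows "F = 0"
proof -
  have "cusp_bdd f" using assms by (intro qexp_imp_cusp_bdd[OF assms(3)]) auto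
  then obtain C where "\<And>z. z \<in> \<H> \<Longrightarrow> f z = C"
    using mod_fun_bounded_imp_constant assms by blast
  hence F: "F = fls_const C" using qexp_unique[OF assms(3) qexp_const] by blast
  moreover have "C = 0" using assms(4)[of 0] by (simp add: F)
  ultimately show ?thesis by simp
qed

lemma mod_fun_qexp_unique:
  assumes "mod_fun N f" "mod_fun N g" "N > 0" "qexp f F" "qexp g G"
    "\<And>n. n \<le> 0 \<Longrightarrow> fls_nth F n = fls_nth G n"
  shows "F = G"
  using mod_fun_qexp_eq_0[OF mod_fun_diff[OF assms(1,2)] assms(3) qexp_diff[OF assms(4,5)]] assms(6) by simp

lemma M0_sharp_imp_mod_fun:
  assumes "f \<in> M0_sharp N"
  shows "mod_fun N f"
proof -
  define mat where "mat = (\<lambda>a b c d. vector [vector [a, b], vector [c, d]] :: int ^ 2 ^ 2)"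
  have mat: "mat a b c d \<in> SL2Z \<longleftrightarrow> a * d - b * c = 1" "moebius (mat a b c d) = mob a b c d"
    "mat a b c d $ 2 $ 1 = c" for a b c d
    by (auto simp: mat_def SL2Z_def det_2 vector_2 moebius_def mob_def fun_eq_iff)
  have f: "f holomorphic_on \<H>" "\<And>A z. A \<in> Gamma0 N \<Longrightarrow> z \<in> \<H> \<Longrightarrow> f (moebius A z) = f z"
     "\<And>A. A \<in> SL2Z - Gamma0 N \<Longrightarrow> \<exists>h>0. \<exists>F. has_q_expansion (\<lambda>z. f (moebius A z)) h F \<and> fls_subdegree F \<ge> 0"
    using assms by (auto simp: M0_sharp_def)
  show ?thesis
    unfolding mod_fun_def
  proof (intro conjI allI impI ballI f(1))
    fix a b c d :: int and z assume "a * d - b * c = 1 \<and> int N dvd c" "z \<in> \<H>"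
    thus "f (mob a b c d z) = f z"
      using f(2)[of "mat a b c d" z] by (simp add: mat Gamma0_def)
  next
    fix a b c d :: int assume "a * d - b * c = 1 \<and> \<not> int N dvd c"
    hence "mat a b c d \<in> SL2Z - Gamma0 N" by (simp add: mat Gamma0_def)
    from f(3)[OF this] show "cusp_bdd (\<lambda>z. f (mob a b c d z))"
      using has_q_expansion_imp_cusp_bdd by (auto simp: mat)
  qed
qed

text \<open>The matrix identity (1 j; 0 p) g = g' (1 j'; 0 p). The condition on j' expresses that
  the upper right entry B of g' is an integer.\<close>

lemma hecke_U_term:
  assumes "p > 0" "z \<in> \<H>" "a * d - b * c = 1" "int p * B = b + j * d - (a + j * c) * j'"
  shows "(mob a b c d z + of_int j) / of_nat p = mob (a + j * c) B (int p * c) (d - c * j') ((z + of_int j') / of_nat p)"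
    and "(a + j * c) * (d - c * j') - B * (int p * c) = 1"
proof -
  have nz: "of_int c * z + of_int d \<noteq> 0" by (rule mob_denom_nonzero[OF assms(2,3)])
  have B: "of_nat p * of_int B = (of_int b + of_int j * of_int d - (of_int a + of_int j * of_int c) * of_int j' :: complex)"
    using arg_cong[OF assms(4), of "of_int :: int \<Rightarrow> complex"] by simp
  have p: "of_nat p \<noteq> (0 :: complex)" using assms by simp
  have den: "of_int (int p * c) * ((z + of_int j') / of_nat p) + of_int (d - c * j') = of_int c * z + of_int d"
    using p by (simp add: field_simps)
  have num: "of_int (a + j * c) * ((z + of_int j') / of_nat p) + of_int B =
      (of_int a * z + of_int b + of_int j * (of_int c * z + of_int d)) / of_nat p"
  proof -
    have "of_nat p * (of_int (a + j * c) * ((z + of_int j') / of_nat p) + of_int B) =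
      of_int (a + j * c) * (z + of_int j') + of_nat p * of_int B"
      using p by (simp add: field_simps)
    also have "\<dots> = of_int a * z + of_int b + of_int j * (of_int c * z + of_int d)"
      unfolding B by (simp add: algebra_simps)
    finally show ?thesis using p by (metis nonzero_mult_div_cancel_left)
  qed
  show "(mob a b c d z + of_int j) / of_nat p = mob (a + j * c) B (int p * c) (d - c * j') ((z + of_int j') / of_nat p)"
    unfolding mob_def[of "a + j * c"] den num using nz p by (simp add: mob_def field_simps)
  have "(a + j * c) * (d - c * j') - B * (int p * c) = (a + j * c) * (d - c * j') - c * (int p * B)"
    by (simp add: mult_ac)
  also have "\<dots> = 1" unfolding assms(4) using assms(3) by (simp add: algebra_simps)
  finally show "(a + j * c) * (d - c * j') - B * (int p * c) = 1" .
qed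

lemma solve_lin_mod_prime:
  assumes "prime p" "\<not> int p dvd A"
  shows "\<exists>j<p. int p dvd B - A * int j"
proof -
  have "prime (int p)" using assms(1) by simp
  hence "coprime (int p) A" using assms(2) by (rule prime_imp_coprime)
  hence "coprime A (int p)" by (simp only: coprime_commute)
  then obtain y where "[A * y = 1] (mod int p)" using cong_solve_coprime_int by blast
  hence "[A * y * B = 1 * B] (mod int p)" by (rule cong_scalar_right)
  then obtain x where x: "[A * x = B] (mod int p)" by (simp only: mult.assoc mult_1) 
  have p: "p > 0" using assms prime_gt_0_nat by blast
  have "[A * (x mod int p) = B] (mod int p)" using x by (simp add: cong_def mod_mult_right_eq)
  hence "int p dvd B - A * (x mod int p)" by (simp add: cong_iff_dvd_diff dvd_diff_commute)
  thus ?thesis using p by (intro exI[of _ "nat (x mod int p)"]) (auto simp: nat_less_iff)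
qed

text \<open>Since p divides c, both a + j c and d are units modulo p, so j -> j' permutes the
  residues and the sum is only rearranged. The condition on M covers the drop from level p N to N
  and also M = N = p, where U preserves the level.\<close>

lemma Gamma0_inv_U:
  assumes f: "Gamma0_inv M f" and p: "prime p" "p dvd N" and M: "M dvd p * N"
  shows "Gamma0_inv N (hecke_U p f)"
  unfolding Gamma0_inv_def
proof (intro allI impI ballI)
  fix a b c d :: int and z assume *: "a * d - b * c = 1 \<and> int N dvd c" and z: "z \<in> \<H>"
  have p0: "p > 0" using p prime_gt_0_nat by blast
  have pc: "int p dvd c" using * p by (meson dvd_trans int_dvd_int_iff)
  have pi: "prime (int p)" using p by simp
  have nd: "\<not> int p dvd a + j * c" "\<not> int p dvd d" for j
  proof -
    have "\<not> int p dvd 1" using pi not_prime_unit by blast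
    hence nad: "\<not> int p dvd a * d" using * pc by (metis dvd_diff dvd_mult)
    thus "\<not> int p dvd d" by auto
    have "\<not> int p dvd a" using nad by auto
    thus "\<not> int p dvd a + j * c" using pc by (metis dvd_add_left_iff dvd_mult)
  qed
  have "\<exists>j'<p. int p dvd (b + int j * d) - (a + int j * c) * int j'" for j
    by (rule solve_lin_mod_prime[OF p(1) nd(1)])
  then obtain s where s: "\<And>j. s j < p" "\<And>j. int p dvd (b + int j * d) - (a + int j * c) * int (s j)"
    by metis
  have inj: "inj_on s {..<p}"
  proof (rule inj_onI)
    fix j k assume jk: "j \<in> {..<p}" "k \<in> {..<p}" "s j = s k"
    have "int p dvd ((b + int j * d) - (a + int j * c) * int (s j)) - ((b + int k * d) - (a + int k * c) * int (s k))"
      by (intro dvd_diff s)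
    also have "\<dots> = (int j - int k) * d - c * ((int j - int k) * int (s k))"
      using jk(3) by (simp add: algebra_simps)
    finally have "int p dvd (int j - int k) * d" using pc by (metis dvd_diff_left_iff dvd_mult2)
    hence "int p dvd int j - int k" using nd(2) pi prime_dvd_mult_iff by blast
    hence "[int j = int k] (mod int p)" by (simp add: cong_iff_dvd_diff)
    thus "j = k" using jk by (simp add: cong_int_iff cong_less_modulus_unique_nat)
  qed
  have "f ((mob a b c d z + of_nat j) / of_nat p) = f ((z + of_nat (s j)) / of_nat p)" for j
  proof -
    obtain B where B: "int p * B = b + int j * d - (a + int j * c) * int (s j)" using s(2)[of j] by (metis dvdE)
    have "int M dvd int (p * N)" using M by (simp only: int_dvd_int_iff)
    moreover have "int (p * N) dvd int p * c" using * by simp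
    ultimately have "int M dvd int p * c" by (rule dvd_trans)
    thus ?thesis
      using hecke_U_term[OF p0 z conjunct1[OF *] B] Gamma0_invD[OF f] of_nat_in_H(2)[OF z p0, of "s j"] by simp
  qed
  moreover have "(\<Sum>j<p. f ((z + of_nat (s j)) / of_nat p)) = (\<Sum>j<p. f ((z + of_nat j) / of_nat p))"
  proof -
    have "bij_betw s {..<p} {..<p}"
      using inj s(1) endo_inj_surj[of "{..<p}" s] by (auto simp: bij_betw_def)
    thus ?thesis by (rule sum.reindex_bij_betw)
  qed
  ultimately show "hecke_U p f (mob a b c d z) = hecke_U p f z"
    by (simp add: hecke_U_def)
qed

text \<open>At the other cusps there are two kinds of summands. If p does not divide a + j c, the
  matrix g' of \<open>hecke_U_term\<close> has lower left entry p c, which p N does not divide.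
  Otherwise p does not divide c, and (1 j; 0 p) g = g' (p 0; 0 1) with lower left entry c. In both
  cases f is bounded along g'.\<close>

lemma mod_fun_U:
  assumes f: "mod_fun (p * N) f" and p: "prime p" "p dvd N"
  shows "mod_fun N (hecke_U p f)"
  unfolding mod_fun_iff
proof (intro conjI allI impI)
  have p0: "p > 0" using p prime_gt_0_nat by blast
  have pi: "prime (int p)" using p by simp
  show "hecke_U p f holomorphic_on \<H>" using f p0 by (intro holomorphic_U) (auto simp: mod_fun_def)
  show "Gamma0_inv N (hecke_U p f)" using f p by (intro Gamma0_inv_U[of "p * N"]) (auto simp: mod_fun_iff)
  fix a b c d :: int assume *: "a * d - b * c = 1 \<and> \<not> int N dvd c"
  have bdd: "cusp_bdd (\<lambda>z. f (mob a b c d z))" if "a * d - b * c = 1" "\<not> int (p * N) dvd c" for a b c d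
    using f that by (auto simp: mod_fun_def)
  have "cusp_bdd (\<lambda>z. f ((mob a b c d z + of_int j) / of_nat p))" for j
  proof (cases "int p dvd a + j * c")
    case False
    obtain j' where "int p dvd (b + j * d) - (a + j * c) * int j'"
      using solve_lin_mod_prime[OF p(1) False] by blast
    then obtain B where B: "int p * B = b + j * d - (a + j * c) * int j'" by (metis dvdE)
    have "\<not> int (p * N) dvd int p * c" using * p0 by simp
    hence "cusp_bdd (\<lambda>z. f (mob (a + j * c) B (int p * c) (d - c * int j') z))"
      using hecke_U_term(2)[OF p0 _ conjunct1[OF *] B, of \<i>] by (intro bdd) (auto simp: in_H_iff)
    from cusp_bdd_affine[OF this, of "1 / real p" "real j' / real p"] p0
    have "cusp_bdd (\<lambda>z. f (mob (a + j * c) B (int p * c) (d - c * int j') ((z + of_int (int j')) / of_nat p)))"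
      by (simp add: add_divide_distrib)
    thus ?thesis
      by (rule cusp_bdd_cong[rotated]) (simp only: hecke_U_term(1)[OF p0 _ conjunct1[OF *] B])
  next
    case True
    then obtain A where A: "a + j * c = int p * A" by blast
    have pc: "\<not> int p dvd c"
    proof
      assume h: "int p dvd c"
      hence "int p dvd a" using True by (metis dvd_add_left_iff dvd_mult)
      hence "int p dvd a * d - b * c" using h by simp
      thus False using * pi by (metis not_prime_unit)
    qed
    have det: "A * (int p * d) - (b + j * d) * c = 1"
    proof -
      have "A * (int p * d) - (b + j * d) * c = (int p * A) * d - (b + j * d) * c" by simp
      also have "\<dots> = 1" unfolding A [symmetric] using * by (simp add: algebra_simps)
      finally show ?thesis .
    qed
    have "\<not> int (p * N) dvd c" using pc by (metis dvd_mult_left of_nat_mult)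
    hence "cusp_bdd (\<lambda>z. f (mob A (b + j * d) c (int p * d) z))" by (intro bdd det)
    from cusp_bdd_affine[OF this, of "real p" 0] p0
    have "cusp_bdd (\<lambda>z. f (mob A (b + j * d) c (int p * d) (of_nat p * z)))" by simp
    moreover have "f (mob A (b + j * d) c (int p * d) (of_nat p * z)) = f ((mob a b c d z + of_int j) / of_nat p)" if z: "z \<in> \<H>" for z
    proof (rule arg_cong[where f = f])
      have nz: "of_int c * z + of_int d \<noteq> 0" using mob_denom_nonzero[OF z] * by blast
      have "of_int A * (of_nat p * z) = (of_int (int p * A) * z :: complex)" by simp
      also have "\<dots> = (of_int a + of_int j * of_int c) * z" unfolding A [symmetric] by simp
      finally have "mob A (b + j * d) c (int p * d) (of_nat p * z) =
         ((of_int a * z + of_int b) + of_int j * (of_int c * z + of_int d)) / (of_nat p * (of_int c * z + of_int d))"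
        by (simp add: mob_def algebra_simps)
      also have "\<dots> = (mob a b c d z + of_int j) / of_nat p"
        using nz p0 by (simp add: mob_def field_simps)
      finally show "mob A (b + j * d) c (int p * d) (of_nat p * z) = (mob a b c d z + of_int j) / of_nat p" .
    qed
    ultimately show ?thesis by (rule cusp_bdd_cong[rotated])
  qed
  from this[of "int _"] have bj: "cusp_bdd (\<lambda>z. f ((mob a b c d z + of_nat j) / of_nat p))" for j
    by simp
  have "cusp_bdd (\<lambda>z. \<Sum>j\<in>J. f ((mob a b c d z + of_nat j) / of_nat p))" for J
    by (induction J rule: infinite_finite_induct) (auto intro: cusp_bdd_const cusp_bdd_add bj)
  from cusp_bdd_mult[OF this[of "{..<p}"] cusp_bdd_const[of "1 / of_nat p"]]
  show "cusp_bdd (\<lambda>z. hecke_U p f (mob a b c d z))"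
    by (simp add: hecke_U_def)
qed

text \<open>If p divides c, then z -> p z conjugates the matrix to one with lower left entry c / p.
  Otherwise (p 0; 0 1) g = g' (1 j'; 0 p), where c j' is congruent to d modulo p and the lower left
  entry c is not divisible by N.\<close>

lemma mod_fun_V:
  assumes g: "mod_fun N g" and p: "prime p" "p dvd N"
  shows "mod_fun (p * N) (\<lambda>z. g (of_nat p * z))"
  unfolding mod_fun_iff
proof (intro conjI allI impI)
  have p0: "p > 0" using p prime_gt_0_nat by blast
  have pi: "prime (int p)" using p by simp
  have hol: "g holomorphic_on \<H>" using g by (simp add: mod_fun_def)
  have "(g \<circ> (\<lambda>z. of_nat p * z)) holomorphic_on \<H>"
    by (rule holomorphic_on_compose_gen[OF _ hol]) (use p0 in \<open>auto intro!: holomorphic_intros of_nat_in_H\<close>)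
  thus "(\<lambda>z. g (of_nat p * z)) holomorphic_on \<H>" by (simp add: o_def)
  have 1: "of_nat p * mob a b c d z = mob a (int p * b) c' d (of_nat p * z)"
    "a * d - int p * b * c' = 1" if "a * d - b * c = 1" "c = int p * c'" for a b c d c' z
    using that p0 by (simp_all add: mob_def field_simps)
  show "Gamma0_inv (p * N) (\<lambda>z. g (of_nat p * z))"
    unfolding Gamma0_inv_def
  proof (intro allI impI ballI)
    fix a b c d :: int and z assume *: "a * d - b * c = 1 \<and> int (p * N) dvd c" and z: "z \<in> \<H>"
    then obtain k where "c = int (p * N) * k" by (auto elim: dvdE simp only:)
    hence k: "c = int p * (int N * k)" by simp
    show "g (of_nat p * mob a b c d z) = g (of_nat p * z)"
      unfolding 1(1)[OF conjunct1[OF *] k] using g 1(2)[OF conjunct1[OF *] k] of_nat_in_H(1)[OF z p0]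
      by (intro Gamma0_invD[of N]) (auto simp: mod_fun_iff)
  qed
  fix a b c d :: int assume *: "a * d - b * c = 1 \<and> \<not> int (p * N) dvd c"
  have bdd: "cusp_bdd (\<lambda>z. g (mob a b c d z))" if "a * d - b * c = 1" "\<not> int N dvd c" for a b c d
    using g that by (auto simp: mod_fun_def)
  show "cusp_bdd (\<lambda>z. g (of_nat p * mob a b c d z))"
  proof (cases "int p dvd c")
    case True
    then obtain c' where c': "c = int p * c'" by blast
    have "\<not> int N dvd c'" using * c' by auto
    hence "cusp_bdd (\<lambda>z. g (mob a (int p * b) c' d z))" using 1(2)[OF conjunct1[OF *] c'] by (intro bdd)
    from cusp_bdd_affine[OF this, of "real p" 0] p0 show ?thesis
      unfolding 1(1)[OF conjunct1[OF *] c'] by simp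
  next
    case False
    obtain j' where "int p dvd d - c * int j'" using solve_lin_mod_prime[OF p(1) False] by blast
    then obtain D where D: "int p * D = d - c * int j'" by (metis dvdE)
    have Dc: "of_nat p * of_int D = (of_int d - of_int c * of_nat j' :: complex)"
      using arg_cong[OF D, of "of_int :: int \<Rightarrow> complex"] by simp
    have det: "int p * a * D - (b - a * int j') * c = 1"
    proof -
      have "int p * a * D - (b - a * int j') * c = a * (int p * D) - (b - a * int j') * c" by simp
      also have "\<dots> = 1" unfolding D using * by (simp add: algebra_simps)
      finally show ?thesis .
    qed
    have "\<not> int N dvd c" using False p by (meson dvd_trans int_dvd_int_iff)
    hence "cusp_bdd (\<lambda>z. g (mob (int p * a) (b - a * int j') c D z))" by (intro bdd det)
    from cusp_bdd_affine[OF this, of "1 / real p" "real j' / real p"] p0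
    have "cusp_bdd (\<lambda>z. g (mob (int p * a) (b - a * int j') c D ((z + of_nat j') / of_nat p)))"
      by (simp add: add_divide_distrib)
    moreover have "g (mob (int p * a) (b - a * int j') c D ((z + of_nat j') / of_nat p)) = g (of_nat p * mob a b c d z)" if z: "z \<in> \<H>" for z
    proof (rule arg_cong[where f = g])
      have nz: "of_int c * z + of_int d \<noteq> 0" using mob_denom_nonzero[OF z] * by blast
      have p: "of_nat p \<noteq> (0 :: complex)" using p0 by simp
      have "of_int c * ((z + of_nat j') / of_nat p) + of_int D = (of_int c * (z + of_nat j') + of_nat p * of_int D) / of_nat p"
        using p by (simp add: field_simps)
      also have "\<dots> = (of_int c * z + of_int d) / of_nat p" unfolding Dc by (simp add: algebra_simps)
      finally have den: "of_int c * ((z + of_nat j') / of_nat p) + of_int D = (of_int c * z + of_int d) / of_nat p" .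
      have num: "of_int (int p * a) * ((z + of_nat j') / of_nat p) + of_int (b - a * int j') = of_int a * z + of_int b"
        using p by (simp add: field_simps)
      show "mob (int p * a) (b - a * int j') c D ((z + of_nat j') / of_nat p) = of_nat p * mob a b c d z"
        unfolding mob_def[of "int p * a"] den num using nz p by (simp add: mob_def field_simps)
    qed
    ultimately show ?thesis by (rule cusp_bdd_cong[rotated])
  qed
qed

section \<open>Canonical basis elements under U\<close>

definition canonical :: "nat \<Rightarrow> nat \<Rightarrow> (complex \<Rightarrow> complex) \<Rightarrow> complex fls \<Rightarrow> bool" where
  "canonical N m f F \<longleftrightarrow> mod_fun N f \<and> qexp f F \<and> (\<forall>n\<le>0. fls_nth F n = (if n = - int m then 1 else 0))"

lemma canonical_basis_element_imp_canonical:
  "canonical_basis_element N m f F \<Longrightarrow> canonical N m f F"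
  unfolding canonical_basis_element_def canonical_def
  using M0_sharp_imp_mod_fun[of f N] has_q_expansion_imp_qexp[of f F] by (simp add: mod_fun_def)

lemma canonical_level_descent:
  assumes f: "canonical (p * N) m f F" and p: "prime p" "p dvd N" and N: "N > 0"
  shows "p dvd m \<Longrightarrow> canonical N (m div p) (hecke_U p f) (fls_U p F)"
    and "\<not> p dvd m \<Longrightarrow> int p dvd n \<Longrightarrow> fls_nth F n = 0"
    and "p dvd m \<Longrightarrow> \<not> int p dvd n \<Longrightarrow> fls_nth F n = 0"
proof -
  have p0: "p > 0" using p prime_gt_0_nat by blast
  have mf: "mod_fun (p * N) f" "qexp f F" and F: "\<And>n. n \<le> 0 \<Longrightarrow> fls_nth F n = (if n = - int m then 1 else 0)"
    using f by (auto simp: canonical_def)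
  have U: "mod_fun N (hecke_U p f)" "qexp (hecke_U p f) (fls_U p F)"
    using mod_fun_U[OF mf(1) p] qexp_U[OF mf(2) p0] by auto
  have FU: "fls_nth (fls_U p F) n = (if int p * n = - int m then 1 else 0)" if "n \<le> 0" for n
    using F[of "int p * n"] that p0 by (simp add: fls_nth_U mult_le_0_iff)
  have F': "fls_nth F n = fls_nth (fls_U p F) (n div int p)" if "int p dvd n" for n
    using that p0 by (simp add: fls_nth_U)
  {
    assume "\<not> p dvd m"
    hence "int p * n \<noteq> - int m" for n by (metis dvd_triv_left dvd_minus_iff int_dvd_int_iff)
    hence "fls_U p F = 0" using mod_fun_qexp_eq_0[OF U(1) N U(2)] FU by simp
    thus "fls_nth F n = 0" if "int p dvd n" using F'[OF that] by simp
  next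
    assume pm: "p dvd m"
    hence eq: "int p * n = - int m \<longleftrightarrow> n = - int (m div p)" for n
      using p0 by (auto elim!: dvdE) (metis mult_cancel_left mult_minus_right of_nat_eq_0_iff less_irrefl of_nat_0)
    show can: "canonical N (m div p) (hecke_U p f) (fls_U p F)"
      using U FU by (simp add: canonical_def eq)
    \<comment> \<open>V after U keeps the coefficients whose index is divisible by p. Among the
      indices \<le> 0 only - m carries a nonzero coefficient, and p divides m, so both sides agree
      there.\<close>
    have "F = fls_compose_power (fls_U p F) p"
    proof (rule mod_fun_qexp_unique[OF mf(1) mod_fun_V[OF U(1) p] _ mf(2) qexp_V[OF U(2) p0]])
      fix n :: int assume "n \<le> 0"
      thus "fls_nth F n = fls_nth (fls_compose_power (fls_U p F) p) n"
        using p0 F[of n] F' pm by (auto simp: fls_nth_compose_power)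
    qed (use N p0 in simp)
    hence "fls_nth F n = fls_nth (fls_compose_power (fls_U p F) p) n" by simp
    thus "fls_nth F n = 0" if "\<not> int p dvd n" using that p0 by (simp add: fls_nth_compose_power)
  }
qed

subsection \<open>The Hauptmodul of prime level\<close>

text \<open>Right multiplication by a known symmetry changes the bottom row, so invariance is
  inherited from a matrix with smaller lower left entry.\<close>

lemma Gamma0_inv_step:
  assumes g: "x * w - y * r = 1" "\<And>z. z \<in> \<H> \<Longrightarrow> f (mob x y r w z) = f z"
    and det: "a * d - b * c = 1"
    and A: "\<And>z. z \<in> \<H> \<Longrightarrow> f (mob (a * x + b * r) (a * y + b * w) (c * x + d * r) (c * y + d * w) z) = f z"
    and z: "z \<in> \<H>"
  shows "f (mob a b c d z) = f z"
proof -
  define u where "u = mob w (- y) (- r) x z"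
  have e: "w * x - - y * - r = 1" using g(1) by (simp add: algebra_simps)
  have u: "u \<in> \<H>" unfolding u_def by (rule mob_in_H[OF z e])
  have zu: "z = mob x y r w u" unfolding u_def using mob_inverse[OF z e] by simp
  have "f (mob a b c d (mob x y r w u)) = f u"
    unfolding mob_mob[OF u g(1)] by (rule A[OF u])
  also have "f u = f (mob x y r w u)" using g(2)[OF u] by simp
  finally show ?thesis unfolding zu [symmetric] .
qed

text \<open>
  A Euclidean descent on the lower left entry. For \<open>p = 5\<close> the parabolic generators do not always
  decrease it; the two elliptic elements of order 2 cover the remaining range.
\<close>
lemma Gamma0_invI_generators:
  assumes p: "p \<in> {2, 3, 5}"
    and T: "\<And>z. z \<in> \<H> \<Longrightarrow> f (z + 1) = f z"
    and V: "\<And>z. z \<in> \<H> \<Longrightarrow> f (mob 1 0 (int p) 1 z) = f z"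
    and E: "\<And>z s. p = 5 \<Longrightarrow> s \<in> {2, -2} \<Longrightarrow> z \<in> \<H> \<Longrightarrow> f (mob s (- 1) 5 (- s) z) = f z"
  shows "Gamma0_inv p f"
proof -
  have Tk: "f (z + of_int k) = f z" if "z \<in> \<H>" for z k
    using periodic_on_H[of f 1 z k] T that by simp
  have V': "f (mob 1 0 (t * int p) 1 z) = f z" if "t \<in> {1, -1}" "z \<in> \<H>" for t z
  proof (cases "t = 1")
    case False
    have "f (mob 1 0 (- int p) 1 z) = f z"
      by (rule Gamma0_inv_step[of 1 1 0 "int p" f 1 1 0 "- int p"]) (use V that in auto)
    thus ?thesis using False that by auto
  qed (use V that in auto)
  have main: "\<forall>z\<in>\<H>. f (mob a b c d z) = f z" if "nat \<bar>c\<bar> < n" "a * d - b * c = 1" "int p dvd c" for n a b c d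
    using that
  proof (induction n arbitrary: a b c d)
    case (Suc n)
    show ?case
    proof (cases "c = 0")
      case True
      hence "a * d = 1" using Suc.prems by simp
      hence "a = 1 \<and> d = 1 \<or> a = - 1 \<and> d = - 1" using zmult_eq_1_iff by auto
      thus ?thesis
      proof
        assume "a = 1 \<and> d = 1"
        thus ?thesis using True Tk[of _ b] by (auto simp: mob_def)
      next
        assume "a = - 1 \<and> d = - 1"
        thus ?thesis using True Tk[of _ "- b"] by (auto simp: mob_def)
      qed
    next
      case False
      have red: "\<forall>z\<in>\<H>. f (mob a b c d z) = f z" if d: "2 * \<bar>d\<bar> \<le> \<bar>c\<bar>" "a * d - b * c = 1" for b d
      proof -
        have "d \<noteq> 0"
        proof
          assume "d = 0"
          hence "b * c = - 1" using d by simp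
          hence "int p dvd 1" using Suc.prems(3) by (metis dvd_minus_iff dvd_mult)
          thus False using p by auto
        qed
        obtain x y r w where g: "x * w - y * r = 1" "\<And>z. z \<in> \<H> \<Longrightarrow> f (mob x y r w z) = f z"
          "int p dvd r" "\<bar>c * x + d * r\<bar> < \<bar>c\<bar>"
        \<comment> \<open>For 0 < p |d| < 2 |c|, adding or subtracting p d shortens c.\<close>
        proof (cases "int p * \<bar>d\<bar> < 2 * \<bar>c\<bar>")
          case True
          define t :: int where "t = - sgn c * sgn d"
          have t: "t \<in> {1, - 1}" using False \<open>d \<noteq> 0\<close> by (auto simp: t_def sgn_if)
          have "c + d * (t * int p) = sgn c * (\<bar>c\<bar> - int p * \<bar>d\<bar>)"
            using False \<open>d \<noteq> 0\<close> by (auto simp: t_def sgn_if algebra_simps)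
          hence "\<bar>c + d * (t * int p)\<bar> = \<bar>\<bar>c\<bar> - int p * \<bar>d\<bar>\<bar>"
            using False by (simp add: abs_mult)
          moreover have "0 < int p * \<bar>d\<bar>" using \<open>d \<noteq> 0\<close> p by auto
          ultimately have "\<bar>c * 1 + d * (t * int p)\<bar> < \<bar>c\<bar>" using True by linarith
          thus ?thesis using V'[OF t] by (intro that[of 1 1 0 "t * int p"]) auto
        next
          case big: False
          \<comment> \<open>For p \<le> 3 one has p |d| \<le> 3 |c| / 2, so this case is void. For p
            = 5 it means 2 |c| \<le> 5 |d| \<le> 5 |c| / 2, so 5 |d| - 2 |c| is at most |c| /
            2.\<close>
          have p5: "p = 5" using p big d(1) False by auto
          define s :: int where "s = - 2 * sgn c * sgn d"
          have s: "s \<in> {2, - 2}" using False \<open>d \<noteq> 0\<close> by (auto simp: s_def sgn_if)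
          have "c * s + d * 5 = sgn d * (5 * \<bar>d\<bar> - 2 * \<bar>c\<bar>)"
            using False \<open>d \<noteq> 0\<close> by (auto simp: s_def sgn_if algebra_simps)
          hence "\<bar>c * s + d * 5\<bar> = \<bar>5 * \<bar>d\<bar> - 2 * \<bar>c\<bar>\<bar>"
            using \<open>d \<noteq> 0\<close> by (simp add: abs_mult)
          hence "\<bar>c * s + d * 5\<bar> < \<bar>c\<bar>" using big d(1) False p5 by simp
          thus ?thesis using E[OF p5 s] s p5 by (intro that[of s "- s" "- 1" 5]) auto
        qed
        have "\<forall>z\<in>\<H>. f (mob (a * x + b * r) (a * y + b * w) (c * x + d * r) (c * y + d * w) z) = f z"
        proof (rule Suc.IH)
          show "nat \<bar>c * x + d * r\<bar> < n" using g(4) Suc.prems(1) by simp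
          show "(a * x + b * r) * (c * y + d * w) - (a * y + b * w) * (c * x + d * r) = 1"
            by (rule det_mult[OF d(2) g(1)])
          show "int p dvd c * x + d * r" using g(3) Suc.prems(3) by simp
        qed
        thus ?thesis using Gamma0_inv_step[of x w y r f, OF g(1,2) d(2)] by blast
      qed
      \<comment> \<open>The integer nearest to - d / c; the translation by k brings d into the range
        |d| \<le> |c| / 2.\<close>
      define k where "k = - ((2 * d + \<bar>c\<bar>) div (2 * \<bar>c\<bar>)) * sgn c"
      have "k * c = - ((2 * d + \<bar>c\<bar>) div (2 * \<bar>c\<bar>)) * \<bar>c\<bar>"
        using False by (simp add: k_def sgn_if)
      hence "2 * (d + k * c) = 2 * d - (2 * d + \<bar>c\<bar>) div (2 * \<bar>c\<bar>) * (2 * \<bar>c\<bar>)" by (simp add: algebra_simps)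
      also have "\<dots> = (2 * d + \<bar>c\<bar>) mod (2 * \<bar>c\<bar>) - \<bar>c\<bar>"
        by (simp add: minus_div_mult_eq_mod [symmetric])
      finally have "2 * (d + k * c) = (2 * d + \<bar>c\<bar>) mod (2 * \<bar>c\<bar>) - \<bar>c\<bar>" .
      moreover have "0 \<le> (2 * d + \<bar>c\<bar>) mod (2 * \<bar>c\<bar>)" "(2 * d + \<bar>c\<bar>) mod (2 * \<bar>c\<bar>) < 2 * \<bar>c\<bar>"
        using False by simp_all
      ultimately have "2 * \<bar>d + k * c\<bar> \<le> \<bar>c\<bar>" by linarith
      moreover have "a * (d + k * c) - (b + k * a) * c = 1" using Suc.prems(2) by (simp add: algebra_simps)
      ultimately have *: "\<forall>z\<in>\<H>. f (mob a (b + k * a) c (d + k * c) z) = f z" by (rule red)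
      show ?thesis
      proof
        fix z assume z: "z \<in> \<H>"
        have "mob a b c d z = mob a (b + k * a) c (d + k * c) (z + of_int (- k))"
          by (simp add: mob_def algebra_simps)
        moreover have "z + of_int (- k) \<in> \<H>" using z by (simp add: in_H_iff)
        ultimately show "f (mob a b c d z) = f z" using * Tk[OF z, of "- k"] by auto
      qed
    qed
  qed simp
  show ?thesis unfolding Gamma0_inv_def
  proof (intro allI impI)
    fix a b c d :: int assume "a * d - b * c = 1 \<and> int p dvd c"
    thus "\<forall>z\<in>\<H>. f (mob a b c d z) = f z" using main[of c "Suc (nat \<bar>c\<bar>)" a d b] by simp
  qed
qed

section \<open>The Fricke involution and the two cusps of prime level\<close>

lemma fricke_in_H: "z \<in> \<H> \<Longrightarrow> p > 0 \<Longrightarrow> - 1 / (of_nat p * z) \<in> \<H>"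
  "z \<in> \<H> \<Longrightarrow> - 1 / z \<in> \<H>"
proof -
  have *: "- 1 / z \<in> \<H>" if "z \<in> \<H>" for z
    using mob_in_H[OF that, of 0 0 "-1" 1] by (simp add: mob_def)
  thus "z \<in> \<H> \<Longrightarrow> - 1 / z \<in> \<H>" .
  show "z \<in> \<H> \<Longrightarrow> p > 0 \<Longrightarrow> - 1 / (of_nat p * z) \<in> \<H>"
    using *[of "of_nat p * z"] of_nat_in_H(1) by blast
qed

text \<open>Besides infinity there is only the cusp 0: a matrix with c prime to p lies in Gamma_0(p)
  S T^j, where j solves c j = d modulo p. Boundedness at 0 is tested through the Fricke
  involution.\<close>

lemma mod_funI_prime_level:
  assumes p: "prime p" and hol: "f holomorphic_on \<H>" and inv: "Gamma0_inv p f"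
    and bdd: "cusp_bdd (\<lambda>z. f (- 1 / (of_nat p * z)))"
  shows "mod_fun p f"
  unfolding mod_fun_iff
proof (intro conjI allI impI hol inv)
  fix a b c d :: int assume *: "a * d - b * c = 1 \<and> \<not> int p dvd c"
  have p0: "p > 0" using p prime_gt_0_nat by blast
  obtain j where j: "int p dvd d - c * int j" using solve_lin_mod_prime[OF p, of c d] * by blast
  from cusp_bdd_affine[OF bdd, of "1 / real p" "real j / real p"] p0
  have "cusp_bdd (\<lambda>z. f (- 1 / (z + of_nat j)))"
    by (simp add: add_divide_distrib [symmetric])
  moreover have "f (- 1 / (z + of_nat j)) = f (mob a b c d z)" if z: "z \<in> \<H>" for z
  proof -
    define w where "w = z + of_nat j"
    have w: "w \<in> \<H>" using z by (simp add: w_def in_H_iff)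
    have w0: "w \<noteq> 0" using w by (auto simp: in_H_iff)
    have "mob (a * int j - b) a (c * int j - d) c (- 1 / w) = mob (a * int j - b) a (c * int j - d) c (mob 0 (- 1) 1 0 w)"
      by (simp add: mob_def)
    also have "\<dots> = mob ((a * int j - b) * 0 + a * 1) ((a * int j - b) * - 1 + a * 0) ((c * int j - d) * 0 + c * 1) ((c * int j - d) * - 1 + c * 0) w"
      by (rule mob_mob[OF w]) simp
    also have "\<dots> = mob a b c d z"
      by (simp add: mob_def w_def algebra_simps)
    finally have "mob a b c d z = mob (a * int j - b) a (c * int j - d) c (- 1 / w)" ..
    moreover have "f (mob (a * int j - b) a (c * int j - d) c (- 1 / w)) = f (- 1 / w)"
    proof (rule Gamma0_invD[OF inv])
      show "(a * int j - b) * c - a * (c * int j - d) = 1" using * by (simp add: algebra_simps)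
      show "int p dvd c * int j - d" using j by (simp add: dvd_diff_commute)
    qed (rule fricke_in_H[OF w])
    ultimately show ?thesis by (simp add: w_def)
  qed
  ultimately show "cusp_bdd (\<lambda>z. f (mob a b c d z))" by (rule cusp_bdd_cong[rotated])
qed

section \<open>Eta quotients of level 2, 3 and 5\<close>

lemma holomorphic_eta6: "eta6 holomorphic_on \<H>"
proof -
  have "(\<lambda>z. euler_phi (qe z)) holomorphic_on \<H>"
    unfolding euler_phi_def using open_H norm_qe_less_1
    by (intro holomorphic_qpoch holomorphic_intros) (auto simp: in_H_iff)
  thus ?thesis unfolding eta6_def by (intro holomorphic_intros) auto
qed

lemma eta6_add_2: "eta6 (z + 2) = - eta6 z"
  using eta6_add_1[of z] eta6_add_1[of "z + 1"] by (simp add: add.assoc)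

text \<open>Here e (p - 1) = 4, so that 6 e = 24/(p-1), and p^(c+1) is the power of p in the linear
  coefficient of the polynomial A given by \<open>Acoeff\<close>. The scaling exponent a is the
  largest for which p^(c+1) divides all coefficients of A(v)/v as a polynomial in t, where v =
  p^(3e-a) t.\<close>

locale genus_zero_level =
  fixes p e a c :: nat
  assumes params: "(p, e, a, c) \<in> {(2, 4, 8, 3), (3, 2, 4, 2), (5, 1, 2, 1)}"
begin

lemma prime_p: "prime p" and p_pos [simp]: "p > 0" and p_in: "p \<in> {2, 3, 5}"
  using params by auto

lemma p_nz [simp]: "of_nat p \<noteq> (0 :: complex)" "p \<noteq> 0"
  using params by auto

definition \<psi> :: "complex \<Rightarrow> complex" where
  "\<psi> z = (eta6 z / eta6 (of_nat p * z)) ^ e"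

definition \<kappa> :: complex where "\<kappa> = of_nat p ^ (3 * e)"

lemma \<kappa>_nz [simp]: "\<kappa> \<noteq> 0" by (simp add: \<kappa>_def)

lemma psi_nonzero: "z \<in> \<H> \<Longrightarrow> \<psi> z \<noteq> 0"
  using eta6_nonzero[of z] eta6_nonzero[of "of_nat p * z"] p_pos by (simp add: \<psi>_def in_H_iff)

lemma holomorphic_psi: "\<psi> holomorphic_on \<H>"
proof -
  have "(eta6 \<circ> (\<lambda>z. of_nat p * z)) holomorphic_on \<H>"
    by (rule holomorphic_on_compose_gen[OF _ holomorphic_eta6])
       (use p_pos in \<open>auto intro!: holomorphic_intros of_nat_in_H\<close>)
  thus ?thesis unfolding \<psi>_def o_def
    using eta6_nonzero of_nat_in_H(1)[OF _ p_pos]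
    by (intro holomorphic_intros holomorphic_eta6) (auto simp: in_H_iff)
qed

text \<open>The translation contributes i at z and i^p at p z; the quotient i^(1-p) disappears in
  the e-th power because e (p - 1) = 4.\<close>

lemma psi_add_1: "\<psi> (z + 1) = \<psi> z"
proof -
  have "eta6 (of_nat p * (z + 1)) = \<i> ^ p * eta6 (of_nat p * z)"
  proof -
    have "eta6 (w + of_nat n) = \<i> ^ n * eta6 w" for n w
      by (induction n arbitrary: w) (simp_all add: add.assoc [symmetric] add.commute[of 1] eta6_add_1 mult_ac)
    thus ?thesis by (simp add: ring_distribs)
  qed
  thus ?thesis using params
    by (auto simp: \<psi>_def eta6_add_1 power_divide power_mult_distrib numeral_eq_Suc)
qed

text \<open>The automorphy factors i (p z)^3 and i z^3 of numerator and denominator leave p^3, whose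
  e-th power is \<open>\<kappa>\<close>.\<close>

lemma psi_fricke:
  assumes z: "z \<in> \<H>"
  shows "\<psi> (- 1 / (of_nat p * z)) = \<kappa> / \<psi> z"
proof -
  have z': "of_nat p * z \<in> \<H>" "z \<noteq> 0" using of_nat_in_H(1)[OF z p_pos] z by (auto simp: in_H_iff)
  have 1: "eta6 (- 1 / (of_nat p * z)) = \<i> * (of_nat p * z) ^ 3 * eta6 (of_nat p * z)"
    using z' by (intro eta6_inversion) (simp add: in_H_iff)
  have "of_nat p * (- 1 / (of_nat p * z)) = - 1 / z" by simp
  hence 2: "eta6 (of_nat p * (- 1 / (of_nat p * z))) = \<i> * z ^ 3 * eta6 z"
    using z eta6_inversion[of z] by (simp add: in_H_iff)
  have "\<psi> (- 1 / (of_nat p * z)) = (of_nat p ^ 3 * eta6 (of_nat p * z) / eta6 z) ^ e"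
    unfolding \<psi>_def 1 2 using z' by (simp add: power_mult_distrib)
  also have "\<dots> = \<kappa> / \<psi> z"
    by (simp add: \<psi>_def \<kappa>_def power_divide power_mult_distrib power_mult)
  finally show ?thesis .
qed

text \<open>This generator is the translation by -1 conjugated with the Fricke involution, and
  \<psi> -> \<kappa> / \<psi> is applied twice.\<close>

lemma psi_V:
  assumes z: "z \<in> \<H>"
  shows "\<psi> (mob 1 0 (int p) 1 z) = \<psi> z"
proof -
  define w where "w = - 1 / (of_nat p * z)"
  have w: "w \<in> \<H>" "w - 1 \<in> \<H>" using fricke_in_H(1)[OF z p_pos] by (simp_all add: w_def in_H_iff)
  have z0: "z \<noteq> 0" using z by (auto simp: in_H_iff)
  have nz: "of_nat p * z + 1 \<noteq> 0" using mob_denom_nonzero[OF z, of 1 1 0 "int p"] by simp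
  have "of_nat p * (w - 1) = - ((of_nat p * z + 1) / z)"
    using z0 by (simp add: w_def field_simps)
  hence "- 1 / (of_nat p * (w - 1)) = mob 1 0 (int p) 1 z"
    by (simp only: minus_divide_divide mob_def) simp
  hence "\<psi> (mob 1 0 (int p) 1 z) = \<kappa> / \<psi> (w - 1)" using psi_fricke[OF w(2)] by simp
  also have "\<psi> (w - 1) = \<psi> w" using psi_add_1[of "w - 1"] by simp
  also have "\<kappa> / \<psi> w = \<psi> z" using psi_fricke[OF z] by (simp add: w_def)
  finally show ?thesis .
qed

text \<open>As s^2 = 4, the determinant is 1 and the trace 0. The element acts on z as S T^(-s) S
  T^s S and on 5 z as T^s S T^(-s). Each T^(\<plusminus>2) multiplies \<open>eta6\<close> by -1 and
  each S by i w^3; both words give i d^3 with d = 5 z - s, which cancels in the quotient.\<close>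

lemma psi_elliptic:
  assumes p5: "p = 5" and s: "s \<in> {2, - 2 :: int}" and z: "z \<in> \<H>"
  shows "\<psi> (mob s (- 1) 5 (- s) z) = \<psi> z"
proof -
  define t :: complex where "t = of_int s"
  have tt: "t * t = 4" using s by (auto simp: t_def)
  have e1: "e = 1" using params p5 by auto
  have shift: "eta6 (w + t) = - eta6 w" "eta6 (w - t) = - eta6 w" for w
    using s eta6_add_2[of w] eta6_add_2[of "w - 2"] by (auto simp: t_def)
  define d where "d = 5 * z - t"
  define v where "v = t - 1 / z"
  define u where "u = - t - 1 / v"
  have z0: "z \<noteq> 0" using z by (auto simp: in_H_iff)
  have H0: "w \<noteq> 0" if "w \<in> \<H>" for w using that by (auto simp: in_H_iff)
  have "d \<in> \<H>" using z by (auto simp: d_def t_def in_H_iff)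
  hence dH: "d \<in> \<H>" "d \<noteq> 0" using H0 by auto
  have "v \<in> \<H>" using fricke_in_H(2)[OF z] by (auto simp: v_def t_def in_H_iff)
  hence vH: "v \<in> \<H>" "v \<noteq> 0" using H0 by auto
  have "u \<in> \<H>" using fricke_in_H(2)[OF vH(1)] by (auto simp: u_def t_def in_H_iff)
  hence uH: "u \<in> \<H>" "u \<noteq> 0" using H0 by auto
  have uv: "u * v = - t * v - 1" using vH by (simp add: u_def field_simps)
  have vz: "v * z = t * z - 1" using z0 by (simp add: v_def field_simps)
  have "u * v * z = - t * (v * z) - z" unfolding uv by (simp add: algebra_simps)
  also have "\<dots> = t - (t * t) * z - z" unfolding vz by (simp add: algebra_simps)
  also have "\<dots> = - d" unfolding tt by (simp add: d_def)
  finally have uvz: "u * v * z = - d" .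
  have m: "mob s (- 1) 5 (- s) z = (t * z - 1) / d" by (simp add: mob_def t_def d_def)
  have m1: "mob s (- 1) 5 (- s) z = - 1 / u"
  proof -
    have "(t * z - 1) * u = - d" using uvz unfolding vz [symmetric] by (simp add: mult_ac)
    thus ?thesis unfolding m using uH dH by (simp add: field_simps)
  qed
  have m5: "5 * mob s (- 1) 5 (- s) z = - 1 / d + t"
    unfolding m using dH(2) tt by (simp add: field_simps) (simp add: d_def algebra_simps tt)
  have inv: "eta6 (- 1 / w) = \<i> * w ^ 3 * eta6 w" if "w \<in> \<H>" for w
    using that by (intro eta6_inversion) (simp add: in_H_iff)
  have "eta6 (5 * mob s (- 1) 5 (- s) z) = \<i> * d ^ 3 * eta6 (5 * z)"
    unfolding m5 shift inv[OF dH(1)] by (simp add: d_def shift)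
  moreover have "eta6 (mob s (- 1) 5 (- s) z) = \<i> * d ^ 3 * eta6 z"
  proof -
    have "u = - 1 / v - t" by (simp add: u_def)
    hence "eta6 u = - eta6 (- 1 / v)" using shift(2)[of "- 1 / v"] by (simp only:)
    moreover have "eta6 v = - eta6 (- 1 / z)" using shift(1)[of "- 1 / z"] by (simp add: v_def)
    ultimately have "eta6 (- 1 / u) = - \<i> * (u * v * z) ^ 3 * eta6 z"
      unfolding inv[OF uH(1)] using inv[OF vH(1)] inv[OF z] by (simp add: power_mult_distrib mult_ac)
    thus ?thesis unfolding m1 uvz by simp
  qed
  ultimately show ?thesis unfolding \<psi>_def using dH p5 e1 by simp
qed

lemma Gamma0_inv_psi: "Gamma0_inv p \<psi>"
  by (rule Gamma0_invI_generators[OF p_in]) (use psi_add_1 psi_V psi_elliptic in auto)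

end

subsection \<open>Integrality of the Hauptmodul\<close>

definition int_fls :: "complex fls \<Rightarrow> bool" where
  "int_fls F \<longleftrightarrow> (\<forall>n. fls_nth F n \<in> \<int>)"

lemma int_fls_nth: "int_fls F \<Longrightarrow> fls_nth F n \<in> \<int>"
  by (simp add: int_fls_def)

lemma int_fls_const: "c \<in> \<int> \<Longrightarrow> int_fls (fls_const c)"
  by (simp add: int_fls_def)

lemma int_fls_add: "int_fls F \<Longrightarrow> int_fls G \<Longrightarrow> int_fls (F + G)"
  by (simp add: int_fls_def)

lemma int_fls_diff: "int_fls F \<Longrightarrow> int_fls G \<Longrightarrow> int_fls (F - G)"
  by (simp add: int_fls_def)

lemma int_fls_mult: "int_fls F \<Longrightarrow> int_fls G \<Longrightarrow> int_fls (F * G)"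
  by (auto simp: int_fls_def fls_times_nth(1) intro!: Ints_sum Ints_mult)

lemma int_fls_power: "int_fls F \<Longrightarrow> int_fls (F ^ n)"
  by (induction n) (auto simp: int_fls_const[of 1, simplified] intro: int_fls_mult)

lemma int_fls_sum: "(\<And>i. i \<in> A \<Longrightarrow> int_fls (F i)) \<Longrightarrow> int_fls (\<Sum>i\<in>A. F i)"
  by (induction A rule: infinite_finite_induct) (auto simp: int_fls_const[of 0, simplified] intro: int_fls_add)

lemma int_fls_fps_inverse:
  fixes h :: "complex fps"
  assumes "int_fls (fps_to_fls h)" "fps_nth h 0 = 1"
  shows "int_fls (fps_to_fls (inverse h))"
proof -
  have h: "fps_nth h n \<in> \<int>" for n using int_fls_nth[OF assms(1), of "int n"] by simp
  have "fps_nth (inverse h) n \<in> \<int>" for n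
  proof (induction n rule: less_induct)
    case (less n)
    show ?case
    proof (cases "n = 0")
      case False
      have "inverse h * h = 1" using assms(2) by (intro inverse_mult_eq_1) auto
      hence "(\<Sum>i=0..n. fps_nth h i * fps_nth (inverse h) (n - i)) = 0"
        using False fps_mult_nth[of h "inverse h" n] by (simp add: mult.commute)
      hence "fps_nth (inverse h) n = - (\<Sum>i=1..n. fps_nth h i * fps_nth (inverse h) (n - i))"
        using assms(2) by (subst (asm) sum.atLeast_Suc_atMost) (auto simp: add_eq_0_iff)
      also have "\<dots> \<in> \<int>" by (intro Ints_minus Ints_sum Ints_mult h less.IH) auto
      finally show ?thesis .
    qed (simp add: fps_inverse_def assms(2))
  qed
  thus ?thesis by (simp add: int_fls_def)
qed

lemma fls_inverse_fps_to_fls':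
  fixes h :: "complex fps"
  assumes "fps_nth h 0 \<noteq> 0"
  shows "inverse (fps_to_fls h) = fps_to_fls (inverse h)"
proof -
  have "fps_to_fls h * fps_to_fls (inverse h) = 1"
    using assms by (simp add: fls_times_fps_to_fls [symmetric] inverse_mult_eq_1')
  thus ?thesis by (metis inverse_unique)
qed

lemma qexp_inverse:
  assumes "qexp f F" "\<And>z. z \<in> \<H> \<Longrightarrow> f z \<noteq> 0"
  shows "qexp (\<lambda>z. inverse (f z)) (inverse F)"
proof (rule has_q_expansion_imp_qexp)
  show "(\<lambda>z. inverse (f z)) holomorphic_on \<H>"
    using assms by (intro holomorphic_intros) (auto simp: qexp_def)
  have "eval_fls F has_laurent_expansion F"
    using assms(1) less_le_trans[of 0 "1 :: ereal"] by (intro eval_fls_has_laurent_expansion) (auto simp: qexp_def)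
  hence "(\<lambda>w. inverse (eval_fls F w)) has_laurent_expansion inverse F"
    by (rule has_laurent_expansion_inverse)
  thus "has_q_expansion (\<lambda>z. inverse (f z)) 1 (inverse F)"
    unfolding has_q_expansion_def using assms(1)
    by (intro exI[of _ "\<lambda>w. inverse (eval_fls F w)"]) (auto simp: qexp_def qe_def)
qed

lemma qexp_qe: "qexp qe fls_X"
  by (auto simp: qexp_def intro!: holomorphic_qe[of "\<lambda>z. z"] holomorphic_intros)

section \<open>Coefficients of the Euler product\<close>

definition euler_poly :: "nat \<Rightarrow> complex fps" where
  "euler_poly N = (\<Prod>n<N. 1 - fps_X ^ Suc n)"

definition euler_fps :: "complex fps" where
  "euler_fps = fps_expansion euler_phi 0"

lemma euler_poly_stable: "i \<le> N \<Longrightarrow> fps_nth (euler_poly N) i = fps_nth (euler_poly i) i"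
proof (induction N rule: dec_induct)
  case (step N)
  have "euler_poly (Suc N) = euler_poly N - fps_X ^ Suc N * euler_poly N"
    by (simp add: euler_poly_def algebra_simps)
  hence "fps_nth (euler_poly (Suc N)) i = fps_nth (euler_poly N) i"
    using step.hyps by (simp add: fps_X_power_mult_nth del: power_Suc)
  thus ?case using step.IH by simp
qed simp

lemma euler_poly_Ints: "fps_nth (euler_poly N) i \<in> \<int>"
proof (induction N arbitrary: i)
  case (Suc N)
  have "euler_poly (Suc N) = euler_poly N - fps_X ^ Suc N * euler_poly N"
    by (simp add: euler_poly_def algebra_simps)
  thus ?case using Suc by (simp add: fps_X_power_mult_nth del: power_Suc)
qed (simp add: euler_poly_def)

lemma holomorphic_euler_phi: "euler_phi holomorphic_on ball 0 1"
  unfolding euler_phi_def by (intro holomorphic_qpoch holomorphic_intros) auto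

text \<open>By locally uniform convergence the derivatives at 0 of the partial products converge to
  those of the infinite product, and by \<open>euler_poly_stable\<close> the corresponding
  coefficients are eventually constant.\<close>

lemma euler_fps_nth: "fps_nth euler_fps i = fps_nth (euler_poly i) i"
proof -
  define f where "f = (\<lambda>N (w :: complex). \<Prod>n<N. 1 - w * w ^ n)"
  have "uniform_limit (cball 0 (1/2)) f euler_phi sequentially"
    unfolding f_def euler_phi_def by (intro qpoch_uniform_limit continuous_intros) auto
  hence "uniform_limit (ball 0 (1/2)) f euler_phi sequentially"
    by (rule uniform_limit_on_subset) auto
  hence "(\<lambda>N. (deriv ^^ i) (f N) 0) \<longlonglongrightarrow> (deriv ^^ i) euler_phi 0"
    by (rule higher_deriv_complex_uniform_limit) (auto simp: f_def intro!: holomorphic_intros always_eventually)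
  hence "(\<lambda>N. (deriv ^^ i) (f N) 0 / fact i) \<longlonglongrightarrow> (deriv ^^ i) euler_phi 0 / fact i"
    by (intro tendsto_intros) auto
  moreover have "(deriv ^^ i) (f N) 0 / fact i = fps_nth (euler_poly N) i" for N
  proof -
    have "f N has_fps_expansion euler_poly N"
    proof (induction N)
      case (Suc N)
      have "(\<lambda>w. f N w * (1 - w ^ Suc N)) has_fps_expansion (euler_poly N * (1 - fps_X ^ Suc N))"
        by (intro fps_expansion_intros Suc)
      thus ?case by (simp add: f_def euler_poly_def)
    qed (simp add: f_def euler_poly_def)
    thus ?thesis by (simp add: fps_nth_fps_expansion)
  qed
  moreover have "(\<lambda>N. fps_nth (euler_poly N) i) \<longlonglongrightarrow> fps_nth (euler_poly i) i"
    by (rule tendsto_eventually) (use eventually_ge_at_top[of i] in eventually_elim, rule euler_poly_stable)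
  ultimately show ?thesis
    using LIMSEQ_unique by (auto simp: euler_fps_def fps_expansion_def)
qed

lemma qexp_euler_phi: "qexp (\<lambda>z. euler_phi (qe z)) (fps_to_fls euler_fps)"
proof -
  have "(euler_phi \<circ> qe) holomorphic_on \<H>"
    by (rule holomorphic_on_compose_gen[OF _ holomorphic_euler_phi])
       (use norm_qe_less_1 qexp_qe in \<open>auto simp: in_H_iff qexp_def\<close>)
  moreover have "euler_phi has_fps_expansion euler_fps"
    unfolding euler_fps_def using holomorphic_euler_phi
    by (intro has_fps_expansion_fps_expansion[of "ball 0 1"]) auto
  hence "(\<lambda>n. fps_nth euler_fps n * qe z ^ n) sums euler_phi (qe z)" if "z \<in> \<H>" for z
    using that norm_qe_less_1[of z] holomorphic_euler_phi
    by (intro has_fps_expansion_imp_sums_complex[where r = 1]) (auto simp: in_H_iff one_ereal_def)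
  ultimately have "qexp (\<lambda>z. euler_phi (qe z)) (fls_shift (int 0) (fps_to_fls euler_fps))"
    unfolding qexp_shift_iff by (simp add: o_def)
  thus ?thesis by simp
qed

lemma euler_fps_0: "fps_nth euler_fps 0 = 1"
  by (simp add: euler_fps_nth euler_poly_def)

lemma int_euler_fps: "int_fls (fps_to_fls euler_fps)"
  by (simp add: int_fls_def euler_fps_nth euler_poly_Ints)

lemma int_fls_compose_power: "int_fls F \<Longrightarrow> int_fls (fls_compose_power F d)"
  by (cases "d = 0") (simp_all add: int_fls_def fls_nth_compose_power)

context genus_zero_level
begin

text \<open>The factor of \<psi> besides the pole q^(-1). Its constant term 1 keeps inverses and
  powers integral, with leading coefficient 1.\<close>

definition psi_unit :: "complex fps" where
  "psi_unit = euler_fps ^ (6 * e) * inverse ((euler_fps oo fps_X ^ p) ^ (6 * e))"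

definition \<Psi> :: "complex fls" where
  "\<Psi> = fls_X_inv * fps_to_fls psi_unit"

lemma euler_comp_0: "fps_nth ((euler_fps oo fps_X ^ p) ^ n) 0 = 1"
  by (intro fps_power_zeroth_eq_one) (simp add: euler_fps_0)

lemma psi_unit_0: "fps_nth psi_unit 0 = 1"
  using euler_comp_0[of "6 * e"] fps_power_zeroth_eq_one[OF euler_fps_0, of "6 * e"]
  by (simp add: psi_unit_def)

lemma int_psi_unit: "int_fls (fps_to_fls psi_unit)"
proof -
  have "int_fls (fps_to_fls ((euler_fps oo fps_X ^ p) ^ (6 * e)))"
    using int_fls_power[OF int_fls_compose_power[OF int_euler_fps, of p]]
    by (simp add: fps_to_fls_power fls_compose_power_fps_to_fls)
  hence "int_fls (fps_to_fls (inverse ((euler_fps oo fps_X ^ p) ^ (6 * e))))"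
    by (intro int_fls_fps_inverse euler_comp_0)
  thus ?thesis using int_fls_power[OF int_euler_fps]
    by (simp add: psi_unit_def fls_times_fps_to_fls fps_to_fls_power int_fls_mult)
qed

lemma int_Psi: "int_fls \<Psi>"
proof -
  have "int_fls fls_X_inv" by (simp add: int_fls_def)
  thus ?thesis unfolding \<Psi>_def using int_psi_unit by (rule int_fls_mult)
qed

lemma int_Phi: "int_fls (inverse \<Psi>)"
proof -
  have "inverse \<Psi> = fls_X * fps_to_fls (inverse psi_unit)"
    by (simp add: \<Psi>_def psi_unit_0 fls_inverse_fps_to_fls' fls_inverse_X_inv)
  moreover have "int_fls fls_X" by (simp add: int_fls_def)
  ultimately show ?thesis using int_fls_fps_inverse[OF int_psi_unit psi_unit_0]
    by (simp add: int_fls_mult)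
qed

lemma psi_eq_product:
  assumes "z \<in> \<H>"
  shows "\<psi> z = inverse (qe z) * (euler_phi (qe z) ^ (6 * e) * inverse (euler_phi (qe (of_nat p * z)) ^ (6 * e)))"
proof -
  have "(qe (z / 4) / qe (of_nat p * z / 4)) ^ e = inverse (qe z)"
  proof -
    have "qe (z / 4) / qe (of_nat p * z / 4) = qe (z / 4 - of_nat p * z / 4)" by (simp only: qe_diff)
    hence "(qe (z / 4) / qe (of_nat p * z / 4)) ^ e = qe (of_nat e * (z / 4 - of_nat p * z / 4))"
      by (simp only: qe_power)
    \<comment> \<open>From e (p - 1) = 4; this is the simple pole of \<psi> at infinity.\<close>
    also have "of_nat e * (z / 4 - of_nat p * z / 4) = - z" using params by (auto simp: field_simps)
    finally show ?thesis by (simp add: qe_minus field_simps)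
  qed
  moreover have "eta6 z / eta6 (of_nat p * z) =
      qe (z / 4) / qe (of_nat p * z / 4) * (euler_phi (qe z) / euler_phi (qe (of_nat p * z))) ^ 6"
    unfolding eta6_def power_divide times_divide_times_eq ..
  ultimately have "\<psi> z = inverse (qe z) * ((euler_phi (qe z) / euler_phi (qe (of_nat p * z))) ^ 6) ^ e"
    unfolding \<psi>_def by (simp only: power_mult_distrib)
  thus ?thesis
    by (simp only: power_mult [symmetric] divide_inverse power_mult_distrib power_inverse)
qed

lemma euler_phi_qe_nonzero: "z \<in> \<H> \<Longrightarrow> euler_phi (qe z) \<noteq> 0"
  using qpoch_self_nonzero[OF norm_qe_less_1, of z] by (simp add: euler_phi_def in_H_iff)

lemma qexp_psi: "qexp \<psi> \<Psi>"
proof -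
  have "qexp (\<lambda>z. euler_phi (qe (of_nat p * z)) ^ (6 * e)) (fps_to_fls ((euler_fps oo fps_X ^ p) ^ (6 * e)))"
    using qexp_power[OF qexp_V[OF qexp_euler_phi p_pos]]
    by (simp add: fps_to_fls_power fls_compose_power_fps_to_fls)
  from qexp_inverse[OF this]
  have "qexp (\<lambda>z. inverse (euler_phi (qe (of_nat p * z)) ^ (6 * e))) (fps_to_fls (inverse ((euler_fps oo fps_X ^ p) ^ (6 * e))))"
    using euler_phi_qe_nonzero of_nat_in_H(1) euler_comp_0[of "6 * e"] by (simp add: fls_inverse_fps_to_fls')
  from qexp_mult[OF qexp_power[OF qexp_euler_phi] this]
  have "qexp (\<lambda>z. euler_phi (qe z) ^ (6 * e) * inverse (euler_phi (qe (of_nat p * z)) ^ (6 * e))) (fps_to_fls psi_unit)"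
    by (simp add: psi_unit_def fls_times_fps_to_fls fps_to_fls_power)
  from qexp_mult[OF qexp_inverse[OF qexp_qe] this]
  have "qexp (\<lambda>z. inverse (qe z) * (euler_phi (qe z) ^ (6 * e) * inverse (euler_phi (qe (of_nat p * z)) ^ (6 * e)))) \<Psi>"
    by (simp add: \<Psi>_def fls_inverse_X)
  thus ?thesis by (rule qexp_cong) (rule psi_eq_product)
qed

end

subsection \<open>The operator U on polynomials in the Hauptmodul\<close>

text \<open>The function is the trace of \<open>f\<close> from level \<open>p\<close> to level 1.\<close>
lemma hecke_U_S_invariant:
  assumes f: "Gamma0_inv p f" and p: "prime p" and z: "z \<in> \<H>"
  shows "of_nat p * hecke_U p f (- 1 / z) + f (- 1 / (of_nat p * (- 1 / z))) =
         of_nat p * hecke_U p f z + f (- 1 / (of_nat p * z))"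
proof -
  have p0: "p > 0" using p prime_gt_0_nat by blast
  have pi: "prime (int p)" using p by simp
  have z0: "z \<noteq> 0" using z by (auto simp: in_H_iff)
  \<comment> \<open>The involution S permutes the summands with j prime to p according to j -> -1/j
    modulo p.\<close>
  have "\<exists>s<p. int p dvd - 1 - int j * int s" if "j \<in> {1..<p}" for j
  proof (rule solve_lin_mod_prime[OF p])
    show "\<not> int p dvd int j" using that nat_dvd_not_less[of j p] by (auto simp: int_dvd_int_iff)
  qed
  then obtain s where s: "\<And>j. j \<in> {1..<p} \<Longrightarrow> s j < p"
    "\<And>j. j \<in> {1..<p} \<Longrightarrow> int p dvd - 1 - int j * int (s j)"
    by metis
  have s0: "s j \<noteq> 0" if "j \<in> {1..<p}" for j
  proof
    assume "s j = 0"
    hence "int p dvd 1" using s(2)[OF that] by simp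
    thus False using pi not_prime_unit by blast
  qed
  have inj: "inj_on s {1..<p}"
  proof (rule inj_onI)
    fix j k assume jk: "j \<in> {1..<p}" "k \<in> {1..<p}" "s j = s k"
    have "int p dvd (- 1 - int j * int (s j)) - (- 1 - int k * int (s k))"
      using jk by (intro dvd_diff s)
    also have "\<dots> = (int k - int j) * int (s k)" using jk(3) by (simp add: algebra_simps)
    finally have "int p dvd int k - int j \<or> int p dvd int (s k)" using pi prime_dvd_mult_iff by blast
    moreover have "\<not> int p dvd int (s k)"
      using s(1)[OF jk(2)] s0[OF jk(2)] nat_dvd_not_less[of "s k" p] by (auto simp: int_dvd_int_iff)
    ultimately have "[int k = int j] (mod int p)" by (simp add: cong_iff_dvd_diff)
    thus "j = k" using jk cong_less_modulus_unique_nat[of k j p] by (simp add: cong_int_iff)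
  qed
  have "s ` {1..<p} \<subseteq> {1..<p}"
  proof safe
    fix j assume "j \<in> {1..<p}"
    thus "s j \<in> {1..<p}" using s(1) s0 by (simp add: Suc_le_eq)
  qed
  hence bij: "bij_betw s {1..<p} {1..<p}"
    using inj endo_inj_surj[of "{1..<p}" s] by (auto simp: bij_betw_def)
  have eq: "f ((- 1 / z + of_nat j) / of_nat p) = f ((z + of_nat (s j)) / of_nat p)" if j: "j \<in> {1..<p}" for j
  proof -
    obtain B where B: "- 1 - int j * int (s j) = int p * B" using s(2)[OF j] by blast
    have Bc: "- 1 - of_nat j * of_nat (s j) = (of_nat p * of_int B :: complex)"
      using arg_cong[OF B, of "of_int :: int \<Rightarrow> complex"] by simp
    define w where "w = (z + of_nat (s j)) / of_nat p"
    have w: "w \<in> \<H>" unfolding w_def using z p0 by (rule of_nat_in_H)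
    have zw: "of_nat p * w = z + of_nat (s j)" using p0 by (simp add: w_def)
    have "of_int (int j) * w + of_int B = (of_nat j * (of_nat p * w) + of_nat p * of_int B) / of_nat p"
      using p0 by (simp add: field_simps)
    also have "\<dots> = (of_nat j * z - 1) / of_nat p" unfolding zw Bc [symmetric] by (simp add: algebra_simps)
    finally have num: "of_int (int j) * w + of_int B = (of_nat j * z - 1) / of_nat p" .
    have den: "of_int (int p) * w + of_int (- int (s j)) = z" using zw by simp
    have "mob (int j) B (int p) (- int (s j)) w = (- 1 / z + of_nat j) / of_nat p"
      unfolding mob_def num den using z0 p0 by (simp add: field_simps)
    moreover have "int j * - int (s j) - B * int p = 1" using B by (simp add: algebra_simps)
    ultimately show ?thesis
      using Gamma0_invD[OF f, of "int j" "- int (s j)" B "int p" w] w by (simp add: w_def)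
  qed
  have "(\<Sum>j\<in>{1..<p}. f ((- 1 / z + of_nat j) / of_nat p)) = (\<Sum>j\<in>{1..<p}. f ((z + of_nat (s j)) / of_nat p))"
    by (intro sum.cong refl eq)
  also have "\<dots> = (\<Sum>j\<in>{1..<p}. f ((z + of_nat j) / of_nat p))"
    by (rule sum.reindex_bij_betw[OF bij])
  finally have main: "(\<Sum>j\<in>{1..<p}. f ((- 1 / z + of_nat j) / of_nat p)) = (\<Sum>j\<in>{1..<p}. f ((z + of_nat j) / of_nat p))" .
  have split: "of_nat p * hecke_U p f w = f (w / of_nat p) + (\<Sum>j\<in>{1..<p}. f ((w + of_nat j) / of_nat p))" for w
  proof -
    have "{..<p} = insert 0 {1..<p}" using p0 by auto
    thus ?thesis using p0 by (simp add: hecke_U_def)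
  qed
  \<comment> \<open>The summand j = 0 and the Fricke term are exchanged by S.\<close>
  have "- 1 / (of_nat p * (- 1 / z)) = z / of_nat p" using z0 p0 by (simp add: field_simps)
  moreover have "- 1 / z / of_nat p = - 1 / (of_nat p * z)" by simp
  ultimately show ?thesis unfolding split main by (simp add: mult.commute)
qed

section \<open>Polynomials in the Hauptmodul and their traces\<close>

lemma Gamma0_inv_comp: "Gamma0_inv N f \<Longrightarrow> Gamma0_inv N (\<lambda>z. h (f z))"
  by (simp add: Gamma0_inv_def)

text \<open>Polymorphic in the ring, so that one coefficient function with degree bound m can be
  evaluated both at values of \<psi> and v and at their Laurent series.\<close>

definition ev :: "(nat \<Rightarrow> int) \<Rightarrow> nat \<Rightarrow> 'a :: comm_ring_1 \<Rightarrow> 'a" where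
  "ev k m x = (\<Sum>j\<le>m. of_int (k j) * x ^ j)"

lemma of_int_fls: "(of_int k :: complex fls) = fls_const (of_int k)"
  by (simp add: fls_of_int)

lemma qexp_ev: "qexp f F \<Longrightarrow> qexp (\<lambda>z. ev k m (f z)) (ev k m F)"
  unfolding ev_def of_int_fls by (intro qexp_sum qexp_cmult qexp_power)

lemma int_fls_ev: "int_fls F \<Longrightarrow> int_fls (ev k m F)"
  unfolding ev_def of_int_fls by (intro int_fls_sum int_fls_mult int_fls_const int_fls_power) auto

context genus_zero_level
begin

definition \<Phi> :: "complex fls" where "\<Phi> = inverse \<Psi>"

definition v :: "complex \<Rightarrow> complex" where "v z = \<kappa> / \<psi> z"

lemma psi_fricke': "z \<in> \<H> \<Longrightarrow> \<psi> (- 1 / (of_nat p * z)) = v z"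
  unfolding v_def by (rule psi_fricke)

lemma v_fricke: "z \<in> \<H> \<Longrightarrow> v (- 1 / (of_nat p * z)) = \<psi> z"
  using psi_nonzero[of z] unfolding v_def psi_fricke by simp

lemma Phi_eq: "\<Phi> = fls_X * fps_to_fls (inverse psi_unit)"
  by (simp add: \<Phi>_def \<Psi>_def psi_unit_0 fls_inverse_fps_to_fls' fls_inverse_X_inv)

lemma qexp_phi: "qexp (\<lambda>z. 1 / \<psi> z) \<Phi>"
  using qexp_inverse[OF qexp_psi psi_nonzero] by (simp add: \<Phi>_def inverse_eq_divide)

lemma qexp_v: "qexp v (fls_const \<kappa> * \<Phi>)"
  using qexp_cmult[OF qexp_phi, of \<kappa>] by (rule qexp_cong) (simp add: v_def)

lemma Psi_power: "\<Psi> ^ j = fls_shift (int j) (fps_to_fls (psi_unit ^ j))"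
proof -
  have "\<Psi> = fls_shift 1 (fps_to_fls psi_unit)"
    by (simp add: \<Psi>_def fls_X_inv_times_conv_shift)
  thus ?thesis
    by (induction j) (simp_all add: fls_shifted_times_simps fls_times_fps_to_fls)
qed

lemma Psi_power_nth: "fls_nth (\<Psi> ^ j) n = (if n < - int j then 0 else fps_nth (psi_unit ^ j) (nat (n + int j)))"
  by (simp add: Psi_power)

lemma Psi_power_nth_eq_0: "n < - int j \<Longrightarrow> fls_nth (\<Psi> ^ j) n = 0"
  and Psi_power_nth_lead: "fls_nth (\<Psi> ^ j) (- int j) = 1"
  using fps_power_zeroth_eq_one[OF psi_unit_0] by (simp_all add: Psi_power_nth)

lemma Psi_nth_eq_0: "n < - 1 \<Longrightarrow> fls_nth \<Psi> n = 0" and Psi_nth_lead: "fls_nth \<Psi> (- 1) = 1"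
  using Psi_power_nth_eq_0[of n 1] Psi_power_nth_lead[of 1] by simp_all

lemma ev_Psi_nth: "fls_nth (ev k m \<Psi>) n = (\<Sum>j\<le>m. of_int (k j) * fls_nth (\<Psi> ^ j) n)"
  by (simp add: ev_def fls_nth_sum of_int_fls)

lemma ev_Psi_nth_eq_0: "n < - int m \<Longrightarrow> fls_nth (ev k m \<Psi>) n = 0"
  unfolding ev_Psi_nth by (intro sum.neutral ballI) (simp add: Psi_power_nth_eq_0)

lemma Phi_power: "\<Phi> ^ j = fps_to_fls (fps_X ^ j * inverse psi_unit ^ j)"
  by (simp add: Phi_eq power_mult_distrib fls_times_fps_to_fls fps_to_fls_power)

lemma ev_cPhi_nth: "n \<le> 0 \<Longrightarrow> fls_nth (ev k m (fls_const x * \<Phi>)) n = (if n = 0 then of_int (k 0) else 0)"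
proof -
  assume n: "n \<le> 0"
  have "fls_nth (ev k m (fls_const x * \<Phi>)) n = (\<Sum>j\<le>m. of_int (k j) * (x ^ j * fls_nth (\<Phi> ^ j) n))"
    by (simp add: ev_def fls_nth_sum of_int_fls power_mult_distrib fls_const_power [symmetric])
  also have "\<dots> = (\<Sum>j\<le>m. if j = 0 then (if n = 0 then of_int (k 0) else 0) else 0)"
    using n by (intro sum.cong refl) (auto simp: Phi_power fps_X_power_mult_nth power_0_left)
  finally show ?thesis by simp
qed

lemma mod_fun_psi: "mod_fun p \<psi>"
proof (rule mod_funI_prime_level[OF prime_p holomorphic_psi Gamma0_inv_psi])
  have "\<Phi> = fps_to_fls (fps_X * inverse psi_unit)" using Phi_power[of 1] by simp
  hence "cusp_bdd v" by (intro qexp_imp_cusp_bdd[OF qexp_v]) simp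
  thus "cusp_bdd (\<lambda>z. \<psi> (- 1 / (of_nat p * z)))" by (rule cusp_bdd_cong[rotated]) (rule psi_fricke'[symmetric])
qed

lemma mod_fun_ev_psi: "mod_fun p (\<lambda>z. ev k m (\<psi> z))"
  unfolding ev_def by (intro mod_fun_sum mod_fun_mult mod_fun_const mod_fun_power mod_fun_psi)

lemma hecke_U_ev_fricke:
  fixes k m
  defines "f \<equiv> (\<lambda>z. ev k m (\<psi> z))"
  assumes z: "z \<in> \<H>"
  shows "of_nat p * hecke_U p f (- 1 / (of_nat p * z)) + f z =
         of_nat p * hecke_U p f (of_nat p * z) + ev k m (v (of_nat p * z))"
proof -
  have inv: "Gamma0_inv p f" unfolding f_def by (rule Gamma0_inv_comp[OF Gamma0_inv_psi])
  have pz: "of_nat p * z \<in> \<H>" using z by (intro of_nat_in_H) auto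
  have "- 1 / (of_nat p * (- 1 / (of_nat p * z))) = z" using z by (auto simp: in_H_iff)
  moreover have "f (- 1 / (of_nat p * (of_nat p * z))) = ev k m (v (of_nat p * z))"
    unfolding f_def psi_fricke'[OF pz] ..
  ultimately show ?thesis
    using hecke_U_S_invariant[OF inv prime_p pz] by simp
qed

text \<open>
  The difference of both sides has level \<open>p\<close>: \<open>A\<close> says that it vanishes at \<open>\<infinity>\<close>, and \<open>B\<close> that it is
  bounded at the cusp \<open>0\<close>.
\<close>
lemma U_ev_psi:
  fixes k l :: "nat \<Rightarrow> int" and m m' :: nat
  defines "F \<equiv> ev k m \<Psi>" and "G \<equiv> ev l m' \<Psi>"
  assumes A: "\<And>n. n \<le> 0 \<Longrightarrow> of_nat p * fls_nth F (int p * n) = fls_nth G n + (if n = 0 then K else 0)"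
    and B: "\<And>n. n < 0 \<Longrightarrow> (if int p dvd n then of_nat p * fls_nth F n else 0) = (1 + r) * fls_nth F n"
    and z: "z \<in> \<H>"
  shows "of_nat p * hecke_U p (\<lambda>z. ev k m (\<psi> z)) z = ev l m' (\<psi> z) + r * (ev k m (v z) - of_int (k 0)) + K"
proof -
  define f where "f = (\<lambda>z. ev k m (\<psi> z))"
  define g where "g = (\<lambda>z. of_nat p * hecke_U p f z - ev l m' (\<psi> z) - r * (ev k m (v z) - of_int (k 0)) - K)"
  have qf: "qexp f F" unfolding f_def F_def by (intro qexp_ev qexp_psi)
  let ?g_fls = "fls_const (of_nat p) * fls_U p F - G - fls_const r * (ev k m (fls_const \<kappa> * \<Phi>) - fls_const (of_int (k 0))) - fls_const K"
  have qg: "qexp g ?g_fls"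
    unfolding g_def G_def by (intro qexp_diff qexp_cmult qexp_U qf qexp_ev qexp_psi qexp_v qexp_const p_pos)
  have inv: "Gamma0_inv p (hecke_U p f)"
    by (rule Gamma0_inv_U[of p]) (auto simp: f_def prime_p intro: Gamma0_inv_comp[OF Gamma0_inv_psi])
  have ginv: "Gamma0_inv p g"
    using inv Gamma0_inv_psi unfolding Gamma0_inv_def g_def v_def by simp
  \<comment> \<open>This is g after the Fricke involution. The trace relation replaces U f at the
    image point, so this function has an explicit expansion as well.\<close>
  define g' where "g' = (\<lambda>z. (of_nat p * hecke_U p f (of_nat p * z) + ev k m (v (of_nat p * z)))
      - f z - ev l m' (v z) - r * (ev k m (\<psi> z) - of_int (k 0)) - K)"
  have g': "g (- 1 / (of_nat p * z)) = g' z" if z: "z \<in> \<H>" for z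
    using hecke_U_ev_fricke[OF z, of k m] psi_fricke'[OF z] v_fricke[OF z]
    by (simp add: g_def g'_def f_def algebra_simps)
  let ?g'_fls = "fls_const (of_nat p) * fls_compose_power (fls_U p F) p + fls_compose_power (ev k m (fls_const \<kappa> * \<Phi>)) p
      - F - ev l m' (fls_const \<kappa> * \<Phi>) - fls_const r * (F - fls_const (of_int (k 0))) - fls_const K"
  have qg': "qexp g' ?g'_fls"
    unfolding g'_def F_def
    using qexp_V[OF qexp_U[OF qf p_pos] p_pos] qexp_V[OF qexp_ev[OF qexp_v] p_pos]
    by (intro qexp_diff qexp_add qexp_cmult qexp_const qexp_ev qexp_psi qexp_v)
       (simp_all add: F_def f_def qexp_ev qexp_psi)
  have "cusp_bdd g'"
  proof (rule qexp_imp_cusp_bdd[OF qg'])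
    fix n :: int assume n: "n < 0"
    have 1: "fls_nth (ev k m (fls_const \<kappa> * \<Phi>)) j = 0" "fls_nth (ev l m' (fls_const \<kappa> * \<Phi>)) j = 0" if "j < 0" for j
      using that ev_cPhi_nth[of j] by simp_all
    have "n div int p < 0" using n by (simp add: div_neg_pos_less0)
    hence 2: "fls_nth (fls_compose_power (ev k m (fls_const \<kappa> * \<Phi>)) p) n = 0"
      using 1 by (simp add: fls_nth_compose_power)
    have 3: "of_nat p * fls_nth (fls_compose_power (fls_U p F) p) n = (1 + r) * fls_nth F n"
      using B[OF n] by (auto simp: fls_nth_compose_power fls_nth_U split: if_splits)
    show "fls_nth ?g'_fls n = 0"
      using n 1[OF n] 2 3 by (simp add: ring_distribs)
  qed
  hence "cusp_bdd (\<lambda>z. g (- 1 / (of_nat p * z)))" by (rule cusp_bdd_cong[rotated]) (rule g'[symmetric])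
  hence mg: "mod_fun p g" by (rule mod_funI_prime_level[OF prime_p qexp_holomorphic[OF qg] ginv])
  have "?g_fls = 0"
  proof (rule mod_fun_qexp_eq_0[OF mg p_pos qg])
    fix n :: int assume n: "n \<le> 0"
    show "fls_nth ?g_fls n = 0"
      using A[OF n] ev_cPhi_nth[OF n, of k m \<kappa>] by (simp add: fls_nth_U)
  qed
  hence "g z = 0" using qg z qexp_0_imp by metis
  thus ?thesis by (simp add: g_def f_def algebra_simps)
qed

text \<open>Subtracting multiples of powers of \<Psi> removes the pole from the top down; everything
  stays integral because these powers have leading coefficient 1.\<close>

lemma ex_int_poly_principal_part:
  "int_fls F \<Longrightarrow> (\<And>n. n < - int m \<Longrightarrow> fls_nth F n = 0) \<Longrightarrow>
     \<exists>k. \<forall>n\<le>0. fls_nth (ev k m \<Psi>) n = fls_nth F n"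
proof (induction m arbitrary: F)
  case 0
  obtain i where i: "fls_nth F 0 = of_int i" using int_fls_nth[OF 0(1), of 0] by (auto elim: Ints_cases)
  show ?case using 0(2) i by (intro exI[of _ "\<lambda>_. i"]) (auto simp: ev_def of_int_fls)
next
  case (Suc m)
  obtain i where i: "fls_nth F (- int (Suc m)) = of_int i"
    using int_fls_nth[OF Suc.prems(1), of "- int (Suc m)"] by (auto elim: Ints_cases)
  define F' where "F' = F - fls_const (of_int i) * \<Psi> ^ Suc m"
  have "int_fls F'" unfolding F'_def
    by (intro int_fls_diff int_fls_mult int_fls_const int_fls_power int_Psi Suc.prems) auto
  moreover have "fls_nth F' n = 0" if "n < - int m" for n
  proof (cases "n = - int (Suc m)")
    case True
    show ?thesis unfolding True using Psi_power_nth_lead[of "Suc m"] i by (simp add: F'_def del: power_Suc of_nat_Suc)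
  next
    case False
    hence "n < - int (Suc m)" using that by simp
    thus ?thesis using Suc.prems(2) Psi_power_nth_eq_0 by (simp add: F'_def del: power_Suc of_nat_Suc)
  qed
  ultimately obtain k where k: "\<And>n. n \<le> 0 \<Longrightarrow> fls_nth (ev k m \<Psi>) n = fls_nth F' n"
    using Suc.IH by blast
  have "ev (k(Suc m := i)) (Suc m) \<Psi> = ev k m \<Psi> + fls_const (of_int i) * \<Psi> ^ Suc m"
    by (simp add: ev_def of_int_fls del: power_Suc)
  thus ?case using k by (intro exI[of _ "k(Suc m := i)"]) (simp add: F'_def del: power_Suc fun_upd_apply)
qed

definition bcoeff :: "nat \<Rightarrow> nat \<Rightarrow> int" where
  "bcoeff m = (SOME k. \<forall>n\<le>0. fls_nth (ev k m \<Psi>) n = (if n = - int m then 1 else 0))"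

definition bfun :: "nat \<Rightarrow> complex \<Rightarrow> complex" where
  "bfun m z = ev (bcoeff m) m (\<psi> z)"

definition bfls :: "nat \<Rightarrow> complex fls" where
  "bfls m = ev (bcoeff m) m \<Psi>"

lemma bfls_nth: "n \<le> 0 \<Longrightarrow> fls_nth (bfls m) n = (if n = - int m then 1 else 0)"
proof -
  have "\<exists>k. \<forall>n\<le>0. fls_nth (ev k m \<Psi>) n = fls_nth (fls_X_intpow (- int m)) n"
    by (rule ex_int_poly_principal_part) (auto simp: int_fls_def)
  moreover have "fls_nth (fls_X_intpow (- int m)) n = (if n = - int m then 1 else 0 :: complex)" for n
    by auto
  ultimately have "\<exists>k. \<forall>n\<le>0. fls_nth (ev k m \<Psi>) n = (if n = - int m then 1 else 0)" by (simp only:)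
  from someI_ex[OF this] show "n \<le> 0 \<Longrightarrow> fls_nth (bfls m) n = (if n = - int m then 1 else 0)"
    unfolding bcoeff_def bfls_def by blast
qed

lemma qexp_bfun: "qexp (bfun m) (bfls m)"
  unfolding bfun_def bfls_def by (intro qexp_ev qexp_psi)

lemma int_bfls: "int_fls (bfls m)"
  unfolding bfls_def by (intro int_fls_ev int_Psi)

lemma canonical_imp_bfls: "canonical p m f F \<Longrightarrow> F = bfls m"
  by (rule mod_fun_qexp_unique[of p f "bfun m"])
     (auto simp: canonical_def bfun_def[abs_def] mod_fun_ev_psi qexp_bfun[unfolded bfun_def] bfls_nth)

end

subsection \<open>The modular equation\<close>

text \<open>Five coefficients suffice: the principal parts of \<psi>^j for j \<le> p and the
  constant terms for j < p involve only coefficients of \<open>psi_unit ^ j\<close> of index below p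
  \<le> 5.\<close>

definition coeffs5 :: "complex fps \<Rightarrow> int \<Rightarrow> int \<Rightarrow> int \<Rightarrow> int \<Rightarrow> int \<Rightarrow> bool" where
  "coeffs5 F a0 a1 a2 a3 a4 \<longleftrightarrow> fps_nth F 0 = of_int a0 \<and> fps_nth F 1 = of_int a1 \<and>
     fps_nth F 2 = of_int a2 \<and> fps_nth F 3 = of_int a3 \<and> fps_nth F 4 = of_int a4"

lemma coeffs5_mult:
  assumes "coeffs5 F a0 a1 a2 a3 a4" "coeffs5 G b0 b1 b2 b3 b4"
  shows "coeffs5 (F * G) (a0 * b0) (a0 * b1 + a1 * b0) (a0 * b2 + a1 * b1 + a2 * b0)
     (a0 * b3 + a1 * b2 + a2 * b1 + a3 * b0) (a0 * b4 + a1 * b3 + a2 * b2 + a3 * b1 + a4 * b0)"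
  using assms by (simp add: coeffs5_def fps_mult_nth numeral_eq_Suc)

lemma euler_poly_Suc_nth:
  "fps_nth (euler_poly (Suc N)) i = fps_nth (euler_poly N) i - (if i \<le> N then 0 else fps_nth (euler_poly N) (i - Suc N))"
proof -
  have "euler_poly (Suc N) = euler_poly N - fps_X ^ Suc N * euler_poly N"
    by (simp add: euler_poly_def algebra_simps)
  thus ?thesis by (simp add: fps_X_power_mult_nth del: power_Suc)
qed

lemma coeffs5_euler: "coeffs5 euler_fps 1 (- 1) (- 1) 0 0"
proof -
  have "euler_poly 0 = 1" by (simp add: euler_poly_def)
  thus ?thesis by (simp add: coeffs5_def euler_fps_nth euler_poly_Suc_nth numeral_eq_Suc)
qed

text \<open>The exponents are the numbers 6 e j with 1 \<le> j \<le> p: multiples of 24, 12 and 6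
  for p = 2, 3 and 5.\<close>

lemma coeffs5_euler_powers:
  "coeffs5 (euler_fps ^ 6) 1 (- 6) 9 10 (- 30)"
  "coeffs5 (euler_fps ^ 12) 1 (- 12) 54 (- 88) (- 99)"
  "coeffs5 (euler_fps ^ 18) 1 (- 18) 135 (- 510) 765"
  "coeffs5 (euler_fps ^ 24) 1 (- 24) 252 (- 1472) 4830"
  "coeffs5 (euler_fps ^ 30) 1 (- 30) 405 (- 3190) 15660"
  "coeffs5 (euler_fps ^ 36) 1 (- 36) 594 (- 5880) 38115"
  "coeffs5 (euler_fps ^ 48) 1 (- 48) 1080 (- 15040) 143820"
proof -
  have 2: "coeffs5 (euler_fps ^ 2) 1 (- 2) (- 1) 2 1"
    using coeffs5_mult[OF coeffs5_euler coeffs5_euler] by (simp add: power2_eq_square)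
  have 4: "coeffs5 (euler_fps ^ 4) 1 (- 4) 2 8 (- 5)"
    using coeffs5_mult[OF 2 2] by (simp add: power_add [symmetric])
  show 6: "coeffs5 (euler_fps ^ 6) 1 (- 6) 9 10 (- 30)"
    using coeffs5_mult[OF 2 4] by (simp add: power_add [symmetric])
  show 12: "coeffs5 (euler_fps ^ 12) 1 (- 12) 54 (- 88) (- 99)"
    using coeffs5_mult[OF 6 6] by (simp add: power_add [symmetric])
  show 18: "coeffs5 (euler_fps ^ 18) 1 (- 18) 135 (- 510) 765"
    using coeffs5_mult[OF 6 12] by (simp add: power_add [symmetric])
  show 24: "coeffs5 (euler_fps ^ 24) 1 (- 24) 252 (- 1472) 4830"
    using coeffs5_mult[OF 12 12] by (simp add: power_add [symmetric])
  show "coeffs5 (euler_fps ^ 30) 1 (- 30) 405 (- 3190) 15660"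
    using coeffs5_mult[OF 6 24] by (simp add: power_add [symmetric])
  show "coeffs5 (euler_fps ^ 36) 1 (- 36) 594 (- 5880) 38115"
    using coeffs5_mult[OF 12 24] by (simp add: power_add [symmetric])
  show "coeffs5 (euler_fps ^ 48) 1 (- 48) 1080 (- 15040) 143820"
    using coeffs5_mult[OF 24 24] by (simp add: power_add [symmetric])
qed

context genus_zero_level
begin

text \<open>The denominator of \<psi> is a series in q^p with constant term 1 and cannot affect
  coefficients of index below p.\<close>

lemma psi_unit_power_nth:
  assumes "n < p"
  shows "fps_nth (psi_unit ^ k) n = fps_nth (euler_fps ^ (6 * e * k)) n"
proof -
  define W where "W = (euler_fps oo fps_X ^ p) ^ (6 * e)"
  have W0: "fps_nth W 0 = 1" unfolding W_def by (rule euler_comp_0)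
  have Wk: "W ^ k = (euler_fps ^ (6 * e * k)) oo fps_X ^ p"
    by (simp add: W_def power_mult [symmetric] fps_compose_power)
  have Wn: "fps_nth (W ^ k) i = (if i = 0 then 1 else 0)" if "i < p" for i
  proof (cases "i = 0")
    case True
    thus ?thesis using fps_power_zeroth_eq_one[OF W0] by simp
  next
    case False
    thus ?thesis unfolding Wk fps_nth_compose_X_power using that by (auto dest: dvd_imp_le)
  qed
  have "psi_unit * W = euler_fps ^ (6 * e)"
    using W0 unfolding psi_unit_def W_def [symmetric] by (simp add: mult.assoc inverse_mult_eq_1)
  hence "euler_fps ^ (6 * e * k) = psi_unit ^ k * W ^ k"
    by (simp add: power_mult power_mult_distrib [symmetric])
  hence "fps_nth (euler_fps ^ (6 * e * k)) n = (\<Sum>i=0..n. fps_nth (psi_unit ^ k) i * fps_nth (W ^ k) (n - i))"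
    by (simp add: fps_mult_nth)
  also have "\<dots> = (\<Sum>i=0..n. if i = n then fps_nth (psi_unit ^ k) n else 0)"
    using assms Wn by (intro sum.cong refl) auto
  finally show ?thesis by simp
qed

text \<open>The polynomial with coefficients \<open>Acoeff\<close> is \<open>(x + 16)\<^sup>3 / x\<close>, \<open>(x + 27) (x + 3)\<^sup>3 / x\<close> and
  \<open>(x\<^sup>2 + 10 x + 5)\<^sup>3 / x\<close> for \<open>p = 2, 3, 5\<close>, without its constant term and its pole;
  at \<open>\<psi>\<close> and at \<open>v\<close> these are \<open>j (p z)\<close> and \<open>j z\<close>.\<close>
definition Acoeff :: "nat \<Rightarrow> int" where
  "Acoeff j = (if j < 6 then
     (if p = 2 then [0, 48, 1, 0, 0, 0] else if p = 3 then [0, 270, 36, 1, 0, 0]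
      else [0, 1575, 1300, 315, 30, 1]) ! j else 0)"

text \<open>So A agrees with P_p up to its constant term, and the trace formula applies to it as to
  f_p. The proof is a finite computation with the coefficient table.\<close>

lemma ev_Acoeff_Psi_nth:
  assumes "n < 0"
  shows "fls_nth (ev Acoeff p \<Psi>) n = (if n = - int p then 1 else 0)"
proof (cases "n < - int p")
  case True
  thus ?thesis by (simp add: ev_Psi_nth_eq_0)
next
  case False
  have nth: "fls_nth (ev Acoeff p \<Psi>) n = (\<Sum>j\<le>p. of_int (Acoeff j) * (if n + int j < 0 then 0 else fps_nth (euler_fps ^ (6 * e * j)) (nat (n + int j))))"
  proof -
    have "fls_nth (\<Psi> ^ j) n = (if n + int j < 0 then 0 else fps_nth (euler_fps ^ (6 * e * j)) (nat (n + int j)))" if "j \<le> p" for j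
    proof -
      have "nat (n + int j) < p" using that assms p_pos by linarith
      thus ?thesis by (auto simp: Psi_power_nth psi_unit_power_nth)
    qed
    thus ?thesis unfolding ev_Psi_nth by (intro sum.cong) auto
  qed
  note c = coeffs5_euler_powers[unfolded coeffs5_def One_nat_def]
  have sets: "{..2 :: nat} = {0, 1, 2}" "{..3 :: nat} = {0, 1, 2, 3}" "{..5 :: nat} = {0, 1, 2, 3, 4, 5}"
    by auto
  from params consider "p = 2" "e = 4" | "p = 3" "e = 2" | "p = 5" "e = 1" by auto
  thus ?thesis
  proof cases
    case 1
    from 1 False assms have "n = -2 \<or> n = -1" by auto
    thus ?thesis unfolding nth unfolding Acoeff_def unfolding 1 sets by (elim disjE) (simp_all add: c)
  next
    case 2
    from 2 False assms have "n = -3 \<or> n = -2 \<or> n = -1" by auto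
    thus ?thesis unfolding nth unfolding Acoeff_def unfolding 2 sets by (elim disjE) (simp_all add: c)
  next
    case 3
    from 3 False assms have "n = -5 \<or> n = -4 \<or> n = -3 \<or> n = -2 \<or> n = -1" by auto
    thus ?thesis unfolding nth unfolding Acoeff_def unfolding 3 sets by (elim disjE) (simp_all add: c)
  qed
qed

lemma Psi_power_const_term:
  "p = 2 \<Longrightarrow> fls_nth (\<Psi> ^ 1) 0 = - 24"
  "p = 3 \<Longrightarrow> fls_nth (\<Psi> ^ 1) 0 = - 12" "p = 3 \<Longrightarrow> fls_nth (\<Psi> ^ 2) 0 = 252"
  "p = 5 \<Longrightarrow> fls_nth (\<Psi> ^ 1) 0 = - 6" "p = 5 \<Longrightarrow> fls_nth (\<Psi> ^ 2) 0 = 54"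
  "p = 5 \<Longrightarrow> fls_nth (\<Psi> ^ 3) 0 = - 510" "p = 5 \<Longrightarrow> fls_nth (\<Psi> ^ 4) 0 = 4830"
proof -
  have *: "fls_nth (\<Psi> ^ j) 0 = fps_nth (euler_fps ^ (6 * e * j)) j" if "j < p" for j
    using that by (simp add: Psi_power_nth psi_unit_power_nth)
  note c = coeffs5_euler_powers[unfolded coeffs5_def]
  show "p = 2 \<Longrightarrow> fls_nth (\<Psi> ^ 1) 0 = - 24" using *[of 1] c params by auto
  show "p = 3 \<Longrightarrow> fls_nth (\<Psi> ^ 1) 0 = - 12" using *[of 1] c params by auto
  show "p = 3 \<Longrightarrow> fls_nth (\<Psi> ^ 2) 0 = 252" using *[of 2] c params by auto
  show "p = 5 \<Longrightarrow> fls_nth (\<Psi> ^ 1) 0 = - 6" using *[of 1] c params by auto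
  show "p = 5 \<Longrightarrow> fls_nth (\<Psi> ^ 2) 0 = 54" using *[of 2] c params by auto
  show "p = 5 \<Longrightarrow> fls_nth (\<Psi> ^ 3) 0 = - 510" using *[of 3] c params by auto
  show "p = 5 \<Longrightarrow> fls_nth (\<Psi> ^ 4) 0 = 4830" using *[of 4] c params by auto
qed

text \<open>The pole order j < p is too small to survive U, so the trace formula with r = -1 leaves
  only a constant and - v^j.\<close>

lemma U_psi_power:
  assumes j: "1 \<le> j" "j < p" and z: "z \<in> \<H>"
  shows "of_nat p * hecke_U p (\<lambda>z. \<psi> z ^ j) z = of_nat p * fls_nth (\<Psi> ^ j) 0 - v z ^ j"
proof -
  define k where "k = (\<lambda>i. if i = j then 1 else 0 :: int)"
  have ev: "ev k j x = x ^ j" for x :: "'a :: comm_ring_1"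
  proof -
    have "ev k j x = (\<Sum>i\<le>j. if i = j then x ^ j else 0)"
      unfolding ev_def by (intro sum.cong) (auto simp: k_def)
    thus ?thesis by simp
  qed
  have ev0: "ev (\<lambda>_. 0) 0 x = 0" for x :: "'a :: comm_ring_1" by (simp add: ev_def)
  have F0: "fls_nth (\<Psi> ^ j) n = 0" if "n \<le> - int p" for n
    using that j by (intro Psi_power_nth_eq_0) auto
  have "of_nat p * hecke_U p (\<lambda>z. ev k j (\<psi> z)) z =
      ev (\<lambda>_. 0) 0 (\<psi> z) + (- 1) * (ev k j (v z) - of_int (k 0)) + of_nat p * fls_nth (\<Psi> ^ j) 0"
  proof (rule U_ev_psi[OF _ _ z])
    fix n :: int assume "n \<le> 0"
    show "of_nat p * fls_nth (ev k j \<Psi>) (int p * n) = fls_nth (ev (\<lambda>_. 0) 0 \<Psi>) n + (if n = 0 then of_nat p * fls_nth (\<Psi> ^ j) 0 else 0)"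
    proof (cases "n = 0")
      case False
      hence "int p * n \<le> int p * (- 1)" using \<open>n \<le> 0\<close> by (intro mult_left_mono) auto
      thus ?thesis using False F0 by (simp add: ev ev0)
    qed (simp add: ev ev0)
  next
    fix n :: int assume "n < 0"
    have "n \<le> - int p" if "int p dvd n"
      using that \<open>n < 0\<close> zdvd_imp_le[of "int p" "- n"] by simp
    thus "(if int p dvd n then of_nat p * fls_nth (ev k j \<Psi>) n else 0) = (1 + (- 1)) * fls_nth (ev k j \<Psi>) n"
      using F0 by (simp add: ev)
  qed
  thus ?thesis unfolding ev ev0 using j by (simp add: k_def)
qed

text \<open>The divided difference (A(x) - A(w)) / (x - w) of the polynomial A, written without
  division.\<close>

definition quot :: "complex \<Rightarrow> complex \<Rightarrow> complex" where
  "quot x w = (\<Sum>j<p. of_int (Acoeff (Suc j)) * (\<Sum>i<Suc j. w ^ (j - i) * x ^ i))"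

lemma ev_Acoeff_diff: "ev Acoeff p x - ev Acoeff p w = (x - w) * quot x w" for x w :: complex
proof -
  have "ev Acoeff p y = of_int (Acoeff 0) + (\<Sum>j<p. of_int (Acoeff (Suc j)) * y ^ Suc j)" for y :: complex
    unfolding ev_def lessThan_Suc_atMost [symmetric] by (subst sum.lessThan_Suc_shift) simp
  hence "ev Acoeff p x - ev Acoeff p w = (\<Sum>j<p. of_int (Acoeff (Suc j)) * (x ^ Suc j - w ^ Suc j))"
    by (simp add: sum_subtractf [symmetric] right_diff_distrib del: power_Suc)
  also have "\<dots> = (\<Sum>j<p. of_int (Acoeff (Suc j)) * ((x - w) * (\<Sum>i<Suc j. w ^ (j - i) * x ^ i)))"
    by (intro sum.cong refl arg_cong2[of _ _ _ _ "(*)"]) (simp only: power_diff_sumr2 diff_Suc_Suc)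
  also have "\<dots> = (x - w) * quot x w"
    unfolding quot_def sum_distrib_left by (intro sum.cong refl) (simp only: mult_ac sum_distrib_left)
  finally show ?thesis .
qed

text \<open>Both sides are j(p z) up to the same constant, expressed by the Hauptmodul at z and at p
  z. Instead of working with j, the proof computes U of A(\<psi>) and inserts the result into the
  S-invariance of the trace.\<close>

lemma modular_equation_aux:
  assumes z: "z \<in> \<H>"
  shows "v z + ev Acoeff p (\<psi> z) = \<psi> (of_nat p * z) + ev Acoeff p (v (of_nat p * z))"
proof -
  define l where "l = (\<lambda>i. if i = Suc 0 then int p else 0)"
  have ev: "ev l (Suc 0) x = of_nat p * x" for x :: "'a :: comm_ring_1" by (simp add: ev_def l_def)
  define F where "F = ev Acoeff p \<Psi>"
  define K where "K = of_nat p * fls_nth F 0 - of_nat p * fls_nth \<Psi> 0"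
  have A0: "Acoeff 0 = 0" by (simp add: Acoeff_def)
  have F: "fls_nth F n = (if n = - int p then 1 else 0)" if "n < 0" for n
    unfolding F_def by (rule ev_Acoeff_Psi_nth[OF that])
  have U: "of_nat p * hecke_U p (\<lambda>z. ev Acoeff p (\<psi> z)) z =
      ev l (Suc 0) (\<psi> z) + (of_nat p - 1) * (ev Acoeff p (v z) - of_int (Acoeff 0)) + K" if z: "z \<in> \<H>" for z
  proof (rule U_ev_psi[OF _ _ z])
    fix n :: int assume n: "n \<le> 0"
    have G: "fls_nth (ev l (Suc 0) \<Psi>) n = of_nat p * fls_nth \<Psi> n"
      unfolding ev by (simp add: fls_of_nat)
    show "of_nat p * fls_nth (ev Acoeff p \<Psi>) (int p * n) = fls_nth (ev l (Suc 0) \<Psi>) n + (if n = 0 then K else 0)"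
    proof (cases "n = 0")
      case False
      hence "int p * n < 0" using n by (simp add: mult_less_0_iff)
      moreover have "int p * n = int p * (- 1) \<longleftrightarrow> n = - 1" by (simp only: mult_cancel_left) simp
      ultimately have "fls_nth (ev Acoeff p \<Psi>) (int p * n) = (if n = - 1 then 1 else 0)"
        using F[of "int p * n"] by (simp add: F_def)
      thus ?thesis using False n Psi_nth_eq_0[of n] Psi_nth_lead unfolding G by auto
    qed (use G in \<open>simp add: K_def F_def\<close>)
  next
    fix n :: int assume n: "n < 0"
    show "(if int p dvd n then of_nat p * fls_nth (ev Acoeff p \<Psi>) n else 0) = (1 + (of_nat p - 1)) * fls_nth (ev Acoeff p \<Psi>) n"
      using F[OF n] by (simp add: F_def)
  qed
  have pz: "of_nat p * z \<in> \<H>" "- 1 / (of_nat p * z) \<in> \<H>"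
    using z of_nat_in_H(1) fricke_in_H(1) by auto
  have "of_nat p * (v z + ev Acoeff p (\<psi> z)) = of_nat p * (\<psi> (of_nat p * z) + ev Acoeff p (v (of_nat p * z)))"
    using hecke_U_ev_fricke[OF z, of Acoeff p] unfolding U[OF pz(1)] U[OF pz(2)] ev psi_fricke'[OF z] v_fricke[OF z]
    by (simp add: A0 algebra_simps)
  thus ?thesis by simp
qed

text \<open>\<open>modular_equation_aux\<close> amounts to this equation multiplied by \<psi>(z) -
  v(p z). As that factor is not known to be nonzero at every point, it is cancelled in the integral
  domain of Laurent series.\<close>

theorem modular_equation:
  assumes z: "z \<in> \<H>"
  shows "\<psi> (of_nat p * z) = \<psi> z * quot (\<psi> z) (v (of_nat p * z))"
proof -
  define D1 D2 where "D1 = (\<lambda>z. \<psi> z - v (of_nat p * z))"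
    and "D2 = (\<lambda>z. quot (\<psi> z) (v (of_nat p * z)) - \<psi> (of_nat p * z) * (1 / \<psi> z))"
  have D: "D1 z * D2 z = 0" if z: "z \<in> \<H>" for z
  proof -
    have pz: "of_nat p * z \<in> \<H>" using z by (intro of_nat_in_H) auto
    have nz: "\<psi> z \<noteq> 0" "\<psi> (of_nat p * z) \<noteq> 0" using psi_nonzero z pz by auto
    have "D1 z * D2 z = (ev Acoeff p (\<psi> z) - ev Acoeff p (v (of_nat p * z))) -
        (\<psi> z - v (of_nat p * z)) * (\<psi> (of_nat p * z) * (1 / \<psi> z))"
      unfolding ev_Acoeff_diff by (simp add: D1_def D2_def algebra_simps)
    also have "ev Acoeff p (\<psi> z) - ev Acoeff p (v (of_nat p * z)) = \<psi> (of_nat p * z) - v z"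
      using modular_equation_aux[OF z] by (simp add: algebra_simps)
    also have "(\<psi> z - v (of_nat p * z)) * (\<psi> (of_nat p * z) * (1 / \<psi> z)) = \<psi> (of_nat p * z) - v z"
      using nz by (simp add: v_def field_simps)
    finally show ?thesis by simp
  qed
  have qv: "qexp (\<lambda>z. v (of_nat p * z)) (fls_compose_power (fls_const \<kappa> * \<Phi>) p)"
    by (rule qexp_V[OF qexp_v p_pos])
  define F1 where "F1 = \<Psi> - fls_compose_power (fls_const \<kappa> * \<Phi>) p"
  have q1: "qexp D1 F1" unfolding D1_def F1_def by (intro qexp_diff qexp_psi qv)
  define F2 where "F2 = (\<Sum>j<p. fls_const (of_int (Acoeff (Suc j))) *
      (\<Sum>i<Suc j. fls_compose_power (fls_const \<kappa> * \<Phi>) p ^ (j - i) * \<Psi> ^ i)) - fls_compose_power \<Psi> p * \<Phi>"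
  have q2: "qexp D2 F2"
    unfolding D2_def quot_def F2_def
    by (intro qexp_diff qexp_sum qexp_mult qexp_power qexp_const qv qexp_psi qexp_phi qexp_V[OF qexp_psi p_pos])
  have "F1 * F2 = 0"
    using qexp_unique[OF qexp_mult[OF q1 q2] qexp_const[of 0]] D by simp
  moreover have "F1 \<noteq> 0"
  proof
    \<comment> \<open>The subtracted series has only exponents divisible by p, so the pole of \<Psi>
      survives in F1.\<close>
    have "\<not> int p dvd - 1" using params by auto
    hence "fls_nth F1 (- 1) = 1" by (simp add: F1_def fls_nth_compose_power Psi_nth_lead)
    moreover assume "F1 = 0"
    ultimately show False by simp
  qed
  ultimately have "F2 = 0" by simp
  hence "D2 z = 0" using q2 z qexp_0_imp by blast
  thus ?thesis using psi_nonzero[OF z] by (simp add: D2_def field_simps)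
qed

end

subsection \<open>Integral lattices of polynomials\<close>

text \<open>The functions on the upper half-plane that lie in \<open>M t\<^sup>k \<int>[t]\<close>.\<close>
inductive_set pspan :: "(complex \<Rightarrow> complex) \<Rightarrow> nat \<Rightarrow> int \<Rightarrow> (complex \<Rightarrow> complex) set"
  for t :: "complex \<Rightarrow> complex" and k :: nat and M :: int where
  zero: "(\<lambda>_. 0) \<in> pspan t k M"
| mono: "j \<ge> k \<Longrightarrow> (\<lambda>z. of_int (M * d) * t z ^ j) \<in> pspan t k M"
| add: "f \<in> pspan t k M \<Longrightarrow> g \<in> pspan t k M \<Longrightarrow> (\<lambda>z. f z + g z) \<in> pspan t k M"
| cong: "f \<in> pspan t k M \<Longrightarrow> (\<And>z. z \<in> \<H> \<Longrightarrow> g z = f z) \<Longrightarrow> g \<in> pspan t k M"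

lemma pspan_mono:
  assumes "f \<in> pspan t k M" "M' dvd M" "k' \<le> k"
  shows "f \<in> pspan t k' M'"
  using assms(1)
proof induction
  case (mono j d)
  obtain r where "M = M' * r" using assms(2) by blast
  thus ?case using pspan.mono[where k = k' and j = j and t = t and M = M' and d = "r * d"] mono assms(3) by (simp add: mult.assoc)
qed (use pspan.zero pspan.add pspan.cong in \<open>blast+\<close>)

lemma pspan_mult:
  assumes "f \<in> pspan t k M" "g \<in> pspan t k' M'"
  shows "(\<lambda>z. f z * g z) \<in> pspan t (k + k') (M * M')"
  using assms(1)
proof induction
  case zero
  show ?case using pspan.zero by simp
next
  case (add f1 f2)
  thus ?case using pspan.add[of "\<lambda>z. f1 z * g z" t "k + k'" "M * M'" "\<lambda>z. f2 z * g z"] by (simp add: ring_distribs)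
next
  case (cong f h)
  show ?case by (rule pspan.cong[OF cong.IH]) (simp add: cong.hyps)
next
  case (mono j d)
  show ?case using assms(2)
  proof induction
    case zero
    show ?case using pspan.zero by simp
  next
    case (add f1 f2)
    thus ?case
      using pspan.add[of "\<lambda>z. of_int (M * d) * t z ^ j * f1 z" t "k + k'" "M * M'" "\<lambda>z. of_int (M * d) * t z ^ j * f2 z"]
      by (simp add: ring_distribs)
  next
    case (cong f h)
    show ?case by (rule pspan.cong[OF cong.IH]) (simp add: cong.hyps)
  next
    case (mono i b)
    have "k + k' \<le> j + i" using mono \<open>k \<le> j\<close> by simp
    from pspan.mono[OF this, where t = t and M = "M * M'" and d = "d * b"] show ?case
      by (simp add: power_add mult_ac)
  qed
qed

lemma pspan_of_int: "(\<lambda>_. of_int (M * d)) \<in> pspan t 0 M"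
  using pspan.mono[where k = 0 and j = 0 and t = t and M = M and d = d] by simp

lemma pspan_self: "t \<in> pspan t 1 1"
  using pspan.mono[where k = 1 and j = 1 and t = t and M = 1 and d = 1] by simp

lemma pspan_cmult:
  assumes "f \<in> pspan t k M"
  shows "(\<lambda>z. of_int r * f z) \<in> pspan t k (r * M)"
  using pspan_mult[OF pspan_of_int[of r 1 t] assms] by simp

lemma pspan_int_mult: "f \<in> pspan t k M \<Longrightarrow> (\<lambda>z. of_int r * f z) \<in> pspan t k M"
  using pspan_mono[OF pspan_cmult[of f t k M r], of M k] by simp

lemma pspan_diff: "f \<in> pspan t k M \<Longrightarrow> g \<in> pspan t k M \<Longrightarrow> (\<lambda>z. f z - g z) \<in> pspan t k M"
  using pspan.add[OF _ pspan_int_mult[of g t k M "- 1"], of f] by simp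

lemma pspan_sum:
  "(\<And>i. i \<in> A \<Longrightarrow> f i \<in> pspan t k M) \<Longrightarrow> (\<lambda>z. \<Sum>i\<in>A. f i z) \<in> pspan t k M"
  by (induction A rule: infinite_finite_induct) (auto intro: pspan.zero pspan.add)

lemma pspan_power: "f \<in> pspan t 0 1 \<Longrightarrow> (\<lambda>z. f z ^ n) \<in> pspan t 0 1"
proof (induction n)
  case 0
  show ?case using pspan_of_int[of 1 1 t] by simp
next
  case (Suc n)
  thus ?case using pspan_mult[OF Suc.prems Suc.IH] by simp
qed

lemma pspan_divide:
  assumes "f \<in> pspan t k (r * M)" "r \<noteq> 0"
  shows "(\<lambda>z. f z / of_int r) \<in> pspan t k M"
  using assms(1)
proof induction
  case zero
  show ?case using pspan.zero by simp
next
  case (mono j d)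
  thus ?case using pspan.mono[OF mono, where t = t and M = M and d = d] assms(2) by (simp add: mult.assoc)
next
  case (add f g)
  thus ?case using pspan.add[OF add.IH] by (simp add: add_divide_distrib)
next
  case (cong f g)
  show ?case by (rule pspan.cong[OF cong.IH]) (simp add: cong.hyps)
qed

lemma hecke_U_cong: "(\<And>z. z \<in> \<H> \<Longrightarrow> g z = f z) \<Longrightarrow> p > 0 \<Longrightarrow> z \<in> \<H> \<Longrightarrow> hecke_U p g z = hecke_U p f z"
  unfolding hecke_U_def by (intro arg_cong2[of _ _ _ _ "(/)"] sum.cong refl) (simp add: of_nat_in_H)

lemma hecke_U_add: "hecke_U p (\<lambda>z. f z + g z) z = hecke_U p f z + hecke_U p g z"
  by (simp add: hecke_U_def sum.distrib add_divide_distrib)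

lemma hecke_U_cmult: "hecke_U p (\<lambda>z. r * f z) z = r * hecke_U p f z"
  by (simp add: hecke_U_def sum_distrib_left)

section \<open>Divisibility of U on powers of t\<close>

context genus_zero_level
begin

definition t :: "complex \<Rightarrow> complex" where "t z = of_nat p ^ a / \<psi> z"

lemma exponents: "a \<le> 3 * e" "c < a" "a < 3 * e"
  using params by auto

lemma v_eq_t: "v z = of_int (int p ^ (3 * e - a)) * t z"
proof -
  have "(of_nat p :: complex) ^ (3 * e) = of_nat p ^ (3 * e - a) * of_nat p ^ a"
    using exponents by (simp add: power_add [symmetric])
  thus ?thesis by (simp add: v_def t_def \<kappa>_def)
qed

lemma psi_add_nat: "z \<in> \<H> \<Longrightarrow> \<psi> (z + of_nat n) = \<psi> z"
  using periodic_on_H[of \<psi> 1 z "int n"] psi_add_1 by simp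

lemma v_pspan: "v \<in> pspan t 1 (int p)"
proof -
  have "v \<in> pspan t 1 (int p ^ (3 * e - a) * 1)"
    unfolding v_eq_t[abs_def] by (rule pspan_cmult[OF pspan_self])
  thus ?thesis by (rule pspan_mono) (use exponents in auto)
qed

lemma v_pspan_0: "v \<in> pspan t 0 1"
  by (rule pspan_mono[OF v_pspan]) auto

lemma U_psi_power_pspan:
  assumes "1 \<le> j" "j < p"
  shows "(\<lambda>z. of_nat p * hecke_U p (\<lambda>z. \<psi> z ^ j) z) \<in> pspan t 0 (int p)"
proof -
  obtain k where k: "fls_nth (\<Psi> ^ j) 0 = of_int k"
    using int_fls_nth[OF int_fls_power[OF int_Psi], of j 0] by (auto elim: Ints_cases)
  have "(\<lambda>z. v z * v z ^ (j - 1)) \<in> pspan t 0 (int p)"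
    by (rule pspan_mono[OF pspan_mult[OF v_pspan pspan_power[OF v_pspan_0]]]) auto
  moreover have "v z * v z ^ (j - 1) = v z ^ j" for z using assms by (cases j) auto
  ultimately have "(\<lambda>z. v z ^ j) \<in> pspan t 0 (int p)" by (simp only:)
  from pspan_diff[OF pspan_of_int this, of k] show ?thesis
    by (rule pspan.cong) (simp add: U_psi_power[OF assms] k)
qed

text \<open>On \<H> this is p^(1-a) U(\<psi>^(i+1) t^l). As \<psi> t = p^a, the product is a
  multiple of a power of t, of 1 or of a power of \<psi>, depending on the sign of l - i - 1; the
  factor p^(-a) is already cancelled, so no division occurs.\<close>

definition Uterm :: "nat \<Rightarrow> nat \<Rightarrow> complex \<Rightarrow> complex" where
  "Uterm l i z = (if Suc i < l then of_nat p ^ (a * i) * (of_nat p * hecke_U p (\<lambda>z. t z ^ (l - Suc i)) z)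
     else if Suc i = l then of_nat p ^ (a * i) * of_nat p
     else of_nat p ^ (a * (l - 1)) * (of_nat p * hecke_U p (\<lambda>z. \<psi> z ^ (Suc i - l)) z))"

text \<open>Multiply the modular equation by \<open>t\<^sup>l\<close> and apply \<open>U\<close>, which commutes with functions of \<open>p z\<close>.\<close>
lemma U_t_power:
  assumes z: "z \<in> \<H>" and l: "l \<ge> 1"
  shows "of_nat p * hecke_U p (\<lambda>z. t z ^ l) z =
    t z * (\<Sum>j<p. of_int (Acoeff (Suc j)) * (\<Sum>i<Suc j. v z ^ (j - i) * Uterm l i z))"
proof -
  define w where "w = (\<lambda>s :: nat. (z + of_nat s) / of_nat p)"
  have w: "w s \<in> \<H>" for s unfolding w_def using z by (intro of_nat_in_H) auto
  \<comment> \<open>Here p w(s) = z + s, so periodicity takes all functions of p w(s) out of the sum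
    over s.\<close>
  have pw: "\<psi> (of_nat p * w s) = \<psi> z" for s using psi_add_nat[OF z] by (simp add: w_def)
  hence vw: "v (of_nat p * w s) = v z" for s by (simp add: v_def)
  have U: "of_nat p * hecke_U p g z = (\<Sum>s<p. g (w s))" for g by (simp add: hecke_U_def w_def)
  have P: "of_nat p ^ a \<noteq> (0 :: complex)" by simp
  have trm: "(\<Sum>s<p. \<psi> (w s) ^ Suc i * t (w s) ^ l) = of_nat p ^ a * Uterm l i z" for i
  proof -
    have pt: "\<psi> y * t y = of_nat p ^ a" if "y \<in> \<H>" for y using psi_nonzero[OF that] by (simp add: t_def)
    consider "Suc i < l" | "Suc i = l" | "Suc i > l" by linarith
    thus ?thesis
    proof cases
      case 1
      have "\<psi> y ^ Suc i * t y ^ l = of_nat p ^ (a * Suc i) * t y ^ (l - Suc i)" if "y \<in> \<H>" for y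
      proof -
        have "t y ^ l = t y ^ Suc i * t y ^ (l - Suc i)" using 1 by (simp only: power_add [symmetric]) simp
        hence "\<psi> y ^ Suc i * t y ^ l = (\<psi> y * t y) ^ Suc i * t y ^ (l - Suc i)"
          by (simp only: power_mult_distrib mult.assoc)
        thus ?thesis unfolding pt[OF that] by (simp only: power_mult)
      qed
      thus ?thesis using 1 w by (simp add: Uterm_def U sum_distrib_left power_add mult_ac)
    next
      case 2
      have "\<psi> y ^ Suc i * t y ^ l = of_nat p ^ (a * Suc i)" if "y \<in> \<H>" for y
        unfolding 2 power_mult_distrib [symmetric] pt[OF that] by (simp only: power_mult)
      hence "(\<Sum>s<p. \<psi> (w s) ^ Suc i * t (w s) ^ l) = of_nat p * of_nat p ^ (a * Suc i)" using w by simp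
      also have "\<dots> = of_nat p ^ a * Uterm l i z" by (simp add: Uterm_def power_add 2 [symmetric])
      finally show ?thesis .
    next
      case 3
      have "\<psi> y ^ Suc i * t y ^ l = of_nat p ^ (a * l) * \<psi> y ^ (Suc i - l)" if "y \<in> \<H>" for y
      proof -
        have "\<psi> y ^ Suc i = \<psi> y ^ l * \<psi> y ^ (Suc i - l)" using 3 by (simp only: power_add [symmetric]) simp
        hence "\<psi> y ^ Suc i * t y ^ l = (\<psi> y * t y) ^ l * \<psi> y ^ (Suc i - l)"
          by (simp only: power_mult_distrib mult_ac)
        thus ?thesis unfolding pt[OF that] by (simp only: power_mult)
      qed
      moreover have "a * l = a + a * (l - 1)" using l by (cases l) auto
      ultimately show ?thesis using 3 w by (simp add: Uterm_def U sum_distrib_left power_add mult_ac)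
    qed
  qed
  have "of_nat p ^ a * (of_nat p * hecke_U p (\<lambda>z. t z ^ l) z) =
      t z * (\<Sum>s<p. \<psi> z * t (w s) ^ l)"
    using psi_nonzero[OF z] by (simp add: U t_def sum_distrib_left)
  also have "(\<Sum>s<p. \<psi> z * t (w s) ^ l) =
      (\<Sum>s<p. \<Sum>j<p. \<Sum>i<Suc j. of_int (Acoeff (Suc j)) * v z ^ (j - i) * (\<psi> (w s) ^ Suc i * t (w s) ^ l))"
  proof (intro sum.cong refl)
    fix s
    have "\<psi> z = \<psi> (w s) * quot (\<psi> (w s)) (v z)"
      using modular_equation[OF w, of s] by (simp only: pw vw)
    hence "\<psi> z * t (w s) ^ l = \<psi> (w s) * quot (\<psi> (w s)) (v z) * t (w s) ^ l" by simp
    thus "\<psi> z * t (w s) ^ l = (\<Sum>j<p. \<Sum>i<Suc j. of_int (Acoeff (Suc j)) * v z ^ (j - i) * (\<psi> (w s) ^ Suc i * t (w s) ^ l))"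
      by (simp only: quot_def sum_distrib_left sum_distrib_right power_Suc mult_ac)
  qed
  also have "\<dots> = (\<Sum>j<p. \<Sum>i<Suc j. \<Sum>s<p. of_int (Acoeff (Suc j)) * v z ^ (j - i) * (\<psi> (w s) ^ Suc i * t (w s) ^ l))"
    by (rule trans[OF sum.swap]) (intro sum.cong refl sum.swap)
  also have "\<dots> = (\<Sum>j<p. \<Sum>i<Suc j. of_int (Acoeff (Suc j)) * v z ^ (j - i) * (of_nat p ^ a * Uterm l i z))"
    unfolding sum_distrib_left [symmetric] trm ..
  also have "\<dots> = of_nat p ^ a * (\<Sum>j<p. of_int (Acoeff (Suc j)) * (\<Sum>i<Suc j. v z ^ (j - i) * Uterm l i z))"
    by (simp only: sum_distrib_left mult_ac)
  finally have "of_nat p ^ a * (of_nat p * hecke_U p (\<lambda>z. t z ^ l) z) = of_nat p ^ a *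
      (t z * (\<Sum>j<p. of_int (Acoeff (Suc j)) * (\<Sum>i<Suc j. v z ^ (j - i) * Uterm l i z)))"
    by (simp only: mult_ac)
  thus ?thesis using P by (simp only: mult_cancel_left) simp
qed

text \<open>The explicit constant terms of \<psi>^i reduce the double sum to t A(v)/v. The lists d
  are the coefficients of A(v)/v as a polynomial in t, divided by p^(c+1).\<close>

lemma U_t_pspan: "(\<lambda>z. of_nat p * hecke_U p (\<lambda>z. t z ^ 1) z) \<in> pspan t 1 (int p ^ Suc c)"
proof -
  have Up: "of_nat p * hecke_U p (\<lambda>z. t z ^ 1) z =
    t z * (\<Sum>j<p. of_int (Acoeff (Suc j)) * (\<Sum>i<Suc j. v z ^ (j - i) *
       (if i = 0 then of_nat p else of_nat p * fls_nth (\<Psi> ^ i) 0 - v z ^ i)))" if "z \<in> \<H>" for z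
  proof -
    have "Uterm 1 i z = (if i = 0 then of_nat p else of_nat p * fls_nth (\<Psi> ^ i) 0 - v z ^ i)" if "i < p" for i
      using that U_psi_power[OF _ that \<open>z \<in> \<H>\<close>] by (simp add: Uterm_def)
    thus ?thesis unfolding U_t_power[OF that order.refl] by (intro arg_cong2[of _ _ _ _ "(*)"] sum.cong refl) auto
  qed
  have poly: "(\<lambda>z. t z * (\<Sum>i<n. of_int (M * d i) * t z ^ i)) \<in> pspan t 1 M" for d n M
  proof -
    have "(\<lambda>z. t z * (\<Sum>i<n. of_int (M * d i) * t z ^ i)) \<in> pspan t (1 + 0) (1 * M)"
      by (intro pspan_mult pspan_self pspan_sum pspan.mono) simp
    thus ?thesis by simp
  qed
  have sums: "(\<Sum>i<Suc 0. G i) = G 0" "(\<Sum>i<Suc 1. G i) = G 0 + G 1" "(\<Sum>i<Suc 2. G i) = G 0 + G 1 + G 2"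
    "(\<Sum>i<Suc 3. G i) = G 0 + G 1 + G 2 + G 3" "(\<Sum>i<Suc 4. G i) = G 0 + G 1 + G 2 + G 3 + G 4" for G :: "nat \<Rightarrow> complex"
    by (simp_all add: eval_nat_numeral)
  have pSuc: "p = 2 \<Longrightarrow> {..<p} = {..<Suc 1}" "p = 3 \<Longrightarrow> {..<p} = {..<Suc 2}" "p = 5 \<Longrightarrow> {..<p} = {..<Suc 4}"
    by simp_all
  from params consider "p = 2" "e = 4" "a = 8" "c = 3" | "p = 3" "e = 2" "a = 4" "c = 2" | "p = 5" "e = 1" "a = 2" "c = 1"
    by auto
  thus ?thesis
  proof cases
    case 1
    define d :: "nat \<Rightarrow> int" where "d = (\<lambda>i. [3, 1] ! i)"
    have v: "v z = 16 * t z" for z unfolding v_eq_t using 1 by simp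
    have M: "int p ^ Suc c = 16" and pc: "(of_nat p :: complex) = 2" using 1 by simp_all
    have A: "Acoeff (Suc 0) = 48" "Acoeff (Suc 1) = 1" unfolding Acoeff_def using 1 by simp_all
    note K = Psi_power_const_term(1)[OF 1(1)]
    show ?thesis unfolding M
    proof (rule pspan.cong[OF poly[of 16 d "Suc 1"]])
      fix z assume z: "z \<in> \<H>"
      show "of_nat p * hecke_U p (\<lambda>z. t z ^ 1) z = t z * (\<Sum>i<Suc 1. of_int (16 * d i) * t z ^ i)"
        unfolding Up[OF z] v pSuc(1)[OF 1(1)] unfolding sums A K pc d_def
        by (simp add: algebra_simps)
    qed
  next
    case 2
    define d :: "nat \<Rightarrow> int" where "d = (\<lambda>i. [10, 12, 3] ! i)"
    have v: "v z = 9 * t z" for z unfolding v_eq_t using 2 by simp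
    have M: "int p ^ Suc c = 27" and pc: "(of_nat p :: complex) = 3" using 2 by simp_all
    have A: "Acoeff (Suc 0) = 270" "Acoeff (Suc 1) = 36" "Acoeff (Suc 2) = 1" unfolding Acoeff_def using 2 by simp_all
    note K = Psi_power_const_term(2,3)[OF 2(1)]
    show ?thesis unfolding M
    proof (rule pspan.cong[OF poly[of 27 d "Suc 2"]])
      fix z assume z: "z \<in> \<H>"
      show "of_nat p * hecke_U p (\<lambda>z. t z ^ 1) z = t z * (\<Sum>i<Suc 2. of_int (27 * d i) * t z ^ i)"
        unfolding Up[OF z] v pSuc(2)[OF 2(1)] unfolding sums A K pc d_def
        by (simp add: algebra_simps power2_eq_square)
    qed
  next
    case 3
    define d :: "nat \<Rightarrow> int" where "d = (\<lambda>i. [63, 260, 315, 150, 25] ! i)"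
    have v: "v z = 5 * t z" for z unfolding v_eq_t using 3 by simp
    have M: "int p ^ Suc c = 25" and pc: "(of_nat p :: complex) = 5" using 3 by simp_all
    have A: "Acoeff (Suc 0) = 1575" "Acoeff (Suc 1) = 1300" "Acoeff (Suc 2) = 315" "Acoeff (Suc 3) = 30"
      "Acoeff (Suc 4) = 1" unfolding Acoeff_def using 3 by simp_all
    note K = Psi_power_const_term(4-7)[OF 3(1)]
    show ?thesis unfolding M
    proof (rule pspan.cong[OF poly[of 25 d "Suc 4"]])
      fix z assume z: "z \<in> \<H>"
      show "of_nat p * hecke_U p (\<lambda>z. t z ^ 1) z = t z * (\<Sum>i<Suc 4. of_int (25 * d i) * t z ^ i)"
        unfolding Up[OF z] v pSuc(3)[OF 3(1)] unfolding sums A K pc d_def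
        by (simp add: algebra_simps power_mult_distrib power2_eq_square power3_eq_cube power4_eq_xxxx)
    qed
  qed
qed

end

context genus_zero_level
begin

text \<open>For l \<ge> 2 each \<open>Uterm\<close> is divisible by p^(c+1) on its own, either by
  induction or through a factor p^a, as a \<ge> c + 1. For l = 1 and i = 0 it is merely p, and the
  divisibility has to come from the coefficients of A.\<close>

lemma U_t_power_pspan:
  "l \<ge> 1 \<Longrightarrow> (\<lambda>z. of_nat p * hecke_U p (\<lambda>z. t z ^ l) z) \<in> pspan t 1 (int p ^ Suc c)"
proof (induction l rule: less_induct)
  case (less l)
  show ?case
  proof (cases "l = 1")
    case True
    thus ?thesis using U_t_pspan by simp
  next
    case False
    have ca: "Suc c \<le> a" using exponents by simp
    have Y: "Uterm l i \<in> pspan t 0 (int p ^ Suc c)" if "i < p" for i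
    proof -
      consider "Suc i < l" | "Suc i = l" | "Suc i > l" by linarith
      thus ?thesis
      proof cases
        case 1
        have "(\<lambda>z. of_nat p * hecke_U p (\<lambda>z. t z ^ (l - Suc i)) z) \<in> pspan t 0 (int p ^ Suc c)"
          using 1 by (intro pspan_mono[OF less.IH]) auto
        from pspan_int_mult[OF this, of "int p ^ (a * i)"] show ?thesis
          by (rule pspan.cong) (use 1 in \<open>simp add: Uterm_def\<close>)
      next
        case 2
        have "a * 1 \<le> a * i" using 2 False by (intro mult_left_mono) auto
        hence "Suc c \<le> a * i" using ca by linarith
        hence "int p ^ Suc c dvd int p ^ (a * i)" by (intro le_imp_power_dvd)
        hence "(\<lambda>_. of_int (int p ^ (a * i) * int p)) \<in> pspan t 0 (int p ^ Suc c)"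
          by (intro pspan_mono[OF pspan_of_int]) auto
        thus ?thesis by (rule pspan.cong) (use 2 in \<open>simp add: Uterm_def\<close>)
      next
        case 3
        have j: "1 \<le> Suc i - l" "Suc i - l < p" using 3 that less.prems by auto
        have "a * 1 \<le> a * (l - 1)" using less.prems False by (intro mult_left_mono) auto
        hence "Suc c \<le> a * (l - 1)" using ca by linarith
        hence "int p ^ Suc c dvd int p ^ (a * (l - 1))" by (intro le_imp_power_dvd)
        hence "(\<lambda>z. of_int (int p ^ (a * (l - 1))) * (of_nat p * hecke_U p (\<lambda>z. \<psi> z ^ (Suc i - l)) z)) \<in> pspan t 0 (int p ^ Suc c)"
          by (intro pspan_mono[OF pspan_cmult[OF U_psi_power_pspan[OF j]]]) auto
        thus ?thesis by (rule pspan.cong) (use 3 in \<open>simp add: Uterm_def\<close>)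
      qed
    qed
    have T: "(\<lambda>z. v z ^ (j - i) * Uterm l i z) \<in> pspan t 0 (int p ^ Suc c)" if "i < p" for i j
      using pspan_mult[OF pspan_power[OF v_pspan_0] Y[OF that]] by simp
    have "(\<lambda>z. \<Sum>j<p. of_int (Acoeff (Suc j)) * (\<Sum>i<Suc j. v z ^ (j - i) * Uterm l i z)) \<in> pspan t 0 (int p ^ Suc c)"
    proof (rule pspan_sum, rule pspan_int_mult, rule pspan_sum)
      fix j i assume "j \<in> {..<p}" "i \<in> {..<Suc j}"
      thus "(\<lambda>z. v z ^ (j - i) * Uterm l i z) \<in> pspan t 0 (int p ^ Suc c)" by (intro T) auto
    qed
    from pspan_mult[OF pspan_self this] have
      "(\<lambda>z. t z * (\<Sum>j<p. of_int (Acoeff (Suc j)) * (\<Sum>i<Suc j. v z ^ (j - i) * Uterm l i z))) \<in> pspan t 1 (int p ^ Suc c)"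
      by simp
    thus ?thesis by (rule pspan.cong) (rule U_t_power[OF _ less.prems])
  qed
qed

lemma U_pspan:
  assumes "f \<in> pspan t 1 M"
  shows "hecke_U p f \<in> pspan t 1 (int p ^ c * M)"
  using assms
proof induction
  case zero
  have "hecke_U p (\<lambda>_. 0) = (\<lambda>_. 0)" by (simp add: hecke_U_def fun_eq_iff)
  thus ?case using pspan.zero by simp
next
  case (add f g)
  show ?case by (rule pspan.cong[OF pspan.add[OF add.IH]]) (rule hecke_U_add)
next
  case (cong f g)
  show ?case by (rule pspan.cong[OF cong.IH]) (rule hecke_U_cong[OF cong.hyps(2)], auto)
next
  case (mono j d)
  have "(\<lambda>z. of_nat p * hecke_U p (\<lambda>z. t z ^ j) z) \<in> pspan t 1 (int p * int p ^ c)"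
    using U_t_power_pspan[of j] mono by simp
  hence "(\<lambda>z. of_nat p * hecke_U p (\<lambda>z. t z ^ j) z / of_int (int p)) \<in> pspan t 1 (int p ^ c)"
    by (rule pspan_divide) auto
  hence "(\<lambda>z. hecke_U p (\<lambda>z. t z ^ j) z) \<in> pspan t 1 (int p ^ c)" by simp
  hence "(\<lambda>z. of_int (M * d) * hecke_U p (\<lambda>z. t z ^ j) z) \<in> pspan t 1 (int p ^ c * M)"
    by (intro pspan_mono[OF pspan_cmult]) auto
  thus ?case by (rule pspan.cong) (rule hecke_U_cmult)
qed

lemma U_iter_pspan: "f \<in> pspan t 1 M \<Longrightarrow> (hecke_U p ^^ n) f \<in> pspan t 1 (int p ^ (c * n) * M)"
proof (induction n)
  case (Suc n)
  have e: "int p ^ c * (int p ^ (c * n) * M) = int p ^ (c * Suc n) * M" by (simp add: power_add)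
  show ?case using U_pspan[OF Suc.IH[OF Suc.prems]] unfolding e by simp
qed simp

section \<open>Iterating U on the canonical basis\<close>

lemma ev_v_pspan: "(\<lambda>z. ev k m (v z) - of_int (k 0)) \<in> pspan t 1 (int p ^ (3 * e - a))"
proof -
  have 1: "(\<lambda>z. of_int (k (Suc j)) * v z ^ Suc j) \<in> pspan t 1 (int p ^ (3 * e - a))" for j
  proof -
    have "v \<in> pspan t 1 (int p ^ (3 * e - a) * 1)"
      unfolding v_eq_t[abs_def] by (rule pspan_cmult[OF pspan_self])
    from pspan_mult[OF this pspan_power[OF v_pspan_0, of j]]
    have "(\<lambda>z. v z * v z ^ j) \<in> pspan t 1 (int p ^ (3 * e - a))" by simp
    from pspan_int_mult[OF this, of "k (Suc j)"] show ?thesis by simp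
  qed
  have "ev k m x - of_int (k 0) = (\<Sum>j<m. of_int (k (Suc j)) * x ^ Suc j)" for x :: complex
    unfolding ev_def lessThan_Suc_atMost [symmetric] by (subst sum.lessThan_Suc_shift) simp
  thus ?thesis using pspan_sum[OF 1, of "\<lambda>j. j" "{..<m}"] by simp
qed

text \<open>The deviation of U f_m from f_(m/p). By the trace formula it is a polynomial in v
  without constant term, which is what lets further applications of U gain powers of p.\<close>

definition Qfun :: "nat \<Rightarrow> complex \<Rightarrow> complex" where
  "Qfun m z = hecke_U p (bfun m) z - (if p dvd m then bfun (m div p) z else 0)"

text \<open>Each v contributes p^(3e-a), and one power of p is lost because the trace formula
  computes p U. The factor r is p - 1 or -1 according to whether p divides m.\<close>

lemma Qfun_pspan:
  assumes m: "m \<ge> 1"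
  shows "Qfun m \<in> pspan t 1 (int p ^ (3 * e - a - 1))"
proof -
  define r :: int where "r = (if p dvd m then int p else 0) - 1"
  define l where "l = (if p dvd m then (\<lambda>i. int p * bcoeff (m div p) i) else (\<lambda>_. 0))"
  have evl: "ev l (m div p) x = (if p dvd m then of_nat p * ev (bcoeff (m div p)) (m div p) x else 0)" for x :: "'a :: comm_ring_1"
    by (simp add: ev_def l_def sum_distrib_left mult.assoc)
  have mp: "int p * n = - int m \<longleftrightarrow> p dvd m \<and> n = - int (m div p)" for n
  proof
    assume h: "int p * n = - int m"
    hence "int p dvd - int m" by (metis dvd_triv_left)
    hence "p dvd m" by (simp add: int_dvd_int_iff)
    have "int p * n = int p * (- int (m div p))" using h \<open>p dvd m\<close> by (auto simp flip: of_nat_mult)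
    hence "n = - int (m div p)" by (simp only: mult_cancel_left) simp
    with \<open>p dvd m\<close> show "p dvd m \<and> n = - int (m div p)" by blast
  qed (auto simp flip: of_nat_mult)
  have "of_nat p * hecke_U p (\<lambda>z. ev (bcoeff m) m (\<psi> z)) z =
     ev l (m div p) (\<psi> z) + of_int r * (ev (bcoeff m) m (v z) - of_int (bcoeff m 0)) + 0" if z: "z \<in> \<H>" for z
  proof (rule U_ev_psi[OF _ _ z])
    fix n :: int assume n: "n \<le> 0"
    have "int p * n \<le> 0" using n by (simp add: mult_le_0_iff)
    hence "fls_nth (ev (bcoeff m) m \<Psi>) (int p * n) = (if int p * n = - int m then 1 else 0)"
      using bfls_nth[of "int p * n" m] by (simp only: bfls_def)
    moreover have "fls_nth (ev l (m div p) \<Psi>) n = (if p dvd m then of_nat p * fls_nth (bfls (m div p)) n else 0)"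
      unfolding evl by (simp add: bfls_def fls_of_nat)
    ultimately show "of_nat p * fls_nth (ev (bcoeff m) m \<Psi>) (int p * n) = fls_nth (ev l (m div p) \<Psi>) n + (if n = 0 then 0 else 0)"
      unfolding mp using bfls_nth[OF n, of "m div p"] by simp
  next
    fix n :: int assume n: "n < 0"
    show "(if int p dvd n then of_nat p * fls_nth (ev (bcoeff m) m \<Psi>) n else 0) = (1 + of_int r) * fls_nth (ev (bcoeff m) m \<Psi>) n"
      using bfls_nth[of n m] n unfolding bfls_def by (auto simp: r_def int_dvd_int_iff)
  qed
  hence U: "of_nat p * hecke_U p (bfun m) z - (if p dvd m then of_nat p * bfun (m div p) z else 0) =
     of_int r * (ev (bcoeff m) m (v z) - of_int (bcoeff m 0))" if "z \<in> \<H>" for z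
    using that unfolding evl bfun_def[abs_def] by (simp split: if_splits)
  have "(\<lambda>z. of_int r * (ev (bcoeff m) m (v z) - of_int (bcoeff m 0))) \<in> pspan t 1 (int p ^ (3 * e - a))"
    by (rule pspan_int_mult[OF ev_v_pspan])
  also have "int p ^ (3 * e - a) = int p * int p ^ (3 * e - a - 1)"
  proof -
    have "3 * e - a = Suc (3 * e - a - 1)" using exponents by simp
    thus ?thesis by (metis power_Suc)
  qed
  finally have "(\<lambda>z. of_int r * (ev (bcoeff m) m (v z) - of_int (bcoeff m 0)) / of_int (int p)) \<in> pspan t 1 (int p ^ (3 * e - a - 1))"
    by (rule pspan_divide) simp
  thus ?thesis
  proof (rule pspan.cong)
    fix z assume "z \<in> \<H>"
    from U[OF this, symmetric] show "Qfun m z = of_int r * (ev (bcoeff m) m (v z) - of_int (bcoeff m 0)) / of_int (int p)"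
      by (simp add: Qfun_def diff_divide_distrib)
  qed
qed

lemma U_iter_add: "(hecke_U p ^^ n) (\<lambda>z. f z + g z) = (\<lambda>z. (hecke_U p ^^ n) f z + (hecke_U p ^^ n) g z)"
proof (induction n)
  case (Suc n)
  thus ?case by (simp add: hecke_U_add[abs_def])
qed simp

text \<open>Unrolled, this is the sum over i \<le> \<alpha> of U^(\<beta>-1-i) applied to
  \<open>Qfun (p ^ (\<alpha> - i) * m)\<close>; the chain ends at i = \<alpha> because p does not
  divide m. That last term has undergone U least often, \<beta>-\<alpha>-1 times, and determines the
  exponent.\<close>

lemma U_iter_bfun_pspan:
  assumes m: "m \<ge> 1" "\<not> p dvd m"
  shows "\<alpha> < \<beta> \<Longrightarrow> (hecke_U p ^^ \<beta>) (bfun (p ^ \<alpha> * m)) \<in> pspan t 1 (int p ^ (c * (\<beta> - \<alpha> - 1) + (3 * e - a - 1)))"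
proof (induction \<alpha> arbitrary: \<beta>)
  case 0
  then obtain b where b: "\<beta> = Suc b" by (cases \<beta>) auto
  have "hecke_U p (bfun m) = Qfun m" using m by (simp add: Qfun_def fun_eq_iff)
  thus ?case using U_iter_pspan[OF Qfun_pspan[OF m(1)], of b] b by (simp add: funpow_swap1 power_add)
next
  case (Suc \<alpha>)
  then obtain b where b: "\<beta> = Suc b" "\<alpha> < b" by (cases \<beta>) auto
  define M where "M = p ^ Suc \<alpha> * m"
  have M: "M \<ge> 1" "p dvd M" "M div p = p ^ \<alpha> * m" using m by (auto simp: M_def Suc_le_eq)
  let ?k = "c * (\<beta> - Suc \<alpha> - 1) + (3 * e - a - 1)"
  have "hecke_U p (bfun M) = (\<lambda>z. bfun (p ^ \<alpha> * m) z + Qfun M z)"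
    using M by (simp add: Qfun_def fun_eq_iff)
  hence "(hecke_U p ^^ \<beta>) (bfun M) = (\<lambda>z. (hecke_U p ^^ b) (bfun (p ^ \<alpha> * m)) z + (hecke_U p ^^ b) (Qfun M) z)"
    by (simp add: b funpow_Suc_right U_iter_add del: funpow.simps)
  moreover have "(hecke_U p ^^ b) (bfun (p ^ \<alpha> * m)) \<in> pspan t 1 (int p ^ ?k)"
    using Suc.IH[OF b(2)] b by simp
  moreover have "(hecke_U p ^^ b) (Qfun M) \<in> pspan t 1 (int p ^ ?k)"
  proof (rule pspan_mono[OF U_iter_pspan[OF Qfun_pspan[OF M(1)]]])
    have "c * (\<beta> - Suc \<alpha> - 1) \<le> c * b" using b by (intro mult_left_mono) auto
    thus "int p ^ ?k dvd int p ^ (c * b) * int p ^ (3 * e - a - 1)"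
      unfolding power_add [symmetric] by (intro le_imp_power_dvd) simp
  qed simp
  ultimately show ?case unfolding M_def by (simp add: pspan.add)
qed

section \<open>From lattices of functions to congruences of coefficients\<close>

lemma pspan_qexp:
  assumes "f \<in> pspan t 1 M"
  shows "\<exists>F. qexp f F \<and> (\<forall>n. \<exists>b :: int. fls_nth F n = of_int (int p ^ a * M * b))"
  using assms
proof induction
  case zero
  show ?case using qexp_const[of 0] by (intro exI[of _ 0]) (auto intro: exI[of _ 0])
next
  case (cong f g)
  thus ?case using qexp_cong by metis
next
  case (add f g)
  then obtain F G where FG: "qexp f F" "qexp g G" "\<And>n. \<exists>b :: int. fls_nth F n = of_int (int p ^ a * M * b)"
     "\<And>n. \<exists>b :: int. fls_nth G n = of_int (int p ^ a * M * b)" by blast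
  have "\<exists>b :: int. fls_nth (F + G) n = of_int (int p ^ a * M * b)" for n
  proof -
    obtain b b' :: int where "fls_nth F n = of_int (int p ^ a * M * b)" "fls_nth G n = of_int (int p ^ a * M * b')"
      using FG(3,4)[of n] by blast
    thus ?thesis by (intro exI[of _ "b + b'"]) (simp add: ring_distribs)
  qed
  thus ?case using qexp_add[OF FG(1,2)] by blast
next
  case (mono j d)
  have qt: "qexp t (fls_const (of_nat p ^ a) * \<Phi>)"
    using qexp_cmult[OF qexp_phi, of "of_nat p ^ a"] by (rule qexp_cong) (simp add: t_def)
  define F where "F = fls_const (of_int (M * d)) * (fls_const (of_nat p ^ a) * \<Phi>) ^ j"
  have "qexp (\<lambda>z. of_int (M * d) * t z ^ j) F" unfolding F_def by (intro qexp_cmult qexp_power qt)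
  moreover have "\<exists>b :: int. fls_nth F n = of_int (int p ^ a * M * b)" for n
  proof -
    obtain k where k: "fls_nth (\<Phi> ^ j) n = of_int k"
      using int_fls_nth[OF int_fls_power[OF int_Phi], of j n] by (auto simp: \<Phi>_def elim: Ints_cases)
    \<comment> \<open>Because j \<ge> 1 there is at least one factor p^a; the powers of \<Phi> are
      integral.\<close>
    obtain i where i: "j = Suc i" using mono by (cases j) auto
    have "F = fls_const (of_int (M * d) * (of_nat p ^ a) ^ j) * \<Phi> ^ j"
      by (simp add: F_def power_mult_distrib fls_const_power [symmetric] mult.assoc)
    hence "fls_nth F n = of_int (M * d) * (of_nat p ^ a) ^ j * of_int k" using k by simp
    also have "\<dots> = of_int (int p ^ a * M * (d * (int p ^ a) ^ i * k))" by (simp add: i mult_ac)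
    finally show ?thesis by blast
  qed
  ultimately show ?case by blast
qed

lemma qexp_U_iter: "qexp f F \<Longrightarrow> \<exists>G. qexp ((hecke_U p ^^ n) f) G \<and> (\<forall>i. fls_nth G i = fls_nth F (int p ^ n * i))"
proof (induction n)
  case (Suc n)
  then obtain G where G: "qexp ((hecke_U p ^^ n) f) G" "\<And>i. fls_nth G i = fls_nth F (int p ^ n * i)" by blast
  show ?case using qexp_U[OF G(1) p_pos] G(2)
    by (intro exI[of _ "fls_U p G"]) (simp add: fls_nth_U mult_ac)
qed auto

text \<open>The offset \<open>3 * e - 1 - c\<close> is 8, 3 and 1 for p = 2, 3 and 5.\<close>

abbreviation modulus :: "nat \<Rightarrow> int" where
  "modulus n \<equiv> int p ^ (n + (3 * e - 1 - c))"

lemma bfls_coeff_cong: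
  assumes m: "m \<ge> 1" "\<not> p dvd m" and ab: "\<alpha> < \<beta>"
  shows "\<exists>b :: int. fls_nth (bfls (p ^ \<alpha> * m)) (int (p ^ \<beta> * n)) = of_int (modulus (c * (\<beta> - \<alpha>)) * b)"
proof -
  let ?k = "c * (\<beta> - \<alpha> - 1) + (3 * e - a - 1)"
  obtain F where F: "qexp ((hecke_U p ^^ \<beta>) (bfun (p ^ \<alpha> * m))) F"
    "\<And>n. \<exists>b :: int. fls_nth F n = of_int (int p ^ a * int p ^ ?k * b)"
    using pspan_qexp[OF U_iter_bfun_pspan[OF m ab]] by blast
  obtain G where G: "qexp ((hecke_U p ^^ \<beta>) (bfun (p ^ \<alpha> * m))) G"
    "\<And>i. fls_nth G i = fls_nth (bfls (p ^ \<alpha> * m)) (int p ^ \<beta> * i)"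
    using qexp_U_iter[OF qexp_bfun] by blast
  have "F = G" by (rule qexp_unique[OF F(1) G(1)]) simp
  obtain d where d: "\<beta> - \<alpha> = Suc d" using ab by (cases "\<beta> - \<alpha>") auto
  \<comment> \<open>The scaling exponent a cancels: it enters through the expansion of t and,
    negatively, through v = p^(3e-a) t.\<close>
  have "a + ?k = c * (\<beta> - \<alpha>) + (3 * e - 1 - c)" using exponents by (simp add: d)
  hence "int p ^ a * int p ^ ?k = modulus (c * (\<beta> - \<alpha>))"
    by (simp only: power_add [symmetric])
  thus ?thesis using F(2)[of "int n"] G(2)[of "int n"] unfolding \<open>F = G\<close> by simp
qed

section \<open>Duality between the coefficients\<close>

lemma residue_mult_deriv_Psi_powers:
  "fls_nth (ev k m \<Psi> * fls_deriv (ev l n \<Psi>)) (- 1) = 0"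
proof -
  \<comment> \<open>A derivative has no term of index -1, and (i + j) \<Psi>^i (\<Psi>^j)' is j
    times the derivative of \<Psi>^(i+j). The case j = 0 is treated apart so that i + j can be
    cancelled.\<close>
  have 0: "fls_nth (\<Psi> ^ i * fls_deriv (\<Psi> ^ j)) (- 1) = 0" for i j
  proof (cases "j = 0")
    case False
    then obtain j' where j: "j = Suc j'" by (cases j) auto
    have d: "fls_deriv (\<Psi> ^ Suc n) = of_nat (Suc n) * \<Psi> ^ n * fls_deriv \<Psi>" for n
      using fls_deriv_power[of \<Psi> "Suc n"] by (simp del: power_Suc of_nat_Suc)
    have "of_nat (i + j) * (\<Psi> ^ i * fls_deriv (\<Psi> ^ j)) = of_nat j * fls_deriv (\<Psi> ^ (i + j))"
      unfolding j add_Suc_right d by (simp only: power_add mult_ac)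
    from arg_cong[OF this, of "\<lambda>F. fls_nth F (- 1)"]
    have "of_nat (i + j) * fls_nth (\<Psi> ^ i * fls_deriv (\<Psi> ^ j)) (- 1) = 0"
      unfolding fls_of_nat by (simp only: fls_mult_const_nth fls_deriv_nth) simp
    thus ?thesis using False by (metis add_is_0 mult_eq_0_iff of_nat_eq_0_iff)
  qed simp
  have "ev k m \<Psi> * fls_deriv (ev l n \<Psi>) =
     (\<Sum>i\<le>m. \<Sum>j\<le>n. fls_const (of_int (k i) * of_int (l j)) * (\<Psi> ^ i * fls_deriv (\<Psi> ^ j)))"
    unfolding ev_def of_int_fls fls_deriv_sum sum_product
    by (intro sum.cong refl) (simp add: mult_ac flip: fls_const_mult_const)
  thus ?thesis using 0 by (simp add: fls_nth_sum)
qed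

text \<open>The coefficient of q^(-1) in f_m f_n' pairs index i of f_m with index - i of f_n, with
  weight - i. Among i \<le> 0 only i = - m contributes, among i > 0 only i = n, and the two
  contributions add up to the vanishing residue.\<close>

lemma bfls_duality:
  assumes "m \<ge> 1" "n \<ge> 1"
  shows "of_nat n * fls_nth (bfls m) (int n) = of_nat m * fls_nth (bfls n) (int m)"
proof -
  define A D where "A = bfls m" and "D = fls_deriv (bfls n)"
  define I where "I = {fls_subdegree A..- 1 - fls_subdegree D}"
  define J where "J = {- int m, int n}"
  have out: "fls_nth A i * fls_nth D (- 1 - i) = 0" if "i \<notin> I" for i
    using that by (auto simp: I_def not_le)
  have J0: "fls_nth A i * fls_nth D (- 1 - i) = 0" if "i \<notin> J" for i
  proof (cases "i \<le> 0")
    case True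
    thus ?thesis using that bfls_nth[of i m] by (auto simp: A_def J_def)
  next
    case False
    have "fls_nth (bfls n) (- i) = 0" using False that bfls_nth[of "- i" n] by (simp add: J_def)
    thus ?thesis by (simp add: D_def)
  qed
  have "fls_nth (A * D) (- 1) = (\<Sum>i\<in>I. fls_nth A i * fls_nth D (- 1 - i))"
    unfolding I_def by (rule fls_times_nth)
  also have "\<dots> = (\<Sum>i\<in>I \<union> J. fls_nth A i * fls_nth D (- 1 - i))"
    by (intro sum.mono_neutral_left) (auto simp: I_def J_def out[unfolded I_def])
  also have "\<dots> = (\<Sum>i\<in>J. fls_nth A i * fls_nth D (- 1 - i))"
    by (intro sum.mono_neutral_right) (auto simp: I_def J_def J0[unfolded J_def])
  also have "\<dots> = of_nat m * fls_nth (bfls n) (int m) - of_nat n * fls_nth (bfls m) (int n)"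
  proof -
    have "- int m \<noteq> int n" using assms by simp
    moreover have "fls_nth (bfls m) (- int m) = 1" "fls_nth (bfls n) (- int n) = 1"
      using bfls_nth[of "- int m" m] bfls_nth[of "- int n" n] by simp_all
    ultimately show ?thesis by (simp add: J_def A_def D_def)
  qed
  also have "fls_nth (A * D) (- 1) = 0"
    unfolding A_def D_def bfls_def by (rule residue_mult_deriv_Psi_powers)
  finally show ?thesis by simp
qed

theorem bfls_coeff_cong_0_mod:
  assumes "\<not> p dvd m'" "\<not> p dvd n'" "m' \<ge> 1" "n' \<ge> 1"
  shows "\<alpha> < \<beta> \<Longrightarrow> cong_0_mod (fls_nth (bfls (p ^ \<alpha> * m')) (int (p ^ \<beta> * n'))) (modulus (c * (\<beta> - \<alpha>)))"
    and "\<beta> < \<alpha> \<Longrightarrow> cong_0_mod (fls_nth (bfls (p ^ \<alpha> * m')) (int (p ^ \<beta> * n'))) (modulus (Suc c * (\<alpha> - \<beta>)))"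
proof -
  assume "\<alpha> < \<beta>"
  from bfls_coeff_cong[OF assms(3,1) this, of n']
  obtain b where b: "fls_nth (bfls (p ^ \<alpha> * m')) (int (p ^ \<beta> * n')) = of_int (modulus (c * (\<beta> - \<alpha>)) * b)"
    by blast
  show "cong_0_mod (fls_nth (bfls (p ^ \<alpha> * m')) (int (p ^ \<beta> * n'))) (modulus (c * (\<beta> - \<alpha>)))"
    unfolding cong_0_mod_def cong_0_iff b by (rule exI, rule conjI, rule refl, rule dvd_triv_left)
next
  assume ab: "\<beta> < \<alpha>"
  let ?k = "c * (\<alpha> - \<beta>) + (3 * e - 1 - c)"
  define x where "x = fls_nth (bfls (p ^ \<alpha> * m')) (int (p ^ \<beta> * n'))"
  obtain b where b: "fls_nth (bfls (p ^ \<beta> * n')) (int (p ^ \<alpha> * m')) = of_int (int p ^ ?k * b)"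
    using bfls_coeff_cong[OF assms(4,2) ab, of m'] by blast
  obtain y where y: "x = of_int y"
    using int_fls_nth[OF int_bfls] unfolding x_def by (metis Ints_cases)
  have "of_nat (p ^ \<beta> * n') * x = of_nat (p ^ \<alpha> * m') * of_int (int p ^ ?k * b)"
    unfolding x_def b [symmetric] using assms by (intro bfls_duality) (auto simp: Suc_le_eq)
  hence "(of_int (int p ^ \<beta> * (int n' * y)) :: complex) = of_int (int p ^ \<alpha> * (int m' * (int p ^ ?k * b)))"
    by (simp add: y mult_ac)
  hence "int p ^ \<beta> * (int n' * y) = int p ^ \<alpha> * (int m' * (int p ^ ?k * b))"
    by (simp only: of_int_eq_iff)
  also have "\<dots> = int p ^ \<beta> * (int p ^ (\<alpha> - \<beta>) * (int m' * (int p ^ ?k * b)))"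
    using ab by (simp add: mult.assoc [symmetric] power_add [symmetric])
  finally have "int n' * y = int p ^ (\<alpha> - \<beta>) * (int m' * (int p ^ ?k * b))"
    by (simp only: mult_cancel_left) simp
  \<comment> \<open>The ratio m / n supplies \<alpha> - \<beta> further powers of p, which turns c
    into c + 1.\<close>
  also have "\<dots> = modulus (Suc c * (\<alpha> - \<beta>)) * (int m' * b)"
    by (simp add: power_add mult_ac)
  finally have "modulus (Suc c * (\<alpha> - \<beta>)) dvd int n' * y" by simp
  moreover have "coprime (modulus (Suc c * (\<alpha> - \<beta>))) (int n')"
    using assms(2) prime_p by (simp add: prime_imp_coprime)
  ultimately have "modulus (Suc c * (\<alpha> - \<beta>)) dvd y"
    by (simp only: coprime_dvd_mult_right_iff)
  thus "cong_0_mod (fls_nth (bfls (p ^ \<alpha> * m')) (int (p ^ \<beta> * n'))) (modulus (Suc c * (\<alpha> - \<beta>)))"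
    unfolding x_def [symmetric] y cong_0_mod_def cong_0_iff by blast
qed

section \<open>Transfer of the congruences to higher levels\<close>

definition coeff_divisible :: "nat \<Rightarrow> nat \<Rightarrow> complex \<Rightarrow> bool" where
  "coeff_divisible \<alpha> \<beta> x \<longleftrightarrow> (\<alpha> < \<beta> \<longrightarrow> cong_0_mod x (modulus (c * (\<beta> - \<alpha>)))) \<and>
     (\<beta> < \<alpha> \<longrightarrow> cong_0_mod x (modulus (Suc c * (\<alpha> - \<beta>))))"

definition congruences_hold :: "nat \<Rightarrow> bool" where
  "congruences_hold N \<longleftrightarrow> (\<forall>\<alpha> \<beta> m' n' f F.
     canonical N (p ^ \<alpha> * m') f F \<and> m' \<ge> 1 \<and> n' \<ge> 1 \<and> \<not> p dvd m' \<and> \<not> p dvd n' \<longrightarrow>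
     coeff_divisible \<alpha> \<beta> (fls_nth F (int (p ^ \<beta> * n'))))"

lemma congruences_hold_p: "congruences_hold p"
  unfolding congruences_hold_def coeff_divisible_def using canonical_imp_bfls bfls_coeff_cong_0_mod by blast

text \<open>U divides m and n by p simultaneously, and \<open>coeff_divisible\<close> depends only
  on the difference of \<alpha> and \<beta>. If exactly one of them is 0, the coefficient vanishes;
  if both are 0, nothing is claimed.\<close>

lemma congruences_hold_step:
  assumes N: "congruences_hold N" "p dvd N" "N > 0"
  shows "congruences_hold (p * N)"
  unfolding congruences_hold_def
proof (intro allI impI)
  fix \<alpha> \<beta> m' n' f F
  assume *: "canonical (p * N) (p ^ \<alpha> * m') f F \<and> m' \<ge> 1 \<and> n' \<ge> 1 \<and> \<not> p dvd m' \<and> \<not> p dvd n'"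
  let ?x = "fls_nth F (int (p ^ \<beta> * n'))"
  have zero: "coeff_divisible \<alpha> \<beta> ?x" if "?x = 0"
    unfolding that coeff_divisible_def cong_0_mod_def cong_0_iff by (auto intro: exI[of _ 0])
  note descent = canonical_level_descent[OF conjunct1[OF *] prime_p N(2,3)]
  show "coeff_divisible \<alpha> \<beta> ?x"
  proof (cases \<alpha>)
    case 0
    show ?thesis
    proof (cases \<beta>)
      case (Suc b)
      hence "?x = 0" using * 0 by (intro descent(2)) auto
      thus ?thesis by (rule zero)
    qed (simp add: 0 coeff_divisible_def)
  next
    case (Suc a')
    show ?thesis
    proof (cases \<beta>)
      case 0
      hence "?x = 0" using * Suc by (intro descent(3)) (auto simp: int_dvd_int_iff)
      thus ?thesis by (rule zero)
    next
      case (Suc b')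
      have "canonical N (p ^ a' * m') (hecke_U p f) (fls_U p F)"
        using descent(1) \<open>\<alpha> = Suc a'\<close> by (simp add: mult.assoc)
      hence "coeff_divisible a' b' (fls_nth (fls_U p F) (int (p ^ b' * n')))"
        using N(1) * unfolding congruences_hold_def by blast
      moreover have "fls_nth (fls_U p F) (int (p ^ b' * n')) = ?x"
        by (simp add: fls_nth_U Suc mult_ac)
      ultimately show ?thesis using Suc \<open>\<alpha> = Suc a'\<close> by (simp add: coeff_divisible_def)
    qed
  qed
qed

end

theorem theorem5:
  fixes N p m n m' n' \<alpha> \<beta> :: nat
    and f :: "complex \<Rightarrow> complex" and F :: "complex fls"
  assumes "N \<in> {8, 9, 16, 25}"
    and "prime p" and "p dvd N"
    and "m \<ge> 1" and "n \<ge> 1"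
    and "m = p ^ \<alpha> * m'" and "n = p ^ \<beta> * n'"
    and "coprime m' N" and "coprime n' N"
    and "canonical_basis_element N m f F"
    and "\<alpha> \<noteq> \<beta>"
  shows "
    (N \<in> {8, 16} \<and> \<alpha> > \<beta> \<longrightarrow> cong_0_mod (fls_nth F (int n)) (2 ^ (4 * (\<alpha> - \<beta>) + 8))) \<and>
    (N \<in> {8, 16} \<and> \<beta> > \<alpha> \<longrightarrow> cong_0_mod (fls_nth F (int n)) (2 ^ (3 * (\<beta> - \<alpha>) + 8))) \<and>
    (N = 9 \<and> \<alpha> > \<beta> \<longrightarrow> cong_0_mod (fls_nth F (int n)) (3 ^ (3 * (\<alpha> - \<beta>) + 3))) \<and>
    (N = 9 \<and> \<beta> > \<alpha> \<longrightarrow> cong_0_mod (fls_nth F (int n)) (3 ^ (2 * (\<beta> - \<alpha>) + 3))) \<and>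
    (N = 25 \<and> \<alpha> > \<beta> \<longrightarrow> cong_0_mod (fls_nth F (int n)) (5 ^ (2 * (\<alpha> - \<beta>) + 1))) \<and>
    (N = 25 \<and> \<beta> > \<alpha> \<longrightarrow> cong_0_mod (fls_nth F (int n)) (5 ^ ((\<beta> - \<alpha>) + 1)))"
proof -
  interpret L2: genus_zero_level 2 4 8 3 by unfold_locales simp
  interpret L3: genus_zero_level 3 2 4 2 by unfold_locales simp
  interpret L5: genus_zero_level 5 1 2 1 by unfold_locales simp
  have can: "canonical N (p ^ \<alpha> * m') f F"
    using canonical_basis_element_imp_canonical assms(6,10) by simp
  have pos: "m' \<ge> 1" "n' \<ge> 1" using assms(4-7) by (auto simp: Suc_le_eq)
  have nd: "\<not> p dvd m'" "\<not> p dvd n'"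
    using assms(2,3,8,9) by (meson coprime_common_divisor not_prime_unit)+
  \<comment> \<open>Level 2 is lifted through 4 to 8 and once more to 16.\<close>
  have 8: "L2.congruences_hold 8" "L2.congruences_hold 16"
    using L2.congruences_hold_step[OF L2.congruences_hold_p] L2.congruences_hold_step[of 4] L2.congruences_hold_step[of 8]
    by simp_all
  have 9: "L3.congruences_hold 9" and 25: "L5.congruences_hold 25"
    using L3.congruences_hold_step[OF L3.congruences_hold_p] L5.congruences_hold_step[OF L5.congruences_hold_p]
    by simp_all
  from assms(1) consider "N = 8 \<or> N = 16" | "N = 9" | "N = 25" by auto
  thus ?thesis
  proof cases
    case 1
    hence "N = 2 ^ 3 \<or> N = 2 ^ 4" by auto
    hence "p dvd 2" using assms(2,3) prime_dvd_power by blast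
    hence p: "p = 2" using assms(2) by (simp add: primes_dvd_imp_eq)
    have "L2.congruences_hold N" using 1 8 by auto
    thus ?thesis using 1 can pos nd assms(7,11) unfolding L2.congruences_hold_def L2.coeff_divisible_def p by auto
  next
    case 2
    hence "N = 3 ^ 2" by simp
    hence "p dvd 3" using assms(2,3) prime_dvd_power by blast
    hence p: "p = 3" using assms(2) by (simp add: primes_dvd_imp_eq)
    thus ?thesis using 2 9 can pos nd assms(7,11) unfolding L3.congruences_hold_def L3.coeff_divisible_def p by auto
  next
    case 3
    hence "N = 5 ^ 2" by simp
    hence "p dvd 5" using assms(2,3) prime_dvd_power by blast
    hence p: "p = 5" using assms(2) by (simp add: primes_dvd_imp_eq)
    have exps: "Suc 1 * k + (3 * 1 - 1 - 1) = 2 * k + 1" "1 * k + (3 * 1 - 1 - 1) = k + 1" for k :: nat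
      by simp_all
    from 25 show ?thesis using 3 can pos nd assms(7,11) unfolding L5.congruences_hold_def L5.coeff_divisible_def p exps by auto
  qed
qed

end
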